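(* Let $A$ be a Nakayama algebra and $S$ a simple $A$-module. Then $\operatorname{del}(S)=e(S)$.
   Context: A Nakayama algebra is a finite dimensional connected quiver algebra $KQ/I$ over a field $K$ (admissible $I$) such that every indecomposable left and right module is uniserial (the quiver is a linearly oriented line or cycle). Modules are finitely generated right modules. For a simple $S$, $I(S)$ is its injective envelope and $e(S)=\min\{\operatorname{pdim}S,\operatorname{pdim}I(S)\}$. $\Omega$ denotes the syzygy, $\Omega^0(M)=M$. A module is a $k$-th syzygy module if it is of the form $\Omega^k(N)\oplus P$ for some module $N$ and projective module $P$. The delooping level of a module $M$ is $\operatorname{del}(M)=\inf\{t\ge0\mid \Omega^t(M)\text{ is a }(t+1)\text{-th syzygy module}\}$. *)

theory Defs
  imports "HOL-Library.Extended_Nat"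
begin

text \<open>A Nakayama algebra KQ/I: Q has vertices 0..nv-1 with arrows i -> succ i;
  Q is a linearly oriented line (cyc = False) or an oriented cycle (cyc = True).
  A path is a pair (i, l): start vertex i and length l.  An element of KQ is a
  finitely supported K-linear combination of paths, i.e. a map (nat*nat) => K.
  The admissible ideal I is a set of such elements.\<close>

record 'k nak =
  nv  :: nat
  cyc :: bool
  rel :: "((nat \<times> nat) \<Rightarrow> 'k) set"

definition tgt :: "'k nak \<Rightarrow> nat \<Rightarrow> nat \<Rightarrow> nat" where
  "tgt A i l = (if cyc A then (i + l) mod nv A else i + l)"

definition valid_path :: "'k nak \<Rightarrow> nat \<Rightarrow> nat \<Rightarrow> bool" where
  "valid_path A i l \<longleftrightarrow> i < nv A \<and> (cyc A \<or> i + l < nv A)"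

definition path_elem :: "nat \<Rightarrow> nat \<Rightarrow> (nat \<times> nat) \<Rightarrow> 'k::field" where
  "path_elem i l = (\<lambda>p. if p = (i, l) then 1 else 0)"

text \<open>Multiplication by idempotents and arrows (on either side).\<close>
definition keep_start :: "nat \<Rightarrow> ((nat \<times> nat) \<Rightarrow> 'k::field) \<Rightarrow> (nat \<times> nat) \<Rightarrow> 'k" where
  "keep_start j \<rho> = (\<lambda>(i, l). if i = j then \<rho> (i, l) else 0)"

definition keep_end :: "'k::field nak \<Rightarrow> nat \<Rightarrow> ((nat \<times> nat) \<Rightarrow> 'k) \<Rightarrow> (nat \<times> nat) \<Rightarrow> 'k" where
  "keep_end A j \<rho> = (\<lambda>(i, l). if tgt A i l = j then \<rho> (i, l) else 0)"

definition arrow_end :: "'k::field nak \<Rightarrow> nat \<Rightarrow> ((nat \<times> nat) \<Rightarrow> 'k) \<Rightarrow> (nat \<times> nat) \<Rightarrow> 'k" where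
  "arrow_end A j \<rho> = (\<lambda>(i, l). if 1 \<le> l \<and> valid_path A i l \<and> tgt A i (l - 1) = j
                                 then \<rho> (i, l - 1) else 0)"

definition arrow_start :: "'k::field nak \<Rightarrow> nat \<Rightarrow> ((nat \<times> nat) \<Rightarrow> 'k) \<Rightarrow> (nat \<times> nat) \<Rightarrow> 'k" where
  "arrow_start A j \<rho> = (\<lambda>(i, l). if 1 \<le> l \<and> valid_path A i l \<and> i = j
                                 then \<rho> (tgt A j 1, l - 1) else 0)"

definition nakayama :: "'k::field nak \<Rightarrow> bool" where
  "nakayama A \<longleftrightarrow>
     nv A \<ge> 1 \<and>
     \<comment> \<open>elements of I are elements of KQ\<close>
     (\<forall>\<rho>\<in>rel A. finite {p. \<rho> p \<noteq> 0} \<and> (\<forall>i l. \<rho> (i, l) \<noteq> 0 \<longrightarrow> valid_path A i l)) \<and>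
     \<comment> \<open>I is a two-sided ideal of KQ\<close>
     (\<lambda>_. 0) \<in> rel A \<and>
     (\<forall>\<rho>\<in>rel A. \<forall>\<sigma>\<in>rel A. (\<lambda>p. \<rho> p + \<sigma> p) \<in> rel A) \<and>
     (\<forall>\<rho>\<in>rel A. \<forall>c. (\<lambda>p. c * \<rho> p) \<in> rel A) \<and>
     (\<forall>\<rho>\<in>rel A. \<forall>j<nv A. keep_start j \<rho> \<in> rel A \<and> keep_end A j \<rho> \<in> rel A \<and>
        arrow_end A j \<rho> \<in> rel A \<and> arrow_start A j \<rho> \<in> rel A) \<and>
     \<comment> \<open>I is admissible: R^m \<subseteq> I \<subseteq> R^2\<close>
     (\<forall>\<rho>\<in>rel A. \<forall>i l. \<rho> (i, l) \<noteq> 0 \<longrightarrow> 2 \<le> l) \<and>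
     (\<exists>m\<ge>2. \<forall>i l. valid_path A i l \<and> m \<le> l \<longrightarrow> path_elem i l \<in> rel A)"

text \<open>V_i = K^(dm i) (vectors: nat => K vanishing from dm i on);
  ar i is the matrix (dm (succ i)) x (dm i) of the arrow starting at i.\<close>

record 'k rep =
  dm :: "nat \<Rightarrow> nat"
  ar :: "nat \<Rightarrow> nat \<Rightarrow> nat \<Rightarrow> 'k"

definition vec :: "nat \<Rightarrow> (nat \<Rightarrow> 'k::zero) set" where
  "vec d = {v. \<forall>j\<ge>d. v j = 0}"

definition amap :: "(nat \<Rightarrow> nat \<Rightarrow> 'k::field) \<Rightarrow> nat \<Rightarrow> (nat \<Rightarrow> 'k) \<Rightarrow> nat \<Rightarrow> 'k" where
  "amap B m v = (\<lambda>r. \<Sum>j<m. B r j * v j)"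

definition mmul :: "(nat \<Rightarrow> nat \<Rightarrow> 'k::field) \<Rightarrow> (nat \<Rightarrow> nat \<Rightarrow> 'k) \<Rightarrow> nat \<Rightarrow> nat \<Rightarrow> nat \<Rightarrow> 'k" where
  "mmul B C m = (\<lambda>r c. \<Sum>j<m. B r j * C j c)"

definition wf_mat :: "(nat \<Rightarrow> nat \<Rightarrow> 'k::zero) \<Rightarrow> nat \<Rightarrow> nat \<Rightarrow> bool" where
  "wf_mat B r c \<longleftrightarrow> (\<forall>i j. (r \<le> i \<or> c \<le> j) \<longrightarrow> B i j = 0)"

primrec pmap :: "'k::field nak \<Rightarrow> 'k rep \<Rightarrow> nat \<Rightarrow> nat \<Rightarrow> (nat \<Rightarrow> 'k) \<Rightarrow> nat \<Rightarrow> 'k" where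
  "pmap A M i 0 v = v"
| "pmap A M i (Suc l) v = amap (ar M (tgt A i l)) (dm M (tgt A i l)) (pmap A M i l v)"

definition annihilates :: "'k::field nak \<Rightarrow> 'k rep \<Rightarrow> ((nat \<times> nat) \<Rightarrow> 'k) \<Rightarrow> bool" where
  "annihilates A M \<rho> \<longleftrightarrow>
     (\<forall>i j v r. v \<in> vec (dm M i) \<longrightarrow>
        (\<Sum>l\<in>{l. \<rho> (i, l) \<noteq> 0 \<and> tgt A i l = j}. \<rho> (i, l) * pmap A M i l v r) = 0)"

definition wfA :: "'k::field nak \<Rightarrow> 'k rep \<Rightarrow> bool" where
  "wfA A M \<longleftrightarrow>
     (\<forall>i\<ge>nv A. dm M i = 0) \<and>
     (\<forall>i. wf_mat (ar M i) (dm M (tgt A i 1)) (dm M i)) \<and>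
     (\<forall>i. \<not> valid_path A i 1 \<longrightarrow> ar M i = (\<lambda>_ _. 0)) \<and>
     (\<forall>\<rho>\<in>rel A. annihilates A M \<rho>)"

type_synonym 'k hm = "nat \<Rightarrow> nat \<Rightarrow> nat \<Rightarrow> 'k"

definition hom :: "'k::field nak \<Rightarrow> 'k rep \<Rightarrow> 'k rep \<Rightarrow> 'k hm \<Rightarrow> bool" where
  "hom A M N f \<longleftrightarrow> wfA A M \<and> wfA A N \<and>
     (\<forall>i. wf_mat (f i) (dm N i) (dm M i)) \<and>
     (\<forall>i v. v \<in> vec (dm M i) \<longrightarrow>
        amap (ar N i) (dm N i) (amap (f i) (dm M i) v)
        = amap (f (tgt A i 1)) (dm M (tgt A i 1)) (amap (ar M i) (dm M i) v))"

definition hcomp :: "'k::field rep \<Rightarrow> 'k hm \<Rightarrow> 'k hm \<Rightarrow> 'k hm" where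
  "hcomp N g f = (\<lambda>i. mmul (g i) (f i) (dm N i))"

definition monic :: "'k::field rep \<Rightarrow> 'k hm \<Rightarrow> bool" where
  "monic M f \<longleftrightarrow> (\<forall>i v. v \<in> vec (dm M i) \<and> amap (f i) (dm M i) v = (\<lambda>_. 0) \<longrightarrow> v = (\<lambda>_. 0))"

definition epi :: "'k::field rep \<Rightarrow> 'k rep \<Rightarrow> 'k hm \<Rightarrow> bool" where
  "epi M N f \<longleftrightarrow> (\<forall>i w. w \<in> vec (dm N i) \<longrightarrow> (\<exists>v\<in>vec (dm M i). amap (f i) (dm M i) v = w))"

definition exact :: "'k::field rep \<Rightarrow> 'k rep \<Rightarrow> 'k hm \<Rightarrow> 'k hm \<Rightarrow> bool" where
  "exact L M g f \<longleftrightarrow> (\<forall>i v. v \<in> vec (dm M i) \<longrightarrow>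
      (amap (f i) (dm M i) v = (\<lambda>_. 0) \<longleftrightarrow> (\<exists>u\<in>vec (dm L i). amap (g i) (dm L i) u = v)))"

definition iso :: "'k::field nak \<Rightarrow> 'k rep \<Rightarrow> 'k rep \<Rightarrow> bool" where
  "iso A M N \<longleftrightarrow> (\<exists>f. hom A M N f \<and> monic M f \<and> epi M N f)"

definition zero_rep :: "'k rep \<Rightarrow> bool" where
  "zero_rep M \<longleftrightarrow> (\<forall>i. dm M i = 0)"

definition dsum :: "'k::field nak \<Rightarrow> 'k rep \<Rightarrow> 'k rep \<Rightarrow> 'k rep" where
  "dsum A M N =
     \<lparr> dm = (\<lambda>i. dm M i + dm N i),
       ar = (\<lambda>i r c. if r < dm M (tgt A i 1) \<and> c < dm M i then ar M i r c
                      else if dm M (tgt A i 1) \<le> r \<and> dm M i \<le> c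
                      then ar N i (r - dm M (tgt A i 1)) (c - dm M i) else 0) \<rparr>"

definition projective :: "'k::field nak \<Rightarrow> 'k rep \<Rightarrow> bool" where
  "projective A P \<longleftrightarrow> wfA A P \<and>
     (\<forall>X Y g f. hom A X Y g \<and> epi X Y g \<and> hom A P Y f \<longrightarrow>
        (\<exists>h. hom A P X h \<and> hcomp X g h = f))"

definition injective :: "'k::field nak \<Rightarrow> 'k rep \<Rightarrow> bool" where
  "injective A E \<longleftrightarrow> wfA A E \<and>
     (\<forall>X Y g f. hom A X Y g \<and> monic X g \<and> hom A X E f \<longrightarrow>
        (\<exists>h. hom A Y E h \<and> hcomp Y h g = f))"

definition proj_cover :: "'k::field nak \<Rightarrow> 'k rep \<Rightarrow> 'k rep \<Rightarrow> 'k hm \<Rightarrow> bool" where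
  "proj_cover A P M p \<longleftrightarrow> projective A P \<and> hom A P M p \<and> epi P M p \<and>
     (\<forall>Z g. hom A Z P g \<and> epi Z M (hcomp P p g) \<longrightarrow> epi Z P g)"

definition inj_envelope :: "'k::field nak \<Rightarrow> 'k rep \<Rightarrow> 'k rep \<Rightarrow> 'k hm \<Rightarrow> bool" where
  "inj_envelope A S E \<iota> \<longleftrightarrow> injective A E \<and> hom A S E \<iota> \<and> monic S \<iota> \<and>
     (\<forall>Z g. hom A E Z g \<and> monic S (hcomp E g \<iota>) \<longrightarrow> monic E g)"

definition simple_mod :: "'k::field nak \<Rightarrow> 'k rep \<Rightarrow> bool" where
  "simple_mod A S \<longleftrightarrow> wfA A S \<and> \<not> zero_rep S \<and>
     (\<forall>X g. hom A X S g \<and> monic X g \<longrightarrow> zero_rep X \<or> epi X S g)"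

definition omega1 :: "'k::field nak \<Rightarrow> 'k rep \<Rightarrow> 'k rep \<Rightarrow> bool" where
  "omega1 A M X \<longleftrightarrow> (\<exists>P p k. proj_cover A P M p \<and> hom A X P k \<and> monic X k \<and> exact X P k p)"

primrec syz :: "'k::field nak \<Rightarrow> nat \<Rightarrow> 'k rep \<Rightarrow> 'k rep \<Rightarrow> bool" where
  "syz A 0 M X = iso A M X"
| "syz A (Suc k) M X = (\<exists>Y. syz A k M Y \<and> omega1 A Y X)"

definition kth_syzygy_module :: "'k::field nak \<Rightarrow> nat \<Rightarrow> 'k rep \<Rightarrow> bool" where
  "kth_syzygy_module A k X \<longleftrightarrow>
     (\<exists>N Z P. wfA A N \<and> syz A k N Z \<and> projective A P \<and> iso A X (dsum A Z P))"

definition delooping_level :: "'k::field nak \<Rightarrow> 'k rep \<Rightarrow> enat" where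
  "delooping_level A M =
     Inf {enat t | t. \<exists>X. syz A t M X \<and> kth_syzygy_module A (t + 1) X}"

text \<open>projective dimension: least m admitting a projective resolution
  0 -> C(m+1) -> ... -> C 1 -> C 0 = M -> 0 (maps f k : C (k+1) -> C k)\<close>
definition pdim :: "'k::field nak \<Rightarrow> 'k rep \<Rightarrow> enat" where
  "pdim A M = Inf {enat m | m. \<exists>C f. C 0 = M \<and>
      (\<forall>k\<le>m. hom A (C (Suc k)) (C k) (f k)) \<and>
      (\<forall>k. 1 \<le> k \<and> k \<le> m + 1 \<longrightarrow> projective A (C k)) \<and>
      epi (C 1) (C 0) (f 0) \<and>
      (\<forall>k. 1 \<le> k \<and> k \<le> m \<longrightarrow> exact (C (Suc k)) (C k) (f k) (f (k - 1))) \<and>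
      monic (C (Suc m)) (f m)}"

text \<open>e(S) = min(pdim S, pdim I(S)), I(S) the injective envelope (unique up to iso)\<close>
definition e_inv :: "'k::field nak \<Rightarrow> 'k rep \<Rightarrow> enat" where
  "e_inv A S = min (pdim A S) (pdim A (SOME E. \<exists>\<iota>. inj_envelope A S E \<iota>))"

end

theory Submission
  imports Defs "HOL-Library.Function_Algebras" "HOL.Vector_Spaces"
begin

text \<open>Syzygies of uniserial modules are uniserial, and a uniserial module is a half-open interval \<open>[a, b)\<close> of the
  unrolled quiver, with top at \<open>a\<close>. Let \<open>f a\<close> be the right end of the indecomposable projective
  starting at \<open>a\<close>; \<open>f\<close> is monotone. The first syzygy of \<open>[a, b)\<close> is \<open>[b, f a)\<close>, so the syzygies run
  through consecutive terms of \<open>a, b, f a, f b, f (f a), \<dots>\<close> until two neighbours agree. For a simple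
  module \<open>[a, a + 1)\<close> with injective envelope \<open>[g, a + 1)\<close>, both projective dimensions are thereby
  determined by \<open>f\<close>.

  For arbitrary \<open>N\<close> no decomposition theorem is needed: the vertices in the top of \<open>\<Omega>\<^sup>2 N\<close> are images
  under \<open>f\<close> of vertices in the top of \<open>N\<close>, and the right ends of the socle of \<open>\<Omega> N\<close> are such images too.
  Hence if the syzygy of order \<open>2 k\<close> or \<open>2 k + 1\<close> of \<open>[a, a + 1)\<close> is not projective and is a syzygy of one
  order more, then \<open>f\<^sup>k (a + 1)\<close> lies in the image of \<open>f\<close> iterated \<open>k + 1\<close> times. Minimality of \<open>g\<close> and
  monotonicity force either \<open>f\<^sup>k\<^sup>+\<^sup>1 g = f\<^sup>k (a + 1)\<close> or \<open>f\<^sup>k a = f\<^sup>k (a + 1)\<close>, which bounds one of the two projective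
  dimensions. Conversely \<open>f\<^sup>k\<^sup>+\<^sup>1 g = f\<^sup>k (a + 1)\<close> identifies the syzygy of order \<open>2 k\<close> of \<open>[a, a + 1)\<close> with
  the syzygy of order \<open>2 k + 1\<close> of \<open>[g, a)\<close>.\<close>

text \<open>The exponents come from the alternation in \<open>seq\<close>: the position f^k (a + 1)
  is the right end of the syzygy of order 2 k of the simple module and the top of the one of order 2
  k + 1. Syzygies of order 2 k + 1 have their socle ends, and those of order 2 k + 2 their tops, in
  the image of f iterated k + 1 times, so both parities yield the same condition. Two obstacles
  shape the proof. First, \<open>N\<close> and the projective summand are arbitrary, so only the
  sets of top and socle vertices are followed; they can only grow when a summand is added, and for a
  nonzero interval each is a single vertex. Second, on a cycle a vertex fixes a position only up to
  the period. Positions are natural numbers, so minimality of g is required at all its translates by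
  multiples of the period, which also accounts for starting points to the left of 0. Finally,
  \<open>pdim\<close> ranges over all resolutions, while intervals see only the minimal one; a
  separate comparison shows that no resolution stops earlier.\<close>

section \<open>Linear algebra of coordinate vectors\<close>

text \<open>As simplification rules these would eta-expand vectors that occur as arguments.\<close>

declare zero_fun_apply [simp del] plus_fun_apply [simp del] minus_apply [simp del] uminus_apply [simp del]

text \<open>All vertex spaces live inside one vector space, the functions from \<open>nat\<close> to
  the field, with \<open>vec d\<close> as subspaces. A single interpretation of the vector space
  locale then serves every dimension.\<close>

definition scl :: "'k::field \<Rightarrow> (nat \<Rightarrow> 'k) \<Rightarrow> nat \<Rightarrow> 'k" where
  "scl c v = (\<lambda>j. c * v j)"

interpretation fv: vector_space "scl :: 'k::field \<Rightarrow> (nat \<Rightarrow> 'k) \<Rightarrow> nat \<Rightarrow> 'k"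
  by unfold_locales (auto simp: scl_def fun_eq_iff plus_fun_apply algebra_simps)

interpretation fp: vector_space_pair
  "scl :: 'k::field \<Rightarrow> (nat \<Rightarrow> 'k) \<Rightarrow> nat \<Rightarrow> 'k" "scl :: 'k \<Rightarrow> (nat \<Rightarrow> 'k) \<Rightarrow> nat \<Rightarrow> 'k"
  by unfold_locales

abbreviation lin :: "((nat \<Rightarrow> 'k::field) \<Rightarrow> nat \<Rightarrow> 'k) \<Rightarrow> bool" where
  "lin \<equiv> Vector_Spaces.linear scl scl"

definition lfun :: "((nat \<Rightarrow> 'k::field) \<Rightarrow> 'k) \<Rightarrow> bool" where
  "lfun \<phi> \<longleftrightarrow> (\<forall>u v. \<phi> (u + v) = \<phi> u + \<phi> v) \<and> (\<forall>c v. \<phi> (scl c v) = c * \<phi> v)"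

lemma linI:
  assumes "\<And>u v. F (u + v) = F u + F v" and "\<And>c v. F (scl c v) = scl c (F v)"
  shows "lin F"
  by unfold_locales (use assms in auto)

lemma lfun_add: "lfun \<phi> \<Longrightarrow> \<phi> (u + v) = \<phi> u + \<phi> v"
  and lfun_scl: "lfun \<phi> \<Longrightarrow> \<phi> (scl c v) = c * \<phi> v"
  by (simp_all add: lfun_def)

lemma lfun_0: "lfun \<phi> \<Longrightarrow> \<phi> 0 = 0"
  using lfun_scl[of \<phi> 0 0] by simp

lemma lfun_diff: "lfun \<phi> \<Longrightarrow> \<phi> (u - v) = \<phi> u - \<phi> v"
  using lfun_add[of \<phi> "u - v" v] by simp

lemma lam_zero: "(\<lambda>_. 0) = 0"
  by (simp add: zero_fun_def)

lemma scl_apply: "scl c v j = c * v j"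
  by (simp add: scl_def)

lemma sum_fun_app: "(\<Sum>x\<in>S. f x) r = (\<Sum>x\<in>S. f x r)"
  for f :: "'a \<Rightarrow> 'b \<Rightarrow> 'c::comm_monoid_add"
  by (induction S rule: infinite_finite_induct) (auto simp: plus_fun_apply zero_fun_apply)

lemmas vapp = zero_fun_apply plus_fun_apply minus_apply scl_apply sum_fun_app

lemma vec_subspace: "fv.subspace (vec d)"
  by (auto simp: fv.subspace_def vec_def vapp)

lemmas vec_0 [simp, intro] = fv.subspace_0[OF vec_subspace]
lemmas vec_add [intro] = fv.subspace_add[OF vec_subspace]
lemmas vec_diff [intro] = fv.subspace_diff[OF vec_subspace]
lemmas vec_scl [intro] = fv.subspace_scale[OF vec_subspace]
lemmas vec_sum [intro] = fv.subspace_sum[OF vec_subspace]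

lemma vec_zero_dim: "v \<in> vec 0 \<longleftrightarrow> v = 0"
  by (auto simp: vec_def fun_eq_iff vapp)

lemma lin_amap: "lin (amap B m)"
  by (rule linI; rule ext)
    (simp_all add: vapp amap_def distrib_left sum.distrib sum_distrib_left mult.left_commute)

lemmas amap_add = fp.linear_add[OF lin_amap]
lemmas amap_diff = fp.linear_diff[OF lin_amap]
lemmas amap_scl = fp.linear_scale[OF lin_amap]
lemmas amap_0 [simp] = fp.linear_0[OF lin_amap]
lemmas amap_sum = fp.linear_sum[OF lin_amap]

lemma amap_vec: "wf_mat B r c \<Longrightarrow> amap B c v \<in> vec r"
  by (auto simp: wf_mat_def vec_def amap_def)

lemma amap_mmul: "amap (mmul B C m) n v = amap B m (amap C n v)"
proof
  fix r
  have "amap (mmul B C m) n v r = (\<Sum>j<n. \<Sum>k<m. B r k * C k j * v j)"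
    by (simp add: amap_def mmul_def sum_distrib_right)
  also have "\<dots> = (\<Sum>k<m. \<Sum>j<n. B r k * C k j * v j)"
    by (rule sum.swap)
  also have "\<dots> = amap B m (amap C n v) r"
    by (simp add: amap_def sum_distrib_left mult.assoc)
  finally show "amap (mmul B C m) n v r = amap B m (amap C n v) r" .
qed

lemma wf_mmul: "wf_mat B r m \<Longrightarrow> wf_mat C m c \<Longrightarrow> wf_mat (mmul B C m) r c"
  by (auto simp: wf_mat_def mmul_def)

definition uvec :: "nat \<Rightarrow> nat \<Rightarrow> 'k::field" where
  "uvec j = (\<lambda>r. if r = j then 1 else 0)"

lemma uvec_vec [simp]: "uvec j \<in> vec d \<longleftrightarrow> j < d"
  by (auto simp: uvec_def vec_def not_less)

lemma amap_uvec: "j < m \<Longrightarrow> amap B m (uvec j) = (\<lambda>r. B r j)"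
  by (auto simp: amap_def uvec_def fun_eq_iff if_distrib [of "\<lambda>x. _ * x"] cong: if_cong)

lemma vec_expand: "v \<in> vec d \<Longrightarrow> v = (\<Sum>j<d. scl (v j) (uvec j))"
  by (auto simp: fun_eq_iff vapp uvec_def vec_def if_distrib [of "\<lambda>x. _ * x"] cong: if_cong)

lemma wf_mat_eqI:
  assumes "wf_mat B r c" "wf_mat C r c" "\<And>v. v \<in> vec c \<Longrightarrow> amap B c v = amap C c v"
  shows "B = C"
proof (intro ext)
  fix i j
  show "B i j = C i j"
  proof (cases "j < c")
    case True
    with assms(3)[of "uvec j"] show ?thesis by (simp add: amap_uvec fun_eq_iff)
  next
    case False
    with assms(1,2) show ?thesis by (auto simp: wf_mat_def)
  qed
qed

text \<open>Linearity is assumed only on \<open>vec c\<close>, because maps built from chosen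
  coefficients, such as \<open>cof\<close> below, are linear only there.\<close>

lemma matrix_of_linear:
  assumes "\<And>u v. u \<in> vec c \<Longrightarrow> v \<in> vec c \<Longrightarrow> F (u + v) = F u + F v"
    and "\<And>a v. v \<in> vec c \<Longrightarrow> F (scl a v) = scl a (F v)"
    and "\<And>v. v \<in> vec c \<Longrightarrow> F v \<in> vec r"
  shows "\<exists>B. wf_mat B r c \<and> (\<forall>v\<in>vec c. amap B c v = F v)"
proof -
  define B where "B = (\<lambda>i j. if j < c then F (uvec j) i else 0)"
  have "wf_mat B r c"
    using assms(3) by (auto simp: wf_mat_def B_def vec_def uvec_def)
  moreover have "amap B c v = F v" if v: "v \<in> vec c" for v
  proof -
    have F0: "F 0 = 0" using assms(2)[of 0 0] by simp
    have *: "F (\<Sum>j\<in>J. scl (v j) (uvec j)) = (\<Sum>j\<in>J. scl (v j) (F (uvec j)))"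
      if "finite J" "J \<subseteq> {..<c}" for J
      using that
    proof (induction J rule: finite_induct)
      case (insert x J)
      have "(\<Sum>j\<in>J. scl (v j) (uvec j)) \<in> vec c"
        using insert.prems by (intro vec_sum vec_scl) auto
      moreover have "scl (v x) (uvec x) \<in> vec c" "uvec x \<in> vec c"
        using insert.prems by (auto intro!: vec_scl)
      ultimately have "F (scl (v x) (uvec x) + (\<Sum>j\<in>J. scl (v j) (uvec j)))
          = scl (v x) (F (uvec x)) + F (\<Sum>j\<in>J. scl (v j) (uvec j))"
        by (metis assms(1,2))
      then show ?case using insert by simp
    qed (simp add: F0)
    have "F v = (\<Sum>j<c. scl (v j) (F (uvec j)))"
      by (subst vec_expand[OF v], rule *) auto
    then show ?thesis
      by (auto simp: fun_eq_iff vapp amap_def B_def mult.commute)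
  qed
  ultimately show ?thesis by blast
qed

text \<open>A representation records only dimensions, so a subspace becomes a vertex space only
  through a basis; the columns of \<open>B\<close> are one.\<close>

lemma subspace_as_image:
  assumes U: "fv.subspace U" "U \<subseteq> vec d"
  shows "\<exists>m B. wf_mat B d m \<and> (\<forall>v\<in>vec m. amap B m v = 0 \<longrightarrow> v = 0) \<and> amap B m ` vec m = U"
proof -
  obtain S where S: "S \<subseteq> U" "fv.independent S" "U \<subseteq> fv.span S"
    using fv.maximal_independent_subset by blast
  have "vec d \<subseteq> fv.span (uvec ` {..<d} :: (nat \<Rightarrow> 'a) set)"
  proof
    fix v :: "nat \<Rightarrow> 'a" assume v: "v \<in> vec d"
    show "v \<in> fv.span (uvec ` {..<d})"
      by (subst vec_expand[OF v]) (auto intro!: fv.span_sum fv.span_scale intro: fv.span_base)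
  qed
  then have "S \<subseteq> fv.span (uvec ` {..<d})" using S(1) U(2) by blast
  then have finS: "finite S"
    using fv.independent_span_bound[of "uvec ` {..<d}" S] S(2) by simp
  obtain h where h: "bij_betw h {..<card S} S"
    using ex_bij_betw_nat_finite[OF finS] by (auto simp: atLeast0LessThan)
  define m where "m = card S"
  define B where "B = (\<lambda>r j. if j < m then h j r else 0)"
  have hS: "h j \<in> S" if "j < m" for j
    using h that by (auto simp: bij_betw_def m_def)
  have wf: "wf_mat B d m"
    using hS S(1) U(2) by (force simp: wf_mat_def B_def vec_def)
  have am: "amap B m v = (\<Sum>j<m. scl (v j) (h j))" for v
    by (auto simp: fun_eq_iff amap_def vapp B_def mult.commute)
  define g where "g = the_inv_into {..<m} h"
  have gh: "g (h j) = j" if "j < m" for j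
    using h that by (simp add: g_def m_def bij_betw_def the_inv_into_f_f)
  have re: "(\<Sum>j<m. scl (v j) (h j)) = (\<Sum>x\<in>S. scl (v (g x)) x)" for v
    using sum.reindex_bij_betw[OF h, of "\<lambda>x. scl (v (g x)) x"] gh by (simp add: m_def)
  have inj: "v = 0" if v: "v \<in> vec m" "amap B m v = 0" for v
  proof
    fix j
    show "v j = 0 j"
    proof (cases "j < m")
      case True
      from v(2) have "(\<Sum>x\<in>S. scl (v (g x)) x) = 0" by (simp add: am re)
      then have "v (g (h j)) = 0"
        using fv.independentD[OF S(2) finS subset_refl, of "\<lambda>x. v (g x)"] hS[OF True] by simp
      then show ?thesis using gh[OF True] by (simp add: vapp)
    next
      case False then show ?thesis using v(1) by (simp add: vec_def vapp)
    qed
  qed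
  have img: "amap B m ` vec m = U"
  proof
    have "h j \<in> U" if "j < m" for j using hS[OF that] S(1) by blast
    then show "amap B m ` vec m \<subseteq> U"
      by (auto simp: am intro!: fv.subspace_sum[OF U(1)] fv.subspace_scale[OF U(1)])
    show "U \<subseteq> amap B m ` vec m"
    proof
      fix x assume "x \<in> U"
      then have "x \<in> fv.span S" using S(3) by blast
      then obtain a where a: "x = (\<Sum>y\<in>S. scl (a y) y)"
        using fv.span_finite[OF finS] by auto
      define v where "v = (\<lambda>j. if j < m then a (h j) else 0)"
      have "v \<in> vec m" by (simp add: v_def vec_def)
      moreover have "amap B m v = x"
        using sum.reindex_bij_betw[OF h, of "\<lambda>x. scl (a x) x"]
        by (simp add: am v_def a flip: m_def)
      ultimately show "x \<in> amap B m ` vec m" by blast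
    qed
  qed
  show ?thesis using wf inj img by blast
qed

text \<open>A basis of \<open>U\<close> stays independent when \<open>v\<close> is added, so values
  on \<open>U\<close> and at \<open>v\<close> can be prescribed separately. Coordinate 0 of the
  resulting endomorphism is the functional.\<close>

lemma separating_functional:
  assumes "fv.subspace U" "v \<notin> U"
  shows "\<exists>\<phi>. lfun \<phi> \<and> (\<forall>u\<in>U. \<phi> u = 0) \<and> \<phi> v = 1"
proof -
  obtain S where S: "S \<subseteq> U" "fv.independent S" "U \<subseteq> fv.span S"
    using fv.maximal_independent_subset by blast
  have "fv.span S = U" using S assms(1) by (simp add: fv.span_minimal subset_antisym)
  then have vS: "v \<notin> fv.span S" using assms(2) by simp
  then have "fv.independent (insert v S)" using S(2) by (rule fv.independent_insertI)
  from fp.linear_independent_extend[OF this, of "\<lambda>x. if x = v then uvec 0 else 0"]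
  obtain F where F: "lin F" "\<forall>x\<in>insert v S. F x = (if x = v then uvec 0 else 0)" by blast
  have "F x = 0" if "x \<in> S" for x
    using F(2) that vS fv.span_base by fastforce
  then have "F u = 0" if "u \<in> U" for u
    using fp.linear_eq_0_on_span[OF F(1)] S(3) that by blast
  moreover have "lfun (\<lambda>x. F x 0)"
    by (simp add: lfun_def fp.linear_add[OF F(1)] fp.linear_scale[OF F(1)] vapp)
  moreover have "F v 0 = 1" using F(2) by (simp add: uvec_def)
  ultimately show ?thesis by (intro exI[of _ "\<lambda>x. F x 0"]) (simp add: vapp)
qed

lemma left_inverse_on_vec:
  assumes "lin F" "\<And>v. v \<in> vec d \<Longrightarrow> F v = 0 \<Longrightarrow> v = 0"
  shows "\<exists>G. lin G \<and> (\<forall>v\<in>vec d. G (F v) = v) \<and> (\<forall>w. G w \<in> vec d)"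
proof -
  have "inj_on F (vec d)"
    using assms(2) fp.linear_inj_on_iff_eq_0[OF assms(1) vec_subspace] by blast
  from fp.linear_exists_left_inverse_on[OF assms(1) vec_subspace this]
  show ?thesis by auto
qed

section \<open>Representations and homomorphisms\<close>

abbreviation act :: "'k::field rep \<Rightarrow> nat \<Rightarrow> (nat \<Rightarrow> 'k) \<Rightarrow> nat \<Rightarrow> 'k" where
  "act M i \<equiv> amap (ar M i) (dm M i)"

abbreviation hap :: "'k::field rep \<Rightarrow> 'k hm \<Rightarrow> nat \<Rightarrow> (nat \<Rightarrow> 'k) \<Rightarrow> nat \<Rightarrow> 'k" where
  "hap M f i \<equiv> amap (f i) (dm M i)"

lemma monic_iff: "monic M f \<longleftrightarrow> (\<forall>i. \<forall>v\<in>vec (dm M i). hap M f i v = 0 \<longrightarrow> v = 0)"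
  by (auto simp: monic_def lam_zero)

lemma monicD: "monic M f \<Longrightarrow> v \<in> vec (dm M i) \<Longrightarrow> hap M f i v = 0 \<Longrightarrow> v = 0"
  by (auto simp: monic_iff)

lemma monic_inj:
  assumes "monic M f" "u \<in> vec (dm M i)" "v \<in> vec (dm M i)" "hap M f i u = hap M f i v"
  shows "u = v"
  using monicD[OF assms(1) vec_diff[OF assms(2,3)]] assms(4) by (simp add: amap_diff)

lemma exact_iff: "exact L M g f \<longleftrightarrow> (\<forall>i. \<forall>v\<in>vec (dm M i).
    hap M f i v = 0 \<longleftrightarrow> (\<exists>u\<in>vec (dm L i). hap L g i u = v))"
  by (auto simp: exact_def lam_zero)

lemma exactD1: "exact L M g f \<Longrightarrow> v \<in> vec (dm M i) \<Longrightarrow> hap M f i v = 0 \<Longrightarrow>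
    \<exists>u\<in>vec (dm L i). hap L g i u = v"
  by (auto simp: exact_iff)

lemma epiD: "epi M N f \<Longrightarrow> w \<in> vec (dm N i) \<Longrightarrow> \<exists>v\<in>vec (dm M i). hap M f i v = w"
  by (auto simp: epi_def)

section \<open>Action of paths and homomorphisms\<close>

lemma pmap_lin: "lin (pmap A M i l)"
proof (induction l)
  case 0
  show ?case by (rule linI) auto
next
  case (Suc l)
  show ?case
    by (rule linI) (simp_all add: fp.linear_add[OF Suc] fp.linear_scale[OF Suc] amap_add amap_scl)
qed

lemmas pmap_add = fp.linear_add[OF pmap_lin]
lemmas pmap_diff = fp.linear_diff[OF pmap_lin]
lemmas pmap_scl = fp.linear_scale[OF pmap_lin]
lemmas pmap_0 [simp] = fp.linear_0[OF pmap_lin]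
lemmas pmap_sum = fp.linear_sum[OF pmap_lin]

lemma annihilates_iff: "annihilates A M \<rho> \<longleftrightarrow> (\<forall>i j. \<forall>v\<in>vec (dm M i).
    (\<Sum>l\<in>{l. \<rho> (i, l) \<noteq> 0 \<and> tgt A i l = j}. scl (\<rho> (i, l)) (pmap A M i l v)) = 0)"
  by (auto simp: annihilates_def fun_eq_iff vapp)

lemma tgt_tgt [simp]: "tgt A (tgt A i s) t = tgt A i (s + t)"
  by (simp add: tgt_def mod_add_left_eq add.assoc)

lemma pmap_plus: "pmap A M i (s + t) v = pmap A M (tgt A i s) t (pmap A M i s v)"
  by (induction t) auto

lemma hcomp_app: "hap M (hcomp N g f) i v = hap N g i (hap M f i v)"
  by (simp add: hcomp_def amap_mmul)

lemma hom_wf: "hom A M N f \<Longrightarrow> wfA A M" "hom A M N f \<Longrightarrow> wfA A N"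
  by (auto simp: hom_def)

lemma hom_vec [simp, intro]: "hom A M N f \<Longrightarrow> hap M f i v \<in> vec (dm N i)"
  by (auto simp: hom_def intro: amap_vec)

lemma hom_act: "hom A M N f \<Longrightarrow> v \<in> vec (dm M i) \<Longrightarrow>
    hap M f (tgt A i 1) (act M i v) = act N i (hap M f i v)"
  by (auto simp: hom_def)

lemma act_vec [simp, intro]: "wfA A M \<Longrightarrow> act M i v \<in> vec (dm M (tgt A i 1))"
  by (auto simp: wfA_def intro: amap_vec)

lemmas act_vec_Suc_0 [simp, intro] = act_vec[unfolded One_nat_def]

lemma wfA_dm: "wfA A M \<Longrightarrow> nv A \<le> i \<Longrightarrow> dm M i = 0"
  by (auto simp: wfA_def)

lemma vertex_lt: "wfA A M \<Longrightarrow> v \<in> vec (dm M i) \<Longrightarrow> v \<noteq> 0 \<Longrightarrow> i < nv A"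
  by (metis not_less vec_zero_dim wfA_dm)

lemma wfA_act_invalid:
  assumes "wfA A M" "\<not> valid_path A i 1"
  shows "act M i v = 0"
proof -
  have "ar M i = (\<lambda>_ _. 0)" using assms by (auto simp: wfA_def)
  then show ?thesis by (simp add: amap_def fun_eq_iff vapp)
qed

lemma tgt_0 [simp]: "i < nv A \<Longrightarrow> tgt A i 0 = i"
  by (auto simp: tgt_def)

lemma pmap_vec [simp, intro]:
  assumes "wfA A M" "v \<in> vec (dm M i)"
  shows "pmap A M i l v \<in> vec (dm M (tgt A i l))"
proof (cases l)
  case 0
  \<comment> \<open>At length 0 the target \<open>tgt A i 0\<close> equals \<open>i\<close> only for
    \<open>i < nv A\<close>, since \<open>tgt\<close> reduces modulo \<open>nv A\<close> on a cycle;
    outside that range the space is zero.\<close>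
  then show ?thesis
    using assms vertex_lt[OF assms] by (cases "v = 0") auto
next
  case (Suc m)
  then show ?thesis using act_vec[OF assms(1), of "tgt A i m"] by simp
qed

lemma hom_pmap:
  assumes "hom A M N f" "v \<in> vec (dm M i)"
  shows "hap M f (tgt A i l) (pmap A M i l v) = pmap A N i l (hap M f i v)"
proof (induction l)
  case 0
  then show ?case
    using vertex_lt[OF hom_wf(1)[OF assms(1)] assms(2)] by (cases "v = 0") auto
next
  case (Suc l)
  have "hap M f (tgt A (tgt A i l) 1) (act M (tgt A i l) (pmap A M i l v))
      = act N (tgt A i l) (hap M f (tgt A i l) (pmap A M i l v))"
    by (rule hom_act[OF assms(1)]) (use assms hom_wf in blast)
  then show ?case using Suc by simp
qed

lemma hom_of_linear_maps:
  assumes "wfA A M" "wfA A N"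
    and "\<And>i u v. u \<in> vec (dm M i) \<Longrightarrow> v \<in> vec (dm M i) \<Longrightarrow> F i (u + v) = F i u + F i v"
    and "\<And>i c v. v \<in> vec (dm M i) \<Longrightarrow> F i (scl c v) = scl c (F i v)"
    and "\<And>i v. v \<in> vec (dm M i) \<Longrightarrow> F i v \<in> vec (dm N i)"
    and "\<And>i v. v \<in> vec (dm M i) \<Longrightarrow> F (tgt A i 1) (act M i v) = act N i (F i v)"
  shows "\<exists>f. hom A M N f \<and> (\<forall>i. \<forall>v\<in>vec (dm M i). hap M f i v = F i v)"
proof -
  have "\<forall>i. \<exists>B. wf_mat B (dm N i) (dm M i) \<and> (\<forall>v\<in>vec (dm M i). amap B (dm M i) v = F i v)"
    using assms(3,4,5) by (intro allI matrix_of_linear) auto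
  then obtain f where f: "\<And>i. wf_mat (f i) (dm N i) (dm M i)"
      "\<And>i v. v \<in> vec (dm M i) \<Longrightarrow> hap M f i v = F i v"
    by metis
  then have "hom A M N f"
    using assms by (auto simp: hom_def)
  then show ?thesis using f by blast
qed

lemma hom_eqI:
  assumes "hom A M N f" "hom A M N g" "\<And>i v. v \<in> vec (dm M i) \<Longrightarrow> hap M f i v = hap M g i v"
  shows "f = g"
  using assms by (intro ext[of f g] wf_mat_eqI) (auto simp: hom_def)

lemma hom_hcomp:
  assumes "hom A M N f" "hom A N L g"
  shows "hom A M L (hcomp N g f)"
  unfolding hom_def
proof (intro conjI allI impI)
  show "wfA A M" "wfA A L" using assms hom_wf by auto
  show "wf_mat (hcomp N g f i) (dm L i) (dm M i)" for i
    using assms by (auto simp: hom_def hcomp_def intro!: wf_mmul)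
  show "act L i (hap M (hcomp N g f) i v) = hap M (hcomp N g f) (tgt A i 1) (act M i v)"
    if "v \<in> vec (dm M i)" for i v
    using hom_act[OF assms(1) that] hom_act[OF assms(2) hom_vec[OF assms(1)], of i v]
    by (simp add: hcomp_app)
qed

lemma hom_id:
  assumes "wfA A M"
  shows "\<exists>f. hom A M M f \<and> (\<forall>i. \<forall>v\<in>vec (dm M i). hap M f i v = v)"
  using hom_of_linear_maps[OF assms assms, of "\<lambda>i v. v"] by simp

lemma hom_zero:
  assumes "wfA A M" "wfA A N"
  shows "\<exists>f. hom A M N f"
  using hom_of_linear_maps[OF assms, of "\<lambda>i v. 0"] by auto

section \<open>Factorization through monomorphisms, isomorphisms, kernels\<close>

text \<open>Left inverses of \<open>k\<close> chosen vertex by vertex need not respect the arrows.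
  On the image of \<open>g\<close> they do, as can be checked after applying the injective
  \<open>k\<close>.\<close>

lemma hom_factor_monic:
  assumes g: "hom A X P g" and k: "hom A K P k" "monic K k"
    and im: "\<And>i v. v \<in> vec (dm X i) \<Longrightarrow> \<exists>u\<in>vec (dm K i). hap K k i u = hap X g i v"
  shows "\<exists>h. hom A X K h \<and> (\<forall>i. \<forall>v\<in>vec (dm X i). hap K k i (hap X h i v) = hap X g i v)"
proof -
  have "\<forall>i. \<exists>G. lin G \<and> (\<forall>v\<in>vec (dm K i). G (hap K k i v) = v) \<and> (\<forall>w. G w \<in> vec (dm K i))"
    using k(2) by (intro allI left_inverse_on_vec lin_amap) (auto simp: monic_iff)
  from choice[OF this] obtain G where G: "\<And>i. lin (G i)"
      "\<And>i v. v \<in> vec (dm K i) \<Longrightarrow> G i (hap K k i v) = v"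
      "\<And>i v. G i v \<in> vec (dm K i)"
    by blast
  have kG: "hap K k i (G i (hap X g i v)) = hap X g i v" if "v \<in> vec (dm X i)" for i v
    using im[OF that] G(2) by metis
  have "\<exists>h. hom A X K h \<and> (\<forall>i. \<forall>v\<in>vec (dm X i). hap X h i v = G i (hap X g i v))"
  proof (rule hom_of_linear_maps)
    fix i and v :: "nat \<Rightarrow> 'a" assume v: "v \<in> vec (dm X i)"
    have 1: "act X i v \<in> vec (dm X (tgt A i 1))" using hom_wf(1)[OF g] by (rule act_vec)
    have 2: "act K i (G i (hap X g i v)) \<in> vec (dm K (tgt A i 1))"
      using hom_wf(1)[OF k(1)] by (rule act_vec)
    have "hap K k (tgt A i 1) (G (tgt A i 1) (hap X g (tgt A i 1) (act X i v)))
        = hap K k (tgt A i 1) (act K i (G i (hap X g i v)))"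
      using kG[OF 1] kG[OF v] hom_act[OF g v] hom_act[OF k(1) G(3)] by metis
    then show "G (tgt A i 1) (hap X g (tgt A i 1) (act X i v)) = act K i (G i (hap X g i v))"
      by (rule monic_inj[OF k(2) G(3) 2])
  qed (use hom_wf g k G in \<open>auto simp: fp.linear_add[OF G(1)] fp.linear_scale[OF G(1)] amap_add amap_scl\<close>)
  then show ?thesis using kG by auto
qed

text \<open>\<open>iso\<close> asks only for a bijective homomorphism; the inverse arises by
  factoring the identity of \<open>N\<close> through \<open>f\<close>.\<close>

lemma isoE:
  assumes "iso A M N"
  obtains f g where "hom A M N f" "hom A N M g" "monic M f" "monic N g"
    "\<And>i v. v \<in> vec (dm M i) \<Longrightarrow> hap N g i (hap M f i v) = v"
    "\<And>i v. v \<in> vec (dm N i) \<Longrightarrow> hap M f i (hap N g i v) = v"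
proof -
  obtain f where f: "hom A M N f" "monic M f" "epi M N f" using assms by (auto simp: iso_def)
  obtain j where j: "hom A N N j" "\<And>i v. v \<in> vec (dm N i) \<Longrightarrow> hap N j i v = v"
    using hom_id[OF hom_wf(2)[OF f(1)]] by blast
  obtain g where g: "hom A N M g" "\<And>i v. v \<in> vec (dm N i) \<Longrightarrow> hap M f i (hap N g i v) = v"
    using hom_factor_monic[OF j(1) f(1,2)] f(3) j(2) by (metis epiD)
  have gf: "hap N g i (hap M f i v) = v" if "v \<in> vec (dm M i)" for i v
    by (rule monic_inj[OF f(2)]) (use f g that in auto)
  have "monic N g" unfolding monic_iff using g(2) by (metis amap_0)
  show thesis by (rule that[OF f(1) g(1) f(2) \<open>monic N g\<close> gf g(2)])
qed

lemma iso_refl: "wfA A M \<Longrightarrow> iso A M M"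
  using hom_id[of A M] unfolding iso_def monic_iff epi_def by metis

lemma iso_sym: "iso A M N \<Longrightarrow> iso A N M"
  by (elim isoE) (metis epi_def hom_vec iso_def)

text \<open>The arrows of \<open>K\<close> are those of \<open>M\<close> transported through the
  chosen bases. The relations hold in \<open>K\<close> because \<open>k\<close> is injective and
  intertwines the path maps.\<close>

lemma subrep_exists:
  assumes M: "wfA A M"
    and U: "\<And>i. fv.subspace (U i)" "\<And>i. U i \<subseteq> vec (dm M i)"
    and stable: "\<And>i u. u \<in> U i \<Longrightarrow> act M i u \<in> U (tgt A i 1)"
  shows "\<exists>K k. hom A K M k \<and> monic K k \<and> (\<forall>i. hap K k i ` vec (dm K i) = U i)"
proof -
  have "\<forall>i. \<exists>m B. wf_mat B (dm M i) m \<and> (\<forall>v\<in>vec m. amap B m v = 0 \<longrightarrow> v = 0) \<and> amap B m ` vec m = U i"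
    using U by (intro allI subspace_as_image)
  then obtain m k where mk: "\<And>i. wf_mat (k i) (dm M i) (m i)"
      "\<And>i v. v \<in> vec (m i) \<Longrightarrow> amap (k i) (m i) v = 0 \<Longrightarrow> v = 0"
      "\<And>i. amap (k i) (m i) ` vec (m i) = U i"
    by metis
  have "\<forall>i. \<exists>G. lin G \<and> (\<forall>v\<in>vec (m i). G (amap (k i) (m i) v) = v) \<and> (\<forall>w. G w \<in> vec (m i))"
    using mk(2) by (intro allI left_inverse_on_vec lin_amap) auto
  from choice[OF this] obtain G where G: "\<And>i. lin (G i)"
      "\<And>i v. v \<in> vec (m i) \<Longrightarrow> G i (amap (k i) (m i) v) = v"
      "\<And>i v. G i v \<in> vec (m i)"
    by blast
  have kG: "amap (k i) (m i) (G i u) = u" if u: "u \<in> U i" for i u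
  proof -
    obtain v where "v \<in> vec (m i)" "u = amap (k i) (m i) v" using u mk(3)[of i] by blast
    then show ?thesis by (simp add: G(2))
  qed
  have kU: "amap (k i) (m i) v \<in> U i" if "v \<in> vec (m i)" for i v
    using that mk(3)[of i] by blast
  let ?F = "\<lambda>i v. G (tgt A i 1) (act M i (amap (k i) (m i) v))"
  have "\<forall>i. \<exists>B. wf_mat B (m (tgt A i 1)) (m i) \<and> (\<forall>v\<in>vec (m i). amap B (m i) v = ?F i v)"
    by (intro allI matrix_of_linear)
      (simp_all add: G(3) fp.linear_add[OF G(1)] fp.linear_scale[OF G(1)] amap_add amap_scl)
  then obtain a where a: "\<And>i. wf_mat (a i) (m (tgt A i 1)) (m i)"
      "\<And>i v. v \<in> vec (m i) \<Longrightarrow> amap (a i) (m i) v = ?F i v"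
    by metis
  define K where "K = \<lparr>dm = m, ar = a\<rparr>"
  have dK [simp]: "dm K = m" and aK [simp]: "ar K = a" by (simp_all add: K_def)
  have comm: "amap (k (tgt A i 1)) (m (tgt A i 1)) (act K i v) = act M i (amap (k i) (m i) v)"
    if "v \<in> vec (m i)" for i v
    using a(2)[OF that] kG[OF stable[OF kU[OF that]]] by simp
  have m0: "m i = 0" if "nv A \<le> i" for i
  proof (rule ccontr)
    assume "m i \<noteq> 0"
    then have u: "(uvec 0 :: nat \<Rightarrow> 'a) \<in> vec (m i)" by simp
    have "amap (k i) (m i) (uvec 0) \<in> vec 0"
      using kU[OF u] U(2)[of i] wfA_dm[OF M that] by auto
    then have "(uvec 0 :: nat \<Rightarrow> 'a) = 0" using mk(2)[OF u] by (simp add: vec_zero_dim)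
    then have "(uvec 0 :: nat \<Rightarrow> 'a) 0 = 0" by (simp only: zero_fun_apply)
    then show False by (simp add: uvec_def)
  qed
  have K_act_vec: "act K i v \<in> vec (m (tgt A i 1))" for i v
    using a(1) by (simp add: amap_vec)
  have K_pmap: "pmap A K i l v \<in> vec (m (tgt A i l)) \<and>
      amap (k (tgt A i l)) (m (tgt A i l)) (pmap A K i l v) = pmap A M i l (amap (k i) (m i) v)"
    if "v \<in> vec (m i)" "i < nv A" for i l v
  proof (induction l)
    case 0
    then show ?case using that by simp
  next
    case (Suc l)
    then show ?case
      using comm[of "pmap A K i l v" "tgt A i l"] K_act_vec[of "tgt A i l" "pmap A K i l v"] by simp
  qed
  have wfK: "wfA A K"
    unfolding wfA_def
  proof (intro conjI allI impI ballI)
    show "dm K i = 0" if "nv A \<le> i" for i using m0 that by simp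
    show "wf_mat (ar K i) (dm K (tgt A i 1)) (dm K i)" for i using a(1) by simp
    show "ar K i = (\<lambda>_ _. 0)" if "\<not> valid_path A i 1" for i
    proof (rule wf_mat_eqI)
      show "wf_mat (ar K i) (m (tgt A i 1)) (m i)" using a(1) by simp
      show "wf_mat (\<lambda>_ _. 0) (m (tgt A i 1)) (m i)" by (simp add: wf_mat_def)
      fix v :: "nat \<Rightarrow> 'a" assume "v \<in> vec (m i)"
      then have "amap (a i) (m i) v = 0"
        using a(2) wfA_act_invalid[OF M that] by (simp add: fp.linear_0[OF G(1)])
      then show "amap (ar K i) (m i) v = amap (\<lambda>_ _. 0) (m i) v"
        by (simp add: amap_def fun_eq_iff vapp)
    qed
    fix \<rho> assume "\<rho> \<in> rel A"
    then have annM: "annihilates A M \<rho>" using M by (auto simp: wfA_def)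
    show "annihilates A K \<rho>"
      unfolding annihilates_iff
    proof (intro allI ballI)
      fix i j and v :: "nat \<Rightarrow> 'a" assume v: "v \<in> vec (dm K i)"
      let ?L = "{l. \<rho> (i, l) \<noteq> 0 \<and> tgt A i l = j}"
      show "(\<Sum>l\<in>?L. scl (\<rho> (i, l)) (pmap A K i l v)) = 0"
      proof (cases "i < nv A")
        case True
        have "amap (k j) (m j) (\<Sum>l\<in>?L. scl (\<rho> (i, l)) (pmap A K i l v))
            = (\<Sum>l\<in>?L. scl (\<rho> (i, l)) (amap (k j) (m j) (pmap A K i l v)))"
          by (simp only: amap_sum amap_scl)
        also have "\<dots> = (\<Sum>l\<in>?L. scl (\<rho> (i, l)) (pmap A M i l (amap (k i) (m i) v)))"
          using K_pmap[OF _ True] v by (intro sum.cong) auto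
        also have "\<dots> = 0"
          using annM v kU[of v i] U(2)[of i] unfolding annihilates_iff by auto
        finally have "amap (k j) (m j) (\<Sum>l\<in>?L. scl (\<rho> (i, l)) (pmap A K i l v)) = 0" .
        moreover have "(\<Sum>l\<in>?L. scl (\<rho> (i, l)) (pmap A K i l v)) \<in> vec (m j)"
          using K_pmap[OF _ True] v by (intro vec_sum vec_scl) auto
        ultimately show ?thesis using mk(2) by blast
      next
        case False
        then have "v = 0" using v m0[of i] by (simp add: vec_zero_dim)
        then show ?thesis by simp
      qed
    qed
  qed
  have "hom A K M k"
    unfolding hom_def using wfK M mk(1) comm by auto
  moreover have "monic K k" using mk(2) by (auto simp: monic_iff)
  ultimately show ?thesis using mk(3) by (intro exI[of _ K] exI[of _ k]) simp
qed

lemma kernel_exists: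
  assumes f: "hom A M N f"
  shows "\<exists>K k. hom A K M k \<and> monic K k \<and> exact K M k f"
proof -
  let ?U = "\<lambda>i. {v \<in> vec (dm M i). hap M f i v = 0}"
  have "\<exists>K k. hom A K M k \<and> monic K k \<and> (\<forall>i. hap K k i ` vec (dm K i) = ?U i)"
  proof (rule subrep_exists)
    show "fv.subspace (?U i)" for i
      unfolding fv.subspace_def
      by (simp add: vec_add vec_scl amap_add amap_scl)
    show "act M i u \<in> ?U (tgt A i 1)" if "u \<in> ?U i" for i u
      using that hom_act[OF f, of u i] act_vec[OF hom_wf(1)[OF f], of i u] by simp
  qed (use hom_wf f in auto)
  then obtain K k where K: "hom A K M k" "monic K k" "\<And>i. hap K k i ` vec (dm K i) = ?U i"
    by blast
  have "exact K M k f"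
    unfolding exact_iff
  proof (intro allI ballI)
    fix i and v :: "nat \<Rightarrow> 'a" assume "v \<in> vec (dm M i)"
    then have "hap M f i v = 0 \<longleftrightarrow> v \<in> hap K k i ` vec (dm K i)"
      unfolding K(3) by simp
    then show "hap M f i v = 0 \<longleftrightarrow> (\<exists>u\<in>vec (dm K i). hap K k i u = v)"
      by (auto simp: image_iff)
  qed
  with K show ?thesis by blast
qed

lemma projectiveD:
  assumes "projective A P" "hom A X Y g" "epi X Y g" "hom A P Y f"
  shows "\<exists>h. hom A P X h \<and> (\<forall>i v. hap X g i (hap P h i v) = hap P f i v)"
  using assms unfolding projective_def by (metis hcomp_app)

lemma projectiveI:
  assumes "wfA A P"
    and "\<And>X Y g f. hom A X Y g \<Longrightarrow> epi X Y g \<Longrightarrow> hom A P Y f \<Longrightarrow>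
      \<exists>h. hom A P X h \<and> (\<forall>i. \<forall>v\<in>vec (dm P i). hap X g i (hap P h i v) = hap P f i v)"
  shows "projective A P"
  unfolding projective_def
proof (intro conjI allI impI, fact, elim conjE)
  fix X Y g f assume *: "hom A X Y g" "epi X Y g" "hom A P Y f"
  then obtain h where h: "hom A P X h" "\<And>i v. v \<in> vec (dm P i) \<Longrightarrow> hap X g i (hap P h i v) = hap P f i v"
    using assms(2) by blast
  have "hcomp X g h = f"
    by (rule hom_eqI[OF hom_hcomp[OF h(1) *(1)] *(3)]) (simp add: hcomp_app h)
  with h show "\<exists>h. hom A P X h \<and> hcomp X g h = f" by blast
qed

lemma proj_coverD:
  assumes "proj_cover A P M p"
  shows "projective A P" "hom A P M p" "epi P M p"
    "\<And>Z g. hom A Z P g \<Longrightarrow> (\<And>i w. w \<in> vec (dm M i) \<Longrightarrow> \<exists>v\<in>vec (dm Z i). hap P p i (hap Z g i v) = w)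
      \<Longrightarrow> epi Z P g"
  using assms by (auto simp: proj_cover_def epi_def hcomp_app)

lemma zero_repI:
  fixes M :: "'k::field rep"
  assumes "\<And>i (v :: nat \<Rightarrow> 'k). v \<in> vec (dm M i) \<Longrightarrow> v = 0"
  shows "zero_rep M"
proof (unfold zero_rep_def, rule allI, rule ccontr)
  fix i assume "dm M i \<noteq> 0"
  then have "(uvec 0 :: nat \<Rightarrow> 'k) = 0" using assms[of "uvec 0" i] by simp
  then have "(uvec 0 :: nat \<Rightarrow> 'k) 0 = 0" by (simp only: zero_fun_apply)
  then show False by (simp add: uvec_def)
qed

lemma zero_repD: "zero_rep M \<Longrightarrow> v \<in> vec (dm M i) \<Longrightarrow> v = 0"
  by (simp add: zero_rep_def vec_zero_dim)

section \<open>Lengths of the indecomposable projectives\<close>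

text \<open>For a vertex \<open>i\<close> this is the composition length of the indecomposable
  projective with top \<open>i\<close>: the least length at which the path from \<open>i\<close>
  vanishes in the quotient or does not exist in the quiver.\<close>

definition plen :: "'k::field nak \<Rightarrow> nat \<Rightarrow> nat" where
  "plen A i = (LEAST l. \<not> valid_path A i l \<or> path_elem i l \<in> rel A)"

locale nakayama_algebra =
  fixes A :: "'k::field nak"
  assumes nakayama: "nakayama A"
begin

lemma nv_pos: "0 < nv A"
  using nakayama by (simp add: nakayama_def)

lemma rel_finite: "\<rho> \<in> rel A \<Longrightarrow> finite {p. \<rho> p \<noteq> 0}"
  using nakayama by (simp add: nakayama_def)

lemma rel_valid: "\<rho> \<in> rel A \<Longrightarrow> \<rho> (i, l) \<noteq> 0 \<Longrightarrow> valid_path A i l"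
  using nakayama by (simp add: nakayama_def)

lemma rel_zero: "(\<lambda>_. 0) \<in> rel A"
  using nakayama by (simp add: nakayama_def)

lemma rel_add: "\<rho> \<in> rel A \<Longrightarrow> \<sigma> \<in> rel A \<Longrightarrow> (\<lambda>p. \<rho> p + \<sigma> p) \<in> rel A"
  using nakayama by (simp add: nakayama_def)

lemma rel_scale: "\<rho> \<in> rel A \<Longrightarrow> (\<lambda>p. c * \<rho> p) \<in> rel A"
  using nakayama by (simp add: nakayama_def)

lemma rel_ideal:
  assumes "\<rho> \<in> rel A" "j < nv A"
  shows "keep_start j \<rho> \<in> rel A" "arrow_end A j \<rho> \<in> rel A" "arrow_start A j \<rho> \<in> rel A"
  using nakayama assms by (auto simp: nakayama_def)

lemma rel_ge_2: "\<rho> \<in> rel A \<Longrightarrow> \<rho> (i, l) \<noteq> 0 \<Longrightarrow> 2 \<le> l"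
  using nakayama by (simp add: nakayama_def)

lemma rel_long: "\<exists>m. \<forall>i l. valid_path A i l \<and> m \<le> l \<longrightarrow> path_elem i l \<in> rel A"
  using nakayama by (auto simp: nakayama_def)

lemma rel_sum: "finite J \<Longrightarrow> (\<And>j. j \<in> J \<Longrightarrow> f j \<in> rel A) \<Longrightarrow> (\<lambda>p. \<Sum>j\<in>J. f j p) \<in> rel A"
  by (induction J rule: finite_induct) (auto intro: rel_zero rel_add)

lemma plen_prop: "\<not> valid_path A i (plen A i) \<or> path_elem i (plen A i) \<in> rel A"
proof -
  obtain m where "\<forall>i l. valid_path A i l \<and> m \<le> l \<longrightarrow> path_elem i l \<in> rel A"
    using rel_long by blast
  then have "\<not> valid_path A i m \<or> path_elem i m \<in> rel A" by auto
  then show ?thesis unfolding plen_def by (rule LeastI)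
qed

lemma plen_le: "\<not> valid_path A i l \<or> path_elem i l \<in> rel A \<Longrightarrow> plen A i \<le> l"
  unfolding plen_def by (rule Least_le)

lemma plen_valid: "l < plen A i \<Longrightarrow> valid_path A i l"
  using plen_le[of i l] by auto

lemma plen_pos: "i < nv A \<Longrightarrow> 0 < plen A i"
  using plen_prop[of i] rel_ge_2[of "path_elem i 0" i 0]
  by (intro gr0I) (auto simp: valid_path_def path_elem_def)

lemma tgt_lt: "valid_path A i l \<Longrightarrow> tgt A i l < nv A"
  using nv_pos by (auto simp: valid_path_def tgt_def)

lemma valid_path_plus: "valid_path A i (s + t) \<longleftrightarrow> valid_path A i s \<and> valid_path A (tgt A i s) t"
  using nv_pos by (auto simp: valid_path_def tgt_def)

lemma tgt_1_inj: "i < nv A \<Longrightarrow> j < nv A \<Longrightarrow> tgt A i 1 = tgt A j 1 \<Longrightarrow> i = j"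
  by (auto simp: tgt_def mod_Suc split: if_splits)

text \<open>Prefixing an arrow to a vanishing path gives a vanishing path. On the unrolled quiver
  this becomes monotonicity of \<open>fx\<close>.\<close>

lemma plen_step:
  assumes "valid_path A j 1"
  shows "plen A j \<le> Suc (plen A (tgt A j 1))"
proof (rule plen_le, unfold imp_conv_disj[symmetric], rule impI)
  let ?p = "plen A (tgt A j 1)"
  assume v: "valid_path A j (Suc ?p)"
  then have "valid_path A (tgt A j 1) ?p" using valid_path_plus[of j 1 ?p] by simp
  then have "path_elem (tgt A j 1) ?p \<in> rel A" using plen_prop by blast
  then have "arrow_start A j (path_elem (tgt A j 1) ?p) \<in> rel A"
    using assms by (intro rel_ideal) (auto simp: valid_path_def)
  moreover have "arrow_start A j (path_elem (tgt A j 1) ?p) = path_elem j (Suc ?p)"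
    using v by (auto simp: arrow_start_def path_elem_def fun_eq_iff)
  ultimately show "path_elem j (Suc ?p) \<in> rel A" by simp
qed

lemma plen_le_add: "s < plen A i \<Longrightarrow> plen A i \<le> s + plen A (tgt A i s)"
proof (induction s)
  case 0
  then show ?case using plen_valid[of 0 i] by (auto simp: valid_path_def)
next
  case (Suc s)
  have "valid_path A (tgt A i s) 1"
    using plen_valid[OF Suc.prems] valid_path_plus[of i s 1] by simp
  from plen_step[OF this] Suc show ?case by simp
qed

text \<open>Multiplication by the sum of all arrows at the end of paths.\<close>

definition shift :: "(nat \<times> nat \<Rightarrow> 'k) \<Rightarrow> nat \<times> nat \<Rightarrow> 'k" where
  "shift \<rho> = (\<lambda>(i, l). if 1 \<le> l \<and> valid_path A i l then \<rho> (i, l - 1) else 0)"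

lemma shift_rel:
  assumes "\<rho> \<in> rel A" shows "shift \<rho> \<in> rel A"
proof -
  have "shift \<rho> = (\<lambda>p. \<Sum>j<nv A. arrow_end A j \<rho> p)"
  proof (intro ext, clarify)
    fix i l
    show "shift \<rho> (i, l) = (\<Sum>j<nv A. arrow_end A j \<rho> (i, l))"
    proof (cases "1 \<le> l \<and> valid_path A i l")
      case True
      then have "tgt A i (l - 1) < nv A"
        using valid_path_plus[of i "l - 1" 1] by (intro tgt_lt) auto
      then show ?thesis using True by (simp add: shift_def arrow_end_def)
    next
      case False
      then show ?thesis by (auto simp: shift_def arrow_end_def intro!: sum.neutral)
    qed
  qed
  moreover have "(\<lambda>p. \<Sum>j<nv A. arrow_end A j \<rho> p) \<in> rel A"
    using assms by (intro rel_sum rel_ideal) auto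
  ultimately show ?thesis by simp
qed

lemma shift_funpow:
  assumes "\<rho> \<in> rel A"
  shows "(shift ^^ t) \<rho> \<in> rel A"
    "(shift ^^ t) \<rho> (i, l) = (if t \<le> l \<and> valid_path A i l then \<rho> (i, l - t) else 0)"
proof -
  show "(shift ^^ t) \<rho> \<in> rel A" by (induction t) (auto intro: assms shift_rel)
  show "(shift ^^ t) \<rho> (i, l) = (if t \<le> l \<and> valid_path A i l then \<rho> (i, l - t) else 0)"
  proof (induction t arbitrary: l)
    case 0
    then show ?case using rel_valid[OF assms] by auto
  next
    case (Suc t)
    have "valid_path A i (l - 1)" if "1 \<le> l" "valid_path A i l"
      using that valid_path_plus[of i "l - 1" 1] by simp
    then show ?case using Suc by (auto simp: shift_def)
  qed
qed

text \<open>Every path occurring in a relation lies in the ideal itself: cancel the longer terms,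
  starting with the paths that are long enough to be relations by admissibility.\<close>

lemma plen_le_of_rel:
  assumes \<rho>: "\<rho> \<in> rel A" and nz: "\<rho> (i, l) \<noteq> 0"
  shows "plen A i \<le> l"
proof -
  define \<sigma> where "\<sigma> = keep_start i \<rho>"
  have \<sigma>i: "\<sigma> (i, l') = \<rho> (i, l')" for l' by (simp add: \<sigma>_def keep_start_def)
  have \<sigma>j: "\<sigma> (j, l') = 0" if "j \<noteq> i" for j l' using that by (simp add: \<sigma>_def keep_start_def)
  have "i < nv A" using rel_valid[OF \<rho> nz] by (simp add: valid_path_def)
  then have \<sigma>: "\<sigma> \<in> rel A" unfolding \<sigma>_def by (intro rel_ideal \<rho>)
  define l0 where "l0 = (LEAST l. \<sigma> (i, l) \<noteq> 0)"
  have l0: "\<sigma> (i, l0) \<noteq> 0"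
    unfolding l0_def by (rule LeastI[of _ l]) (simp add: \<sigma>i nz)
  have l0_min: "\<sigma> (i, l') = 0" if "l' < l0" for l'
    using not_less_Least[of l' "\<lambda>l. \<sigma> (i, l) \<noteq> 0"] that unfolding l0_def by blast
  have "l0 \<le> l" using l0_min[of l] nz \<sigma>i[of l] by (cases "l < l0") auto
  obtain m where m: "\<And>i l. valid_path A i l \<Longrightarrow> m \<le> l \<Longrightarrow> path_elem i l \<in> rel A"
    using rel_long by blast
  have main: "path_elem i l \<in> rel A" if "l0 \<le> l" "valid_path A i l" for l
    using that
  proof (induction "m - l" arbitrary: l rule: less_induct)
    case (less l)
    \<comment> \<open>The shift moves the shortest path of \<open>\<sigma>\<close> to length
      \<open>l\<close>. All other paths in \<open>\<tau>\<close> are longer, hence in the ideal by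
      the choice of \<open>m\<close> or by induction, and subtracting them isolates the path of
      length \<open>l\<close>.\<close>
    define \<tau> where "\<tau> = (shift ^^ (l - l0)) \<sigma>"
    have \<tau>: "\<tau> \<in> rel A" unfolding \<tau>_def by (rule shift_funpow[OF \<sigma>])
    have \<tau>_app: "\<tau> (j, l') = (if l - l0 \<le> l' \<and> valid_path A j l' then \<sigma> (j, l' - (l - l0)) else 0)"
      for j l' unfolding \<tau>_def by (rule shift_funpow[OF \<sigma>])
    have \<tau>l: "\<tau> (i, l) = \<sigma> (i, l0)" using less.prems by (simp add: \<tau>_app)
    have \<tau>small: "\<tau> (i, l') = 0" if "l' < l" for l'
      using that less.prems l0_min[of "l' - (l - l0)"] by (auto simp: \<tau>_app)
    have \<tau>j: "\<tau> (j, l') = 0" if "j \<noteq> i" for j l' using that \<sigma>j by (simp add: \<tau>_app)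
    define J where "J = {l'. l < l' \<and> \<tau> (i, l') \<noteq> 0}"
    have finJ: "finite J"
    proof (rule finite_surj[OF rel_finite[OF \<tau>]])
      show "J \<subseteq> snd ` {p. \<tau> p \<noteq> 0}" by (force simp: J_def)
    qed
    have pe: "path_elem i l' \<in> rel A" if l': "l' \<in> J" for l'
    proof -
      have v: "valid_path A i l'" using l' rel_valid[OF \<tau>] by (auto simp: J_def)
      show ?thesis
      proof (cases "m \<le> l'")
        case True then show ?thesis using m v by blast
      next
        case False
        then show ?thesis using less.hyps[of l'] less.prems l' v by (auto simp: J_def)
      qed
    qed
    let ?\<kappa> = "\<lambda>p. \<Sum>l'\<in>J. \<tau> (i, l') * path_elem i l' p"
    have "?\<kappa> \<in> rel A" using finJ pe by (intro rel_sum rel_scale) auto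
    then have "(\<lambda>p. inverse (\<sigma> (i, l0)) * (\<tau> p + (- 1) * ?\<kappa> p)) \<in> rel A"
      using \<tau> by (intro rel_scale rel_add)
    moreover have "(\<lambda>p. inverse (\<sigma> (i, l0)) * (\<tau> p + (- 1) * ?\<kappa> p)) = path_elem i l"
    proof (intro ext, clarify)
      fix j l'
      have "?\<kappa> (j, l') = (if j = i \<and> l' \<in> J then \<tau> (i, l') else 0)"
        using finJ by (cases "j = i")
          (auto simp: path_elem_def if_distrib[of "\<lambda>x. _ * x"] cong: if_cong intro!: sum.neutral)
      moreover have "\<tau> (i, l') = 0" if "l' \<notin> J" "l' \<noteq> l"
        using that \<tau>small[of l'] by (cases "l' < l") (auto simp: J_def)
      moreover have "l \<notin> J" by (simp add: J_def)
      ultimately show "inverse (\<sigma> (i, l0)) * (\<tau> (j, l') + (- 1) * ?\<kappa> (j, l')) = path_elem i l (j, l')"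
        using l0 \<tau>l \<tau>j[of j l'] by (cases "j = i") (auto simp: path_elem_def)
    qed
    ultimately show ?case by simp
  qed
  then show ?thesis using \<open>l0 \<le> l\<close> rel_valid[OF \<rho> nz] by (intro plen_le) auto
qed

lemma pmap_plen:
  assumes N: "wfA A N" and u: "u \<in> vec (dm N i)" and l: "plen A i \<le> l"
  shows "pmap A N i l u = 0"
proof -
  let ?p = "plen A i"
  have "pmap A N i ?p u = 0"
  proof (cases "valid_path A i ?p")
    case True
    then have "path_elem i ?p \<in> rel A" using plen_prop by blast
    then have "annihilates A N (path_elem i ?p)" using N by (auto simp: wfA_def)
    then have "(\<Sum>l\<in>{l. path_elem i ?p (i, l) \<noteq> (0::'k) \<and> tgt A i l = tgt A i ?p}.
        scl (path_elem i ?p (i, l)) (pmap A N i l u)) = 0"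
      using u by (auto simp: annihilates_iff)
    moreover have "{l. path_elem i ?p (i, l) \<noteq> (0::'k) \<and> tgt A i l = tgt A i ?p} = {?p}"
      by (auto simp: path_elem_def)
    ultimately show ?thesis by (simp add: path_elem_def)
  next
    case False
    then have "nv A \<le> i \<or> nv A \<le> tgt A i ?p" by (auto simp: valid_path_def tgt_def)
    then show ?thesis
      using u pmap_vec[OF N u, of ?p] wfA_dm[OF N] by (auto simp: vec_zero_dim)
  qed
  then show ?thesis
    using pmap_plus[of A N i ?p "l - ?p" u] l by simp
qed

end

section \<open>Interval modules\<close>

text \<open>On a cycle an interval may pass through \<open>j\<close> several times, so the vectors
  at \<open>j\<close> combine all degrees \<open>s < l\<close> that lie over \<open>j\<close>.
  Values of \<open>c\<close> at other degrees do not matter.\<close>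

definition lc :: "'k::field nak \<Rightarrow> 'k rep \<Rightarrow> nat \<Rightarrow> nat \<Rightarrow> (nat \<Rightarrow> 'k) \<Rightarrow> nat \<Rightarrow> (nat \<Rightarrow> 'k) \<Rightarrow> nat \<Rightarrow> 'k" where
  "lc A M i l v j c = (\<Sum>s\<in>{s. s < l \<and> tgt A i s = j}. scl (c s) (pmap A M i s v))"

text \<open>\<open>M\<close> is uniserial of length \<open>l\<close> and \<open>v\<close> is a generator at its top vertex \<open>i\<close>;
  the case \<open>l = 0\<close> is the zero module, with arbitrary \<open>i\<close>.\<close>

definition is_interval :: "'k::field nak \<Rightarrow> 'k rep \<Rightarrow> nat \<Rightarrow> nat \<Rightarrow> (nat \<Rightarrow> 'k) \<Rightarrow> bool" where
  "is_interval A M i l v \<longleftrightarrow> wfA A M \<and> v \<in> vec (dm M i) \<and> pmap A M i l v = 0 \<and>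
     (\<forall>s<l. pmap A M i s v \<noteq> 0) \<and> (\<forall>j. \<forall>w\<in>vec (dm M j). \<exists>c. w = lc A M i l v j c)"

text \<open>The radical at \<open>i\<close> is the image of the incoming arrow. A vertex has at most
  one such arrow, so no sums occur; the disjunct \<open>v = 0\<close> covers the first vertex of a
  line, which has none.\<close>

definition inrad :: "'k::field nak \<Rightarrow> 'k rep \<Rightarrow> nat \<Rightarrow> (nat \<Rightarrow> 'k) \<Rightarrow> bool" where
  "inrad A M i v \<longleftrightarrow> v = 0 \<or> (\<exists>j<nv A. tgt A j 1 = i \<and> (\<exists>u\<in>vec (dm M j). act M j u = v))"

lemma lc_vec [simp, intro]:
  assumes "wfA A M" "v \<in> vec (dm M i)"
  shows "lc A M i l v j c \<in> vec (dm M j)"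
proof -
  have "pmap A M i s v \<in> vec (dm M j)" if "tgt A i s = j" for s
    using pmap_vec[OF assms, of s] that by simp
  then show ?thesis unfolding lc_def by (intro vec_sum vec_scl) auto
qed

lemma lc_add: "lc A M i l v j c + lc A M i l v j d = lc A M i l v j (\<lambda>s. c s + d s)"
  by (simp add: lc_def sum.distrib[symmetric] fv.scale_left_distrib)

lemma lc_scl: "scl a (lc A M i l v j c) = lc A M i l v j (\<lambda>s. a * c s)"
  by (simp add: lc_def fv.scale_sum_right)

lemma lc_diff: "lc A M i l v j c - lc A M i l v j d = lc A M i l v j (\<lambda>s. c s - d s)"
  by (simp add: lc_def sum_subtractf[symmetric] fv.scale_left_diff_distrib)

lemma lc_cong: "(\<And>s. s < l \<Longrightarrow> tgt A i s = j \<Longrightarrow> c s = d s) \<Longrightarrow> lc A M i l v j c = lc A M i l v j d"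
  unfolding lc_def by (rule sum.cong) auto

lemma pmap_lc: "pmap A M j t (lc A M i l v j c)
    = (\<Sum>s\<in>{s. s < l \<and> tgt A i s = j}. scl (c s) (pmap A M i (s + t) v))"
  unfolding lc_def pmap_sum pmap_scl by (rule sum.cong) (auto simp: pmap_plus)

lemma lc_single:
  assumes "s < l" "tgt A i s = j"
  shows "pmap A M i s v = lc A M i l v j (\<lambda>t. if t = s then 1 else 0)"
proof -
  have "lc A M i l v j (\<lambda>t. if t = s then 1 else 0)
      = (\<Sum>t\<in>{t. t < l \<and> tgt A i t = j}. if t = s then pmap A M i t v else 0)"
    unfolding lc_def by (rule sum.cong) auto
  also have "\<dots> = pmap A M i s v" using assms by simp
  finally show ?thesis by simp
qed

lemma hom_lc:
  assumes "hom A M N h" "v \<in> vec (dm M i)"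
  shows "hap M h j (lc A M i l v j c) = lc A N i l (hap M h i v) j c"
  unfolding lc_def amap_sum amap_scl
  by (rule sum.cong) (auto simp: hom_pmap[OF assms, symmetric])

text \<open>An arrow raises every degree by one; the term that would reach degree \<open>l\<close>
  vanishes by assumption.\<close>

lemma act_lc:
  assumes "pmap A N i l u = 0"
  shows "act N j (lc A N i l u j c)
    = lc A N i l u (tgt A j 1) (\<lambda>s. if 0 < s \<and> tgt A i (s - 1) = j then c (s - 1) else 0)"
proof -
  let ?I = "{s. Suc s < l \<and> tgt A i s = j}"
  have "act N j (lc A N i l u j c) = (\<Sum>s\<in>{s. s < l \<and> tgt A i s = j}. scl (c s) (pmap A N i (Suc s) u))"
    unfolding lc_def amap_sum amap_scl by (rule sum.cong) auto
  also have "\<dots> = (\<Sum>s\<in>?I. scl (c s) (pmap A N i (Suc s) u))"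
  proof (rule sum.mono_neutral_right)
    have "Suc s = l" if "s < l" "\<not> Suc s < l" for s using that by simp
    then show "\<forall>s\<in>{s. s < l \<and> tgt A i s = j} - ?I. scl (c s) (pmap A N i (Suc s) u) = 0"
      using assms by (metis (no_types, lifting) DiffE fv.scale_zero_right mem_Collect_eq)
  qed auto
  also have "\<dots> = (\<Sum>s\<in>Suc ` ?I. scl (c (s - 1)) (pmap A N i s u))"
    by (simp add: sum.reindex del: pmap.simps)
  also have "\<dots> = lc A N i l u (tgt A j 1) (\<lambda>s. if 0 < s \<and> tgt A i (s - 1) = j then c (s - 1) else 0)"
    unfolding lc_def
  proof (rule sum.mono_neutral_cong_left)
    show "Suc ` ?I \<subseteq> {s. s < l \<and> tgt A i s = tgt A j 1}" by auto
    show "\<forall>s\<in>{s. s < l \<and> tgt A i s = tgt A j 1} - Suc ` ?I.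
        scl (if 0 < s \<and> tgt A i (s - 1) = j then c (s - 1) else 0) (pmap A N i s u) = 0"
    proof
      fix s assume s: "s \<in> {s. s < l \<and> tgt A i s = tgt A j 1} - Suc ` ?I"
      have "\<not> (0 < s \<and> tgt A i (s - 1) = j)"
      proof
        assume *: "0 < s \<and> tgt A i (s - 1) = j"
        then have "s - 1 \<in> ?I" using s by auto
        then have "Suc (s - 1) \<in> Suc ` ?I" by blast
        then show False using s * by simp
      qed
      then show "scl (if 0 < s \<and> tgt A i (s - 1) = j then c (s - 1) else 0) (pmap A N i s u) = 0"
        by auto
    qed
  qed auto
  finally show ?thesis .
qed

lemma pmap_Suc_shift:
  assumes "j < nv A"
  shows "pmap A M j (Suc t) u = pmap A M (tgt A j 1) t (act M j u)"
  using pmap_plus[of A M j 1 t u] assms by simp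

lemma is_intervalD:
  assumes "is_interval A M i l v"
  shows "wfA A M" "v \<in> vec (dm M i)" "pmap A M i l v = 0" "\<And>s. s < l \<Longrightarrow> pmap A M i s v \<noteq> 0"
    "\<And>j w. w \<in> vec (dm M j) \<Longrightarrow> \<exists>c. w = lc A M i l v j c"
  using assms by (auto simp: is_interval_def)

lemma interval_pmap_ge: "is_interval A M i l v \<Longrightarrow> l \<le> s \<Longrightarrow> pmap A M i s v = 0"
  using pmap_plus[of A M i l "s - l" v] is_intervalD(3) by fastforce

lemma interval_pmap_kill:
  assumes "is_interval A M i l v" "w \<in> vec (dm M j)" "l \<le> t"
  shows "pmap A M j t w = 0"
proof -
  obtain c where "w = lc A M i l v j c" using is_intervalD(5)[OF assms(1,2)] by blast
  then show ?thesis
    unfolding pmap_lc using interval_pmap_ge[OF assms(1)] assms(3) by (simp add: pmap_lc)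
qed

text \<open>The path of length \<open>l - 1 - s0\<close> carries degree \<open>s0\<close> to the
  last degree and everything above it to zero. This isolates the lowest coefficient and is the basis
  for all later coefficient arguments.\<close>

lemma interval_lead:
  assumes I: "is_interval A M i l v" and s0: "s0 < l" "tgt A i s0 = j"
    and low: "\<And>s. s < s0 \<Longrightarrow> tgt A i s = j \<Longrightarrow> c s = 0"
  shows "pmap A M j (l - 1 - s0) (lc A M i l v j c) = scl (c s0) (pmap A M i (l - 1) v)"
proof -
  let ?I = "{s. s < l \<and> tgt A i s = j}"
  have z: "scl (c s) (pmap A M i (s + (l - 1 - s0)) v) = 0" if "s \<in> ?I - {s0}" for s
  proof (cases "s < s0")
    case True
    then show ?thesis using low that by simp
  next
    case False
    then have "l \<le> s + (l - 1 - s0)" using that s0 by auto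
    then show ?thesis using interval_pmap_ge[OF I] by simp
  qed
  have "pmap A M j (l - 1 - s0) (lc A M i l v j c)
      = (\<Sum>s\<in>{s0}. scl (c s) (pmap A M i (s + (l - 1 - s0)) v))"
    unfolding pmap_lc by (rule sum.mono_neutral_right) (use s0 z in auto)
  then show ?thesis using s0(1) by simp
qed

lemma interval_lc_eq_0:
  assumes I: "is_interval A M i l v" and z: "lc A M i l v j c = 0" and s: "s < l" "tgt A i s = j"
  shows "c s = 0"
proof (rule ccontr)
  assume nz: "c s \<noteq> 0"
  let ?P = "\<lambda>s. s < l \<and> tgt A i s = j \<and> c s \<noteq> 0"
  define s0 where "s0 = (LEAST s. ?P s)"
  have P: "?P s0" unfolding s0_def by (rule LeastI[of _ s]) (use nz s in auto)
  have low: "c t = 0" if "t < s0" "tgt A i t = j" for t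
    using not_less_Least[of t ?P] that P unfolding s0_def[symmetric] by auto
  have "scl (c s0) (pmap A M i (l - 1) v) = 0"
    using interval_lead[OF I, of s0 j c] P low z by simp
  then show False using P is_intervalD(4)[OF I, of "l - 1"] by simp
qed

lemma interval_lc_inj:
  assumes "is_interval A M i l v" "lc A M i l v j c = lc A M i l v j d" "s < l" "tgt A i s = j"
  shows "c s = d s"
  using interval_lc_eq_0[OF assms(1), of j "\<lambda>s. c s - d s" s] assms by (simp flip: lc_diff)

text \<open>The socle of an interval is simple and essential: every nonzero vector can be pushed
  onto a nonzero multiple of the socle vector.\<close>

lemma interval_nonzero_lead:
  assumes I: "is_interval A M i l v" and w: "w \<in> vec (dm M j)" "w \<noteq> 0"
  shows "\<exists>s c. s < l \<and> tgt A i s = j \<and> c \<noteq> 0 \<and> pmap A M j (l - 1 - s) w = scl c (pmap A M i (l - 1) v)"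
proof -
  obtain c where c: "w = lc A M i l v j c" using is_intervalD(5)[OF I w(1)] by blast
  let ?P = "\<lambda>s. s < l \<and> tgt A i s = j \<and> c s \<noteq> 0"
  have "\<exists>s. ?P s"
  proof (rule ccontr)
    assume "\<nexists>s. ?P s"
    then have "w = 0" unfolding c lc_def by (intro sum.neutral) auto
    then show False using w by simp
  qed
  then obtain s where s: "?P s" by blast
  define s0 where "s0 = (LEAST s. ?P s)"
  have P: "?P s0" unfolding s0_def using s by (rule LeastI)
  have low: "c t = 0" if "t < s0" "tgt A i t = j" for t
    using not_less_Least[of t ?P] that P unfolding s0_def[symmetric] by auto
  then show ?thesis using interval_lead[OF I, of s0 j c] P c by blast
qed

text \<open>The choice is determined only at degrees \<open>s < l\<close> over \<open>j\<close>,
  which explains the side conditions of the rules below.\<close>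

definition cof :: "'k::field nak \<Rightarrow> 'k rep \<Rightarrow> nat \<Rightarrow> nat \<Rightarrow> (nat \<Rightarrow> 'k) \<Rightarrow> nat \<Rightarrow> (nat \<Rightarrow> 'k) \<Rightarrow> nat \<Rightarrow> 'k" where
  "cof A M i l v j w = (SOME c. w = lc A M i l v j c)"

lemma lc_cof: "is_interval A M i l v \<Longrightarrow> w \<in> vec (dm M j) \<Longrightarrow> lc A M i l v j (cof A M i l v j w) = w"
  unfolding cof_def using someI_ex[OF is_intervalD(5)] by metis

lemma cof_eq:
  assumes I: "is_interval A M i l v" and w: "w = lc A M i l v j c" and s: "s < l" "tgt A i s = j"
  shows "cof A M i l v j w s = c s"
  using interval_lc_inj[OF I _ s] lc_cof[OF I, of w j] w is_intervalD(1,2)[OF I] by simp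

lemma cof_add:
  assumes I: "is_interval A M i l v" and w: "w \<in> vec (dm M j)" "x \<in> vec (dm M j)"
    and s: "s < l" "tgt A i s = j"
  shows "cof A M i l v j (w + x) s = cof A M i l v j w s + cof A M i l v j x s"
  by (rule cof_eq[OF I _ s]) (simp add: lc_add[symmetric] lc_cof[OF I] w)

lemma cof_scl:
  assumes I: "is_interval A M i l v" and w: "w \<in> vec (dm M j)"
    and s: "s < l" "tgt A i s = j"
  shows "cof A M i l v j (scl a w) s = a * cof A M i l v j w s"
  by (rule cof_eq[OF I _ s]) (simp add: lc_scl[symmetric] lc_cof[OF I] w)

section \<open>Homomorphisms out of and onto intervals\<close>

text \<open>An interval is the cyclic module whose generator is killed by the path of length
  \<open>l\<close>. Uniqueness of coefficients makes the assignment of the generator to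
  \<open>u\<close> well defined.\<close>

lemma hom_from_interval:
  assumes I: "is_interval A M i l v" and N: "wfA A N" and u: "u \<in> vec (dm N i)" "pmap A N i l u = 0"
  shows "\<exists>h. hom A M N h \<and> hap M h i v = u"
proof -
  let ?F = "\<lambda>j w. lc A N i l u j (cof A M i l v j w)"
  have "\<exists>h. hom A M N h \<and> (\<forall>j. \<forall>w\<in>vec (dm M j). hap M h j w = ?F j w)"
  proof (rule hom_of_linear_maps)
    fix j and w :: "nat \<Rightarrow> 'a" assume w: "w \<in> vec (dm M j)"
    let ?g = "\<lambda>s. if 0 < s \<and> tgt A i (s - 1) = j then cof A M i l v j w (s - 1) else 0"
    have "act M j w = lc A M i l v (tgt A j 1) ?g"
      using act_lc[OF is_intervalD(3)[OF I], of j "cof A M i l v j w"] lc_cof[OF I w] by simp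
    then have "?F (tgt A j 1) (act M j w) = lc A N i l u (tgt A j 1) ?g"
      by (intro lc_cong cof_eq[OF I])
    then show "?F (tgt A j 1) (act M j w) = act N j (?F j w)"
      by (simp add: act_lc[OF u(2)])
  qed (use I N u is_intervalD(1)[OF I] cof_add[OF I] cof_scl[OF I] in
      \<open>auto simp: lc_add lc_scl intro!: lc_cong\<close>)
  then obtain h where h: "hom A M N h" "\<And>j w. w \<in> vec (dm M j) \<Longrightarrow> hap M h j w = ?F j w" by blast
  have "hap M h i v = u"
  proof (cases "l = 0")
    case True
    then have "u = 0" "v = 0" using u is_intervalD(3)[OF I] by auto
    then show ?thesis by simp
  next
    case False
    then have "v \<noteq> 0" using is_intervalD(4)[OF I, of 0] by simp
    then have i: "tgt A i 0 = i" using vertex_lt is_intervalD(1,2)[OF I] tgt_0 by blast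
    let ?d = "\<lambda>t. if t = 0 then 1 else 0"
    have v: "v = lc A M i l v i ?d" "u = lc A N i l u i ?d"
      using lc_single[of 0 l A i i] False i by auto
    have "hap M h i v = ?F i v" using h(2) is_intervalD(2)[OF I] by blast
    also have "\<dots> = lc A N i l u i ?d" by (intro lc_cong cof_eq[OF I v(1)])
    finally show ?thesis using v(2) by simp
  qed
  with h show ?thesis by blast
qed

lemma hom_interval_eqI:
  assumes I: "is_interval A M i l v" and h: "hom A M N h" "hom A M N g" "hap M h i v = hap M g i v"
    and w: "w \<in> vec (dm M j)"
  shows "hap M h j w = hap M g j w"
  using hom_lc[OF h(1) is_intervalD(2)[OF I]] hom_lc[OF h(2) is_intervalD(2)[OF I]] h(3)
    is_intervalD(5)[OF I w] by metis

lemma interval_transport: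
  assumes f: "hom A M N f" "monic M f" "epi M N f" and I: "is_interval A M i l v"
  shows "is_interval A N i l (hap M f i v)"
  unfolding is_interval_def
proof (intro conjI allI impI ballI)
  note v = is_intervalD(2)[OF I]
  show "wfA A N" using hom_wf f by blast
  show "hap M f i v \<in> vec (dm N i)" using f by blast
  show "pmap A N i l (hap M f i v) = 0"
    using hom_pmap[OF f(1) v, of l] is_intervalD(3)[OF I] by simp
  show "pmap A N i s (hap M f i v) \<noteq> 0" if "s < l" for s
    using hom_pmap[OF f(1) v, of s] is_intervalD(4)[OF I that]
      monicD[OF f(2) pmap_vec[OF is_intervalD(1)[OF I] v]] by metis
  show "\<exists>c. w = lc A N i l (hap M f i v) j c" if "w \<in> vec (dm N j)" for j w
  proof -
    obtain x where "x \<in> vec (dm M j)" "hap M f j x = w" using epiD[OF f(3) \<open>w \<in> vec (dm N j)\<close>] by blast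
    then show ?thesis using is_intervalD(5)[OF I] hom_lc[OF f(1) v] by metis
  qed
qed

lemma interval_iso_transport:
  assumes "iso A M N" "is_interval A M i l v"
  shows "\<exists>w. is_interval A N i l w"
  using assms interval_transport unfolding iso_def by blast

text \<open>Since the socle is essential, a map is injective as soon as the socle vector
  survives.\<close>

lemma interval_monicI:
  assumes I: "is_interval A M i l v" and h: "hom A M N h"
    and nz: "0 < l \<Longrightarrow> pmap A N i (l - 1) (hap M h i v) \<noteq> 0"
  shows "monic M h"
  unfolding monic_iff
proof (intro allI ballI impI, rule ccontr)
  fix j w assume w: "w \<in> vec (dm M j)" "hap M h j w = 0" "w \<noteq> 0"
  obtain s c where s: "s < l" "tgt A i s = j" "c \<noteq> 0"
      "pmap A M j (l - 1 - s) w = scl c (pmap A M i (l - 1) v)"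
    using interval_nonzero_lead[OF I w(1,3)] by blast
  have t: "tgt A j (l - 1 - s) = tgt A i (l - 1)" using s by (auto simp flip: s(2))
  have "0 = hap M h (tgt A j (l - 1 - s)) (pmap A M j (l - 1 - s) w)"
    using hom_pmap[OF h w(1), of "l - 1 - s"] w(2) by simp
  also have "\<dots> = scl c (pmap A N i (l - 1) (hap M h i v))"
    unfolding s(4) t amap_scl hom_pmap[OF h is_intervalD(2)[OF I]] ..
  finally show False using nz s by auto
qed

text \<open>A form of the Nakayama lemma: an image that contains the generator modulo the radical is
  everything. Induction from the highest degree downwards removes the higher terms.\<close>

lemma interval_epiI:
  assumes I: "is_interval A M i l v" and g: "hom A Z M g" and z: "z \<in> vec (dm Z i)"
    and c: "hap Z g i z = lc A M i l v i c" "c 0 \<noteq> 0" and i: "i < nv A"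
  shows "epi Z M g"
proof -
  let ?U = "\<lambda>j. hap Z g j ` vec (dm Z j)"
  have sub: "fv.subspace (?U j)" for j
    using fp.linear_subspace_image[OF lin_amap vec_subspace] .
  have gen: "pmap A M i s v \<in> ?U (tgt A i s)" for s
  proof (induction "l - s" arbitrary: s rule: less_induct)
    case less
    show ?case
    proof (cases "s < l")
      case False
      then show ?thesis using interval_pmap_ge[OF I] fv.subspace_0[OF sub] by simp
    next
      case True
      let ?I = "{t. t < l \<and> tgt A i t = i}"
      have "pmap A M i s (hap Z g i z) \<in> ?U (tgt A i s)"
        using hom_pmap[OF g z, of s] pmap_vec[OF hom_wf(1)[OF g] z, of s] by (metis imageI)
      moreover have "pmap A M i s (hap Z g i z) = (\<Sum>t\<in>?I. scl (c t) (pmap A M i (t + s) v))"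
        unfolding c(1) by (rule pmap_lc)
      moreover have "\<dots> = scl (c 0) (pmap A M i s v) + (\<Sum>t\<in>?I - {0}. scl (c t) (pmap A M i (t + s) v))"
        using True i by (subst sum.remove[of _ 0]) auto
      moreover have "(\<Sum>t\<in>?I - {0}. scl (c t) (pmap A M i (t + s) v)) \<in> ?U (tgt A i s)"
      proof (intro fv.subspace_sum[OF sub] fv.subspace_scale[OF sub])
        fix t assume t: "t \<in> ?I - {0}"
        then have "tgt A i (t + s) = tgt A i s" using tgt_tgt[of A i t s] by simp
        then show "pmap A M i (t + s) v \<in> ?U (tgt A i s)"
          using less[of "t + s"] t True by auto
      qed
      ultimately have "scl (c 0) (pmap A M i s v) \<in> ?U (tgt A i s)"
        by (metis (no_types, lifting) add_diff_cancel_right' fv.subspace_diff[OF sub])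
      then have "scl (inverse (c 0)) (scl (c 0) (pmap A M i s v)) \<in> ?U (tgt A i s)"
        by (rule fv.subspace_scale[OF sub])
      then show ?thesis using c(2) by simp
    qed
  qed
  show ?thesis
    unfolding epi_def
  proof (intro allI impI)
    fix j and w :: "nat \<Rightarrow> 'a" assume "w \<in> vec (dm M j)"
    then obtain d where d: "w = lc A M i l v j d" using is_intervalD(5)[OF I] by blast
    have "w \<in> ?U j"
      unfolding d lc_def
      by (intro fv.subspace_sum[OF sub] fv.subspace_scale[OF sub]) (use gen in auto)
    then show "\<exists>x\<in>vec (dm Z j). hap Z g j x = w" by auto
  qed
qed

lemma interval_0_zero: "is_interval A M i 0 v \<Longrightarrow> zero_rep M"
  by (rule zero_repI) (auto dest: is_intervalD(5) simp: lc_def)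

lemma zero_interval: "wfA A M \<Longrightarrow> zero_rep M \<Longrightarrow> is_interval A M i 0 0"
  by (auto simp: is_interval_def lc_def dest: zero_repD)

lemma projective_zero: "wfA A M \<Longrightarrow> zero_rep M \<Longrightarrow> projective A M"
  for M :: "'k::field rep"
proof (rule projectiveI)
  fix X Y :: "'k rep" and g f assume *: "wfA A M" "zero_rep M" "hom A X Y g"
  obtain h where "hom A M X h" using hom_zero[OF *(1) hom_wf(1)[OF *(3)]] by blast
  moreover have "v = 0" if "v \<in> vec (dm M i)" for i and v :: "nat \<Rightarrow> 'k"
    using *(2) that by (rule zero_repD)
  ultimately show "\<exists>h. hom A M X h \<and> (\<forall>i. \<forall>v\<in>vec (dm M i). hap X g i (hap M h i v) = hap M f i v)"
    by (metis amap_0)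
qed

lemma interval_iso:
  assumes I: "is_interval A M i l v" and J: "is_interval A N i l u"
  shows "iso A M N"
proof -
  obtain h where h: "hom A M N h" "hap M h i v = u"
    using hom_from_interval[OF I is_intervalD(1,2,3)[OF J]] by blast
  have "monic M h"
    by (rule interval_monicI[OF I h(1)]) (use h(2) is_intervalD(4)[OF J] in simp)
  moreover have "epi M N h"
  proof (unfold epi_def, intro allI impI)
    fix j and w :: "nat \<Rightarrow> 'a" assume "w \<in> vec (dm N j)"
    then obtain c where "w = lc A N i l u j c" using is_intervalD(5)[OF J] by blast
    then have "hap M h j (lc A M i l v j c) = w" using hom_lc[OF h(1) is_intervalD(2)[OF I]] h(2) by simp
    then show "\<exists>x\<in>vec (dm M j). hap M h j x = w" using is_intervalD(1,2)[OF I] by blast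
  qed
  ultimately show ?thesis using h by (auto simp: iso_def)
qed

lemma interval_top_lt: "is_interval A M i l v \<Longrightarrow> 0 < l \<Longrightarrow> i < nv A"
  using vertex_lt is_intervalD(1,2,4)[of A M i l v] by (metis pmap.simps(1))

text \<open>A preimage of the generator under an arrow would survive a path of length
  \<open>l\<close>, but such paths kill the whole interval.\<close>

lemma interval_not_inrad:
  assumes I: "is_interval A M i l v" and l: "0 < l"
  shows "\<not> inrad A M i v"
proof
  assume "inrad A M i v"
  moreover have "v \<noteq> 0" using is_intervalD(4)[OF I l] by simp
  ultimately obtain j u where j: "j < nv A" "tgt A j 1 = i" "u \<in> vec (dm M j)" "act M j u = v"
    by (auto simp: inrad_def)
  have "pmap A M j (Suc (l - 1)) u = pmap A M i (l - 1) v"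
    using pmap_Suc_shift[OF j(1)] j by metis
  then show False
    using is_intervalD(4)[OF I, of "l - 1"] interval_pmap_kill[OF I j(3), of l] l by simp
qed

lemma interval_soc:
  assumes I: "is_interval A M i l v" and w: "w \<in> vec (dm M j)" "w \<noteq> 0" "act M j w = 0"
  shows "j = tgt A i (l - 1)"
proof -
  obtain s c where s: "s < l" "tgt A i s = j" "c \<noteq> 0"
      "pmap A M j (l - 1 - s) w = scl c (pmap A M i (l - 1) v)"
    using interval_nonzero_lead[OF I w(1,2)] by blast
  have nz: "pmap A M j (l - 1 - s) w \<noteq> 0"
    using s is_intervalD(4)[OF I, of "l - 1"] by simp
  have j: "j < nv A" using vertex_lt[OF is_intervalD(1)[OF I] w(1,2)] .
  have "l - 1 - s = 0"
  proof (rule ccontr)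
    assume "l - 1 - s \<noteq> 0"
    then obtain t where "l - 1 - s = Suc t" using not0_implies_Suc by blast
    then show False using nz pmap_Suc_shift[OF j, of M t w] w(3) by simp
  qed
  then have "s = l - 1" using s(1) by simp
  then show ?thesis using s(2) by simp
qed

context nakayama_algebra
begin

lemma interval_le_plen: "is_interval A M i l v \<Longrightarrow> l \<le> plen A i"
  using pmap_plen[of M v i "plen A i"] is_intervalD[of A M i l v] by (metis le_refl not_le)

text \<open>At the maximal length the condition on \<open>u\<close> in
  \<open>hom_from_interval\<close> holds for every vector of every module, so any lift of the
  generator extends to a homomorphism.\<close>

lemma projective_interval:
  assumes I: "is_interval A P i (plen A i) v"
  shows "projective A P"
proof (rule projectiveI[OF is_intervalD(1)[OF I]])
  fix X Y :: "'k rep" and g f assume *: "hom A X Y g" "epi X Y g" "hom A P Y f"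
  obtain u where u: "u \<in> vec (dm X i)" "hap X g i u = hap P f i v"
    using epiD[OF *(2) hom_vec[OF *(3)]] by blast
  obtain h where h: "hom A P X h" "hap P h i v = u"
    using hom_from_interval[OF I hom_wf(1)[OF *(1)] u(1) pmap_plen[OF hom_wf(1)[OF *(1)] u(1)]] by auto
  have "hap P (hcomp X g h) j w = hap P f j w" if "w \<in> vec (dm P j)" for j w
    by (rule hom_interval_eqI[OF I hom_hcomp[OF h(1) *(1)] *(3) _ that]) (simp add: hcomp_app h u)
  then show "\<exists>h. hom A P X h \<and> (\<forall>i. \<forall>v\<in>vec (dm P i). hap X g i (hap P h i v) = hap P f i v)"
    using h(1) unfolding hcomp_app by blast
qed

text \<open>All positive degrees over \<open>j\<close> are preceded by the same vertex
  \<open>p\<close>, so a single vector at \<open>p\<close> is mapped to the whole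
  combination.\<close>

lemma lc_inrad:
  assumes I: "is_interval A M i l v" and c: "i = j \<Longrightarrow> c 0 = 0"
  shows "inrad A M j (lc A M i l v j c)"
proof (cases "\<exists>s. 0 < s \<and> s < l \<and> tgt A i s = j")
  case False
  have "lc A M i l v j c = 0"
    unfolding lc_def
  proof (rule sum.neutral, rule ballI)
    fix s assume s: "s \<in> {s. s < l \<and> tgt A i s = j}"
    then have "s = 0" using False by auto
    then have "i = j" using s interval_top_lt[OF I] by auto
    then show "scl (c s) (pmap A M i s v) = 0" using c \<open>s = 0\<close> by simp
  qed
  then show ?thesis by (simp add: inrad_def)
next
  case True
  then obtain s1 where s1: "0 < s1" "s1 < l" "tgt A i s1 = j" by blast
  define p where "p = tgt A i (s1 - 1)"
  have lt: "tgt A i s < nv A" if "s < l" for s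
    using that interval_le_plen[OF I] by (intro tgt_lt plen_valid) simp
  have p: "p < nv A" "tgt A p 1 = j" using lt[of "s1 - 1"] s1 by (auto simp: p_def)
  have i: "tgt A i 0 = i" using interval_top_lt[OF I] s1 by simp
  have "act M p (lc A M i l v p (\<lambda>s. c (Suc s))) = lc A M i l v j c"
    unfolding act_lc[OF is_intervalD(3)[OF I]] p(2)
  proof (rule lc_cong)
    fix s assume s: "s < l" "tgt A i s = j"
    show "(if 0 < s \<and> tgt A i (s - 1) = p then c (Suc (s - 1)) else 0) = c s"
    proof (cases "s = 0")
      case True
      then show ?thesis using c s i by simp
    next
      case False
      have e: "tgt A (tgt A i (s - 1)) 1 = tgt A p 1" using False s p by simp
      have "tgt A i (s - 1) = p" by (rule tgt_1_inj[OF lt p(1) e]) (use s in auto)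
      then show ?thesis using False by simp
    qed
  qed
  then show ?thesis
    unfolding inrad_def using p is_intervalD(1,2)[OF I] by blast
qed

lemma interval_top:
  assumes I: "is_interval A M i l v" and w: "w \<in> vec (dm M j)" "\<not> inrad A M j w"
  shows "j = i"
  using is_intervalD(5)[OF I w(1)] lc_inrad[OF I] w(2) by metis

end

text \<open>The basis vector of degree \<open>s\<close> sits at vertex \<open>tgt A i s\<close> with index \<open>s div nv A\<close>, so that
  vertex \<open>j\<close> carries the degrees \<open>(j - i) mod nv A + nv A * r\<close> below \<open>l\<close>.\<close>

definition ivl :: "'k::field nak \<Rightarrow> nat \<Rightarrow> nat \<Rightarrow> 'k rep" where
  "ivl A i l =
     \<lparr> dm = (\<lambda>j. if j < nv A then (l - (j + nv A - i) mod nv A + nv A - 1) div nv A else 0),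
       ar = (\<lambda>j r' r. let s = (j + nv A - i) mod nv A + nv A * r in
              if j < nv A \<and> Suc s < l \<and> r' = Suc s div nv A then 1 else 0) \<rparr>"

text \<open>The quotient is a ceiling; in \<open>ivl\<close> it counts the degrees below
  \<open>l\<close> in one residue class.\<close>

lemma less_ceil_div: "0 < (n::nat) \<Longrightarrow> r < (x + n - 1) div n \<longleftrightarrow> n * r < x"
  using less_eq_div_iff_mult_less_eq[of n "Suc r" "x + n - 1"]
  by (auto simp: Suc_le_eq mult.commute)

context nakayama_algebra
begin

context
  fixes i l :: nat
  assumes i: "i < nv A" and l: "l \<le> plen A i"
begin

lemma ivl_tgt_lt: "s < l \<Longrightarrow> tgt A i s < nv A"
  using l by (intro tgt_lt plen_valid) simp

lemma ivl_offset: "(tgt A i s + nv A - i) mod nv A = s mod nv A"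
proof -
  have "(tgt A i s + nv A - i) mod nv A = (tgt A i s + (nv A - i)) mod nv A" using i by simp
  also have "\<dots> = (i + s + (nv A - i)) mod nv A" by (simp add: tgt_def mod_add_left_eq)
  also have "i + s + (nv A - i) = s + nv A" using i by simp
  finally show ?thesis by simp
qed

lemma ivl_dm: "r < dm (ivl A i l) j \<longleftrightarrow> j < nv A \<and> (j + nv A - i) mod nv A + nv A * r < l"
  using less_ceil_div[OF nv_pos, of r "l - (j + nv A - i) mod nv A"]
  by (auto simp: ivl_def less_diff_conv add.commute)

lemma ivl_vertex:
  assumes j: "j < nv A" and s: "(j + nv A - i) mod nv A + nv A * r < l"
  shows "tgt A i ((j + nv A - i) mod nv A + nv A * r) = j"
proof (cases "cyc A")
  case True
  have "(i + ((j + nv A - i) mod nv A + nv A * r)) mod nv A = (i + (j + nv A - i)) mod nv A"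
    by (metis add.assoc mod_add_right_eq mod_mult_self2)
  also have "\<dots> = j" using i j by simp
  finally show ?thesis using True by (simp add: tgt_def)
next
  case False
  \<comment> \<open>On a line a valid path cannot wrap around, which forces \<open>r = 0\<close> and
    \<open>i \<le> j\<close>.\<close>
  have "valid_path A i ((j + nv A - i) mod nv A + nv A * r)"
    using s l by (intro plen_valid) simp
  then have lt: "i + ((j + nv A - i) mod nv A + nv A * r) < nv A"
    using False by (simp add: valid_path_def)
  then have "nv A * r < nv A" by linarith
  then have r: "r = 0" by (cases r) auto
  have "i \<le> j"
  proof (rule ccontr)
    assume "\<not> i \<le> j"
    then have "(j + nv A - i) mod nv A = j + nv A - i" using i by simp
    then show False using lt i r by simp
  qed
  then have "(j + nv A - i) mod nv A = j - i" using j i by (simp add: mod_if)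
  then show ?thesis using r False \<open>i \<le> j\<close> by (simp add: tgt_def)
qed

lemma ivl_basis:
  assumes "r < dm (ivl A i l) j"
  obtains s where "s < l" "j = tgt A i s" "r = s div nv A"
proof -
  let ?s = "(j + nv A - i) mod nv A + nv A * r"
  have "?s < l" "j < nv A" using assms ivl_dm by auto
  then show thesis using that[of ?s] ivl_vertex nv_pos by simp
qed

lemma ivl_basis_lt: "s < l \<Longrightarrow> s div nv A < dm (ivl A i l) (tgt A i s)"
  unfolding ivl_dm ivl_offset using ivl_tgt_lt by simp

lemma ivl_ar: "ar (ivl A i l) (tgt A i s) r' (s div nv A)
    = (if tgt A i s < nv A \<and> Suc s < l \<and> r' = Suc s div nv A then 1 else 0)"
proof -
  have e: "(tgt A i s + nv A - i) mod nv A + nv A * (s div nv A) = s"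
    unfolding ivl_offset by simp
  show ?thesis by (simp add: ivl_def Let_def e)
qed

lemma ivl_act: "s < l \<Longrightarrow> act (ivl A i l) (tgt A i s) (uvec (s div nv A))
    = (if Suc s < l then uvec (Suc s div nv A) else 0)"
  unfolding amap_uvec[OF ivl_basis_lt] ivl_ar
  using ivl_tgt_lt by (auto simp: uvec_def fun_eq_iff vapp)

lemma ivl_pmap: "s < l \<Longrightarrow> pmap A (ivl A i l) (tgt A i s) t (uvec (s div nv A))
    = (if s + t < l then uvec ((s + t) div nv A) else 0)"
proof (induction t)
  case 0
  then show ?case by simp
next
  case (Suc t)
  then show ?case using ivl_act[of "s + t"] by simp
qed

text \<open>By \<open>plen_le_of_rel\<close> every path occurring in a relation has at least length
  \<open>plen A j\<close>, so this makes the ideal act as zero.\<close>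

lemma ivl_pmap_kill:
  fixes v :: "nat \<Rightarrow> 'k"
  assumes v: "v \<in> vec (dm (ivl A i l) j)" and t: "plen A j \<le> t"
  shows "pmap A (ivl A i l) j t v = 0"
proof -
  have "pmap A (ivl A i l) j t (uvec r) = 0" if r: "r < dm (ivl A i l) j" for r
  proof -
    obtain s where s: "s < l" "j = tgt A i s" "r = s div nv A" using ivl_basis[OF r] .
    have "l \<le> s + t" using plen_le_add[of s i] l s t by simp
    then show ?thesis using ivl_pmap[OF s(1), of t] s by simp
  qed
  then show ?thesis
    by (subst vec_expand[OF v]) (simp add: pmap_sum pmap_scl)
qed

lemma ivl_wfA: "wfA A (ivl A i l :: 'k rep)"
  unfolding wfA_def
proof (intro conjI allI impI ballI)
  let ?M = "ivl A i l :: 'k rep"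
  show "dm ?M j = 0" if "nv A \<le> j" for j using that by (simp add: ivl_def)
  have wf: "ar ?M j r' r = 0 \<or> (r < dm ?M j \<and> r' < dm ?M (tgt A j 1) \<and> valid_path A j 1)" for j r' r
  proof (cases "ar ?M j r' r = 0")
    case False
    then have "r < dm ?M j" unfolding ivl_dm by (auto simp: ivl_def Let_def split: if_splits)
    then obtain s where s: "s < l" "j = tgt A i s" "r = s div nv A" using ivl_basis by blast
    then have *: "Suc s < l" "r' = Suc s div nv A" using False ivl_ar[of s r'] by (auto split: if_splits)
    then have "valid_path A i (s + 1)" using l by (intro plen_valid) simp
    then have "valid_path A j 1" using s valid_path_plus[of i s 1] by simp
    moreover have "r' < dm ?M (tgt A j 1)" using ivl_basis_lt[OF *(1)] * s by simp
    ultimately show ?thesis using \<open>r < dm ?M j\<close> by blast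
  qed simp
  then show "wf_mat (ar ?M j) (dm ?M (tgt A j 1)) (dm ?M j)" for j
    unfolding wf_mat_def by (metis not_less)
  show "ar ?M j = (\<lambda>_ _. 0)" if "\<not> valid_path A j 1" for j
    using wf that by blast
  show "annihilates A ?M \<rho>" if \<rho>: "\<rho> \<in> rel A" for \<rho>
    unfolding annihilates_iff
  proof (intro allI ballI sum.neutral)
    fix j j' t and v :: "nat \<Rightarrow> 'k"
    assume v: "v \<in> vec (dm ?M j)" and t: "t \<in> {t. \<rho> (j, t) \<noteq> 0 \<and> tgt A j t = j'}"
    then show "scl (\<rho> (j, t)) (pmap A ?M j t v) = 0"
      using ivl_pmap_kill[OF v] plen_le_of_rel[OF \<rho>] by simp
  qed
qed

lemma ivl_is_interval: "\<exists>v. is_interval A (ivl A i l) i l v"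
proof (cases "l = 0")
  case True
  have "zero_rep (ivl A i l)"
    unfolding zero_rep_def using ivl_dm True by (metis gr0I not_less0)
  then show ?thesis using zero_interval[OF ivl_wfA] True by blast
next
  case False
  let ?M = "ivl A i l" and ?v = "uvec 0 :: nat \<Rightarrow> 'k"
  have p: "pmap A ?M i s ?v = (if s < l then uvec (s div nv A) else 0)" for s
    using ivl_pmap[of 0 s] False i by simp
  have "uvec r \<noteq> (0 :: nat \<Rightarrow> 'k)" for r
    by (metis uvec_def zero_fun_apply zero_neq_one)
  moreover have "\<exists>c. w = lc A ?M i l ?v j c" if w: "w \<in> vec (dm ?M j)" for j w
  proof -
    let ?o = "(j + nv A - i) mod nv A"
    have "w = (\<Sum>r<dm ?M j. scl (w r) (uvec r))" by (rule vec_expand[OF w])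
    also have "\<dots> = (\<Sum>r<dm ?M j. scl (w ((?o + nv A * r) div nv A)) (pmap A ?M i (?o + nv A * r) ?v))"
      using ivl_dm nv_pos by (intro sum.cong) (auto simp: p)
    also have "\<dots> = (\<Sum>s\<in>(\<lambda>r. ?o + nv A * r) ` {..<dm ?M j}. scl (w (s div nv A)) (pmap A ?M i s ?v))"
      using nv_pos by (subst sum.reindex) (auto intro!: inj_onI)
    also have "(\<lambda>r. ?o + nv A * r) ` {..<dm ?M j} = {s. s < l \<and> tgt A i s = j}"
    proof (intro equalityI subsetI)
      fix s assume "s \<in> (\<lambda>r. ?o + nv A * r) ` {..<dm ?M j}"
      then show "s \<in> {s. s < l \<and> tgt A i s = j}" using ivl_dm ivl_vertex by auto
    next
      fix s assume s: "s \<in> {s. s < l \<and> tgt A i s = j}"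
      then have "s div nv A < dm ?M j" using ivl_basis_lt[of s] by auto
      moreover have "s = ?o + nv A * (s div nv A)" using s ivl_offset[of s] by auto
      ultimately show "s \<in> (\<lambda>r. ?o + nv A * r) ` {..<dm ?M j}" by blast
    qed
    finally show ?thesis unfolding lc_def by (rule exI[of _ "\<lambda>s. w (s div nv A)"])
  qed
  moreover have "?v \<in> vec (dm ?M i)" using ivl_basis_lt[of 0] False i by simp
  ultimately show ?thesis
    unfolding is_interval_def using ivl_wfA p by (intro exI[of _ ?v]) auto
qed

end

lemma interval_exists:
  assumes "i < nv A" "l \<le> plen A i"
  obtains M v where "is_interval A M i l v"
  using ivl_is_interval[OF assms] by blast

end

section \<open>Tops, socles and syzygies\<close>

lemma lc_truncate:
  assumes "is_interval A N i l' v" "l' \<le> l"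
  shows "lc A N i l v j c = lc A N i l' v j c"
  unfolding lc_def
  by (rule sum.mono_neutral_right) (use assms interval_pmap_ge[OF assms(1)] in auto)

lemma lc_shift:
  assumes "\<And>s. s < l \<Longrightarrow> tgt A i s = j \<Longrightarrow> c s = 0"
  shows "lc A P i (l + m) q j c = lc A P (tgt A i l) m (pmap A P i l q) j (\<lambda>s. c (l + s))"
proof -
  let ?I = "{s. s < m \<and> tgt A i (l + s) = j}"
  have "lc A P i (l + m) q j c = (\<Sum>s\<in>(+) l ` ?I. scl (c s) (pmap A P i s q))"
    unfolding lc_def
  proof (rule sum.mono_neutral_right)
    show "\<forall>s\<in>{s. s < l + m \<and> tgt A i s = j} - (+) l ` ?I. scl (c s) (pmap A P i s q) = 0"
    proof
      fix s assume s: "s \<in> {s. s < l + m \<and> tgt A i s = j} - (+) l ` ?I"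
      have "s < l"
      proof (rule ccontr)
        assume "\<not> s < l"
        then have "s - l \<in> ?I" using s by auto
        then have "l + (s - l) \<in> (+) l ` ?I" by blast
        then show False using s \<open>\<not> s < l\<close> by simp
      qed
      then show "scl (c s) (pmap A P i s q) = 0" using assms s by simp
    qed
  qed auto
  also have "\<dots> = (\<Sum>s\<in>?I. scl (c (l + s)) (pmap A P i (l + s) q))"
    by (subst sum.reindex) auto
  also have "\<dots> = lc A P (tgt A i l) m (pmap A P i l q) j (\<lambda>s. c (l + s))"
    unfolding lc_def by (rule sum.cong) (auto simp: pmap_plus)
  finally show ?thesis .
qed

text \<open>The generator coefficient survives in every nonzero quotient, so questions about the top
  of a projective can be settled in the module that it covers.\<close>

lemma interval_quotient_cof:
  assumes M: "is_interval A M i l v" and N: "is_interval A N i l' u" and l': "0 < l'" "l' \<le> l"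
    and f: "hom A M N f" "hap M f i v = u"
    and e: "hap M f i (lc A M i l v i c) = lc A N i l' u i d"
  shows "c 0 = d 0"
proof -
  have "lc A N i l' u i c = lc A N i l' u i d"
    using hom_lc[OF f(1) is_intervalD(2)[OF M], of i l c] e f(2) lc_truncate[OF N l'(2)] by simp
  from interval_lc_inj[OF N this, of 0] show ?thesis using l' interval_top_lt[OF N] by simp
qed

lemma interval_generator_lc:
  assumes "is_interval A M i l v" "0 < l"
  shows "v = lc A M i l v i (\<lambda>s. if s = 0 then 1 else 0)"
  using lc_single[of 0 l A i i M v] interval_top_lt[OF assms] assms by simp

lemma hom_inrad:
  assumes "hom A M N f" "inrad A M i v"
  shows "inrad A N i (hap M f i v)"
proof (cases "v = 0")
  case True
  then show ?thesis by (simp add: inrad_def)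
next
  case False
  then obtain j u where "j < nv A" "tgt A j 1 = i" "u \<in> vec (dm M j)" "act M j u = v"
    using assms(2) by (auto simp: inrad_def)
  then show ?thesis
    unfolding inrad_def using hom_act[OF assms(1)] assms(1) by (metis hom_vec)
qed

lemma iso_inrad:
  assumes "hom A M N f" "hom A N M g" "\<And>i v. v \<in> vec (dm M i) \<Longrightarrow> hap N g i (hap M f i v) = v"
    and "v \<in> vec (dm M i)"
  shows "inrad A N i (hap M f i v) \<longleftrightarrow> inrad A M i v"
  using hom_inrad[OF assms(1)] hom_inrad[OF assms(2)] assms(3,4) by metis

context nakayama_algebra
begin

lemma rad_subspace: "fv.subspace {v. inrad A M i v}"
  unfolding fv.subspace_def
proof (intro conjI ballI allI)
  show "0 \<in> {v. inrad A M i v}" by (simp add: inrad_def)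
  show "scl c v \<in> {v. inrad A M i v}" if v: "v \<in> {v. inrad A M i v}" for c v
  proof (cases "v = 0")
    case True
    then show ?thesis by (simp add: inrad_def)
  next
    case False
    then obtain j u where "j < nv A" "tgt A j 1 = i" "u \<in> vec (dm M j)" "act M j u = v"
      using v by (auto simp: inrad_def)
    then show ?thesis unfolding inrad_def using amap_scl vec_scl by blast
  qed
  show "v + w \<in> {v. inrad A M i v}" if v: "v \<in> {v. inrad A M i v}" and w: "w \<in> {v. inrad A M i v}" for v w
  proof (cases "v = 0 \<or> w = 0")
    case True
    then show ?thesis using v w by auto
  next
    case False
    then obtain j u where u: "j < nv A" "tgt A j 1 = i" "u \<in> vec (dm M j)" "act M j u = v"
      using v by (auto simp: inrad_def)
    obtain j' u' where u': "j' < nv A" "tgt A j' 1 = i" "u' \<in> vec (dm M j')" "act M j' u' = w"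
      using w False by (auto simp: inrad_def)
    have "j' = j" using tgt_1_inj[OF u(1) u'(1)] u u' by simp
    then have "act M j (u + u') = v + w" "u + u' \<in> vec (dm M j)" using u u' by (auto simp: amap_add)
    then show ?thesis unfolding inrad_def using u by blast
  qed
qed

lemma inrad_add: "inrad A M i u \<Longrightarrow> inrad A M i v \<Longrightarrow> inrad A M i (u + v)"
  using fv.subspace_add[OF rad_subspace] by blast

text \<open>Pull \<open>u\<close> back along arrows as far as possible. This stops because a path of
  length \<open>plen A a\<close> from \<open>a\<close> acts as zero, and where it stops the vector
  is outside the radical.\<close>

lemma nonrad_preimage:
  assumes M: "wfA A M" and u: "u \<in> vec (dm M w)" "u \<noteq> 0"
  shows "\<exists>a s q. a < nv A \<and> q \<in> vec (dm M a) \<and> \<not> inrad A M a q \<and> tgt A a s = w \<and> pmap A M a s q = u"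
proof -
  let ?P = "\<lambda>s. \<exists>a q. a < nv A \<and> q \<in> vec (dm M a) \<and> tgt A a s = w \<and> pmap A M a s q = u"
  have w: "w < nv A" using vertex_lt[OF M u] .
  have P0: "?P 0" using u w by auto
  have bound: "s \<le> (\<Sum>a<nv A. plen A a)" if "?P s" for s
  proof -
    obtain a q where a: "a < nv A" "q \<in> vec (dm M a)" "pmap A M a s q = u" using \<open>?P s\<close> by blast
    then have "s < plen A a" using pmap_plen[OF M a(2), of s] u(2) by (meson not_le)
    also have "\<dots> \<le> (\<Sum>a<nv A. plen A a)" using a(1) by (intro member_le_sum) auto
    finally show ?thesis by simp
  qed
  define s where "s = Greatest ?P"
  have "?P s" unfolding s_def by (rule GreatestI_nat[of ?P 0 "\<Sum>a<nv A. plen A a", OF P0 bound])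
  then obtain a q where a: "a < nv A" "q \<in> vec (dm M a)" "tgt A a s = w" "pmap A M a s q = u" by blast
  have "\<not> inrad A M a q"
  proof
    assume "inrad A M a q"
    moreover have "q \<noteq> 0" using a u by auto
    ultimately obtain j x where j: "j < nv A" "tgt A j 1 = a" "x \<in> vec (dm M j)" "act M j x = q"
      by (auto simp: inrad_def)
    have "pmap A M j (Suc s) x = u" using pmap_Suc_shift[OF j(1)] j a by metis
    moreover have "tgt A j (Suc s) = w" using tgt_tgt[of A j 1 s] unfolding j(2) a(3) by simp
    ultimately have "?P (Suc s)" using j by blast
    then have "Suc s \<le> s" unfolding s_def by (rule Greatest_le_nat[of ?P _ "\<Sum>a<nv A. plen A a", OF _ bound])
    then show False by simp
  qed
  then show ?thesis using a by blast
qed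

lemma socle_exists:
  fixes v :: "nat \<Rightarrow> 'k"
  assumes M: "wfA A M" and v: "v \<in> vec (dm M i)" "v \<noteq> 0"
  shows "\<exists>j. \<exists>w\<in>vec (dm M j). w \<noteq> 0 \<and> act M j w = 0"
proof -
  let ?P = "\<lambda>t. pmap A M i t v \<noteq> 0"
  have b: "t \<le> plen A i" if "?P t" for t using pmap_plen[OF M v(1), of t] that by (meson linear)
  have P0: "?P 0" using v by simp
  define t where "t = Greatest ?P"
  have t: "?P t" unfolding t_def by (rule GreatestI_nat[of ?P 0 "plen A i", OF P0 b])
  have "\<not> ?P (Suc t)" using Greatest_le_nat[of ?P "Suc t" "plen A i", OF _ b] unfolding t_def by fastforce
  then show ?thesis using t pmap_vec[OF M v(1), of t] by auto
qed

text \<open>A functional that vanishes on the radical at \<open>a\<close> defines a map to the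
  simple module: arrows into \<open>a\<close> land in the radical, and arrows out of
  \<open>a\<close> kill \<open>g\<close>.\<close>

lemma top_functional:
  assumes P: "wfA A P" and q: "q \<in> vec (dm P a)" "\<not> inrad A P a q" and S: "is_interval A S a 1 g"
  shows "\<exists>h \<phi>. hom A P S h \<and> lfun \<phi> \<and> \<phi> q = 1 \<and>
    (\<forall>j. \<forall>w\<in>vec (dm P j). hap P h j w = (if j = a then scl (\<phi> w) g else 0))"
proof -
  obtain \<phi> where \<phi>: "lfun \<phi>" "\<And>u. inrad A P a u \<Longrightarrow> \<phi> u = 0" "\<phi> q = 1"
    using separating_functional[OF rad_subspace, of q P a] q(2) by auto
  have a: "a < nv A" using interval_top_lt[OF S] by simp
  have g: "act S a g = 0" using is_intervalD(3)[OF S] a by simp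
  have "\<exists>h. hom A P S h \<and> (\<forall>j. \<forall>w\<in>vec (dm P j). hap P h j w = (if j = a then scl (\<phi> w) g else 0))"
  proof (rule hom_of_linear_maps)
    fix j and w :: "nat \<Rightarrow> 'k" assume w: "w \<in> vec (dm P j)"
    have "\<phi> (act P j w) = 0" if "tgt A j 1 = a"
    proof (rule \<phi>(2), cases "w = 0")
      case True
      then show "inrad A P a (act P j w)" by (simp add: inrad_def)
    next
      case False
      then show "inrad A P a (act P j w)"
        using vertex_lt[OF P w] w that unfolding inrad_def by blast
    qed
    then show "(if tgt A j 1 = a then scl (\<phi> (act P j w)) g else 0) = act S j (if j = a then scl (\<phi> w) g else 0)"
      using g by (auto simp: amap_scl)
  qed (use P is_intervalD(1,2)[OF S] in \<open>auto simp: lfun_add[OF \<phi>(1)] lfun_scl[OF \<phi>(1)] fv.scale_left_distrib\<close>)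
  then show ?thesis using \<phi> by blast
qed

lemma interval_simple_exists: "a < nv A \<Longrightarrow> \<exists>S g. is_interval A S a 1 g"
  using interval_exists[of a 1] plen_pos[of a] by (metis One_nat_def Suc_leI)

text \<open>If \<open>\<kappa>\<close> were outside the radical, some maximal submodule
  \<open>Z\<close> would miss it. Correcting by multiples of \<open>\<kappa>\<close> shows that
  \<open>Z\<close> still maps onto \<open>N\<close>, against minimality of the cover.\<close>

lemma proj_cover_kernel_inrad:
  assumes pc: "proj_cover A P N p" and \<kappa>: "\<kappa> \<in> vec (dm P a)" "hap P p a \<kappa> = 0"
  shows "inrad A P a \<kappa>"
proof (rule ccontr)
  assume nr: "\<not> inrad A P a \<kappa>"
  note p = proj_coverD(2,3)[OF pc]
  have P: "wfA A P" using hom_wf(1)[OF p(1)] .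
  have "\<kappa> \<noteq> 0" using nr by (auto simp: inrad_def)
  then have "a < nv A" using vertex_lt[OF P \<kappa>(1)] by blast
  then obtain S g where S: "is_interval A S a 1 g" using interval_simple_exists by blast
  obtain h \<phi> where h: "hom A P S h" "lfun \<phi>" "\<phi> \<kappa> = 1"
      "\<And>j w. w \<in> vec (dm P j) \<Longrightarrow> hap P h j w = (if j = a then scl (\<phi> w) g else 0)"
    using top_functional[OF P \<kappa>(1) nr S] by blast
  obtain Z z where Z: "hom A Z P z" "exact Z P z h" using kernel_exists[OF h(1)] by blast
  have "epi Z P z"
  proof (rule proj_coverD(4)[OF pc Z(1)])
    fix j and w :: "nat \<Rightarrow> 'k" assume "w \<in> vec (dm N j)"
    then obtain y where y: "y \<in> vec (dm P j)" "hap P p j y = w" using epiD[OF p(2)] by blast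
    \<comment> \<open>The correction puts \<open>y\<close> into the kernel of \<open>h\<close>
      without changing its image under \<open>p\<close>.\<close>
    define y' where "y' = (if j = a then y - scl (\<phi> y) \<kappa> else y)"
    have y'P: "y' \<in> vec (dm P j)" using y \<kappa> by (auto simp: y'_def)
    have "hap P h j y' = 0"
      using h(4)[OF y'P] by (auto simp: y'_def lfun_diff[OF h(2)] lfun_scl[OF h(2)] h(3))
    then obtain x where "x \<in> vec (dm Z j)" "hap Z z j x = y'" using exactD1[OF Z(2) y'P] by blast
    moreover have "hap P p j y' = w" using y \<kappa> by (auto simp: y'_def amap_diff amap_scl)
    ultimately show "\<exists>v\<in>vec (dm Z j). hap P p j (hap Z z j v) = w" by blast
  qed
  then obtain x where "x \<in> vec (dm Z a)" "hap Z z a x = \<kappa>" using epiD \<kappa>(1) by blast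
  then have "hap P h a \<kappa> = 0" using Z(2) \<kappa>(1) unfolding exact_iff by blast
  then have "g = 0" using h(3) h(4)[OF \<kappa>(1)] by simp
  then show False using is_intervalD(4)[OF S, of 0] by simp
qed

lemma proj_cover_nonrad:
  assumes pc: "proj_cover A P N p" and q: "q \<in> vec (dm P a)" "\<not> inrad A P a q"
  shows "\<not> inrad A N a (hap P p a q)"
proof
  assume "inrad A N a (hap P p a q)"
  moreover have "hap P p a q \<noteq> 0" using proj_cover_kernel_inrad[OF pc q(1)] q(2) by blast
  ultimately obtain j n where j: "j < nv A" "tgt A j 1 = a" "n \<in> vec (dm N j)" "act N j n = hap P p a q"
    by (auto simp: inrad_def)
  note p = proj_coverD(2,3)[OF pc]
  obtain q' where q': "q' \<in> vec (dm P j)" "hap P p j q' = n" using epiD[OF p(2) j(3)] by blast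
  have a: "act P j q' \<in> vec (dm P a)" using act_vec[OF hom_wf(1)[OF p(1)], of j q'] j by simp
  have "hap P p a (q - act P j q') = 0"
    using hom_act[OF p(1) q'(1)] j q' by (simp add: amap_diff)
  then have "inrad A P a (q - act P j q')" using proj_cover_kernel_inrad[OF pc] q(1) a by blast
  moreover have "inrad A P a (act P j q')" unfolding inrad_def using j q' by blast
  ultimately have "inrad A P a (q - act P j q' + act P j q')" by (rule inrad_add)
  then show False using q(2) by simp
qed

text \<open>A quotient map onto the simple top lifts to the indecomposable projective, so a vector outside
  the radical of a projective module generates a free copy of it.\<close>

lemma projective_nonrad_pmap:
  assumes P: "projective A P" and q: "q \<in> vec (dm P a)" "\<not> inrad A P a q" and s: "s < plen A a"
  shows "pmap A P a s q \<noteq> 0"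
proof
  assume z: "pmap A P a s q = 0"
  have wP: "wfA A P" using P by (simp add: projective_def)
  have "q \<noteq> 0" using q by (auto simp: inrad_def)
  then have a: "a < nv A" using vertex_lt[OF wP q(1)] by blast
  then obtain S g where S: "is_interval A S a 1 g" using interval_simple_exists by blast
  obtain Q g' where Q: "is_interval A Q a (plen A a) g'" using interval_exists[OF a] by blast
  have pl: "1 \<le> plen A a" using plen_pos[OF a] by simp
  obtain \<pi> where \<pi>: "hom A Q S \<pi>" "hap Q \<pi> a g' = g"
    using hom_from_interval[OF Q is_intervalD(1,2)[OF S] pmap_plen[OF is_intervalD(1,2)[OF S]]] by blast
  have gl: "g = lc A S a 1 g a (\<lambda>s. if s = 0 then 1 else 0)"
    using interval_generator_lc[OF S] by simp
  have "epi Q S \<pi>"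
    by (rule interval_epiI[OF S \<pi>(1) is_intervalD(2)[OF Q] _ _ a, of "\<lambda>s. if s = 0 then 1 else 0"])
      (use \<pi>(2) gl in simp_all)
  obtain h \<phi> where h: "hom A P S h" "\<phi> q = 1"
      "\<And>j w. w \<in> vec (dm P j) \<Longrightarrow> hap P h j w = (if j = a then scl (\<phi> w) g else 0)"
    using top_functional[OF wP q S] by blast
  obtain k where k: "hom A P Q k" "\<And>i v. hap Q \<pi> i (hap P k i v) = hap P h i v"
    using projectiveD[OF P \<pi>(1) \<open>epi Q S \<pi>\<close> h(1)] by blast
  obtain c where c: "hap P k a q = lc A Q a (plen A a) g' a c"
    using is_intervalD(5)[OF Q hom_vec[OF k(1)]] by blast
  have "hap Q \<pi> a (hap P k a q) = g" using k(2) h(2) h(3)[OF q(1)] by simp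
  then have "c 0 = 1"
    using interval_quotient_cof[OF Q S _ pl \<pi>, of c "\<lambda>s. if s = 0 then 1 else 0"] c gl by simp
  then have "pmap A Q a (plen A a - 1) (hap P k a q) = pmap A Q a (plen A a - 1) g'"
    using interval_lead[OF Q, of 0 a c] c pl a by simp
  moreover have "pmap A P a (plen A a - 1) q = 0"
    using pmap_plus[of A P a s "plen A a - 1 - s" q] z s by simp
  then have "pmap A Q a (plen A a - 1) (hap P k a q) = 0"
    using hom_pmap[OF k(1) q(1), of "plen A a - 1"] by simp
  ultimately show False using is_intervalD(4)[OF Q, of "plen A a - 1"] pl by simp
qed

text \<open>Only the supports of top and socle are kept, without multiplicities; this suffices for a
  comparison with an interval.\<close>

definition tops :: "'k rep \<Rightarrow> nat set" where
  "tops M = {i. \<exists>v\<in>vec (dm M i). \<not> inrad A M i v}"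

definition socs :: "'k rep \<Rightarrow> nat set" where
  "socs M = {i. \<exists>v\<in>vec (dm M i). v \<noteq> 0 \<and> act M i v = 0}"

text \<open>A socle vector of the syzygy is a socle vector of \<open>P\<close>, hence a path applied
  to some \<open>q\<close> outside the radical. As \<open>q\<close> generates a free copy, the path
  is the longest nonzero one from \<open>a\<close>, and \<open>q\<close> maps to a top vector of
  \<open>N\<close>.\<close>

lemma socs_omega:
  assumes X: "omega1 A N X" and w: "w \<in> socs X"
  shows "\<exists>a\<in>tops N. a < nv A \<and> tgt A a (plen A a - 1) = w"
proof -
  obtain P p k where P: "proj_cover A P N p" "hom A X P k" "monic X k"
    using X by (auto simp: omega1_def)
  have wP: "wfA A P" using hom_wf(2)[OF P(2)] .
  obtain \<xi> where \<xi>: "\<xi> \<in> vec (dm X w)" "\<xi> \<noteq> 0" "act X w \<xi> = 0" using w by (auto simp: socs_def)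
  define u where "u = hap X k w \<xi>"
  have u: "u \<in> vec (dm P w)" "u \<noteq> 0" "act P w u = 0"
    using P \<xi> monicD[OF P(3) \<xi>(1)] hom_act[OF P(2) \<xi>(1)] by (auto simp: u_def)
  obtain a s q where a: "a < nv A" "q \<in> vec (dm P a)" "\<not> inrad A P a q" "tgt A a s = w" "pmap A P a s q = u"
    using nonrad_preimage[OF wP u(1,2)] by blast
  have "s < plen A a" using pmap_plen[OF wP a(2), of s] a(5) u(2) by (meson not_le)
  moreover have "\<not> Suc s < plen A a"
    using projective_nonrad_pmap[OF proj_coverD(1)[OF P(1)] a(2,3), of "Suc s"] a(4,5) u(3) by auto
  ultimately have "s = plen A a - 1" by simp
  moreover have "a \<in> tops N"
    using proj_cover_nonrad[OF P(1) a(2,3)] proj_coverD(2)[OF P(1)] by (auto simp: tops_def)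
  ultimately show ?thesis using a by blast
qed

text \<open>A top vector of \<open>Z\<close> is an arrow applied to some \<open>u\<close> in the projective cover of \<open>Y\<close>,
  and the image of \<open>u\<close> is a socle vector of \<open>Y\<close>.\<close>

lemma tops_omega2:
  assumes Y: "omega1 A N Y" and Z: "omega1 A Y Z" and z: "z \<in> tops Z"
  shows "\<exists>a\<in>tops N. a < nv A \<and> tgt A a (plen A a) = z"
proof -
  obtain P p k where P: "proj_cover A P Y p" "hom A Z P k" "monic Z k" "exact Z P k p"
    using Z by (auto simp: omega1_def)
  note p = proj_coverD(2,3)[OF P(1)]
  obtain \<zeta> where \<zeta>: "\<zeta> \<in> vec (dm Z z)" "\<not> inrad A Z z \<zeta>" using z by (auto simp: tops_def)
  have kz: "hap P p z (hap Z k z \<zeta>) = 0" using P(4) hom_vec[OF P(2)] \<zeta>(1) unfolding exact_iff by blast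
  then have "inrad A P z (hap Z k z \<zeta>)"
    using proj_cover_kernel_inrad[OF P(1) hom_vec[OF P(2)]] by blast
  moreover have "hap Z k z \<zeta> \<noteq> 0"
    using monicD[OF P(3) \<zeta>(1)] \<zeta>(2) by (auto simp: inrad_def)
  ultimately obtain j u where j: "j < nv A" "tgt A j 1 = z" "u \<in> vec (dm P j)" "act P j u = hap Z k z \<zeta>"
    by (auto simp: inrad_def)
  have "hap P p j u \<noteq> 0"
  proof
    assume "hap P p j u = 0"
    then obtain u' where u': "u' \<in> vec (dm Z j)" "hap Z k j u' = u" using exactD1[OF P(4) j(3)] by blast
    have "hap Z k z (act Z j u') = hap Z k z \<zeta>" using hom_act[OF P(2) u'(1)] u' j by simp
    moreover have "act Z j u' \<in> vec (dm Z z)" using act_vec[OF hom_wf(1)[OF P(2)], of j u'] j by simp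
    ultimately have "act Z j u' = \<zeta>" using monic_inj[OF P(3) _ \<zeta>(1)] by blast
    then show False using \<zeta>(2) u' j unfolding inrad_def by blast
  qed
  moreover have "act Y j (hap P p j u) = 0" using hom_act[OF p(1) j(3)] j kz by simp
  ultimately have "j \<in> socs Y" using p(1) by (auto simp: socs_def)
  then obtain a where a: "a \<in> tops N" "a < nv A" "tgt A a (plen A a - 1) = j"
    using socs_omega[OF Y] by blast
  have "tgt A a (plen A a) = z"
    using tgt_tgt[of A a "plen A a - 1" 1] plen_pos[OF a(2)] unfolding a(3) j(2) by simp
  then show ?thesis using a by blast
qed

section \<open>Syzygies of intervals\<close>

text \<open>Pairs consist of top vertex and length. Length 0 is absorbing, so length 0 after
  \<open>m\<close> steps means that the minimal resolution has ended by then.\<close>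

definition om :: "nat \<times> nat \<Rightarrow> nat \<times> nat" where
  "om p = (if snd p = 0 then p else (tgt A (fst p) (snd p), plen A (fst p) - snd p))"

definition interval_of :: "'k rep \<Rightarrow> nat \<times> nat \<Rightarrow> bool" where
  "interval_of M p \<longleftrightarrow> (\<exists>v. is_interval A M (fst p) (snd p) v)"

lemma om_funpow_0: "snd p = 0 \<Longrightarrow> (om ^^ m) p = p"
  by (induction m) (auto simp: om_def)

text \<open>The zero map into a cover of the zero module already satisfies the minimality test, so
  the cover itself is zero.\<close>

lemma omega_zero:
  assumes Y: "zero_rep Y" and X: "omega1 A Y X"
  shows "zero_rep X"
proof -
  obtain P p k where P: "proj_cover A P Y p" "hom A X P k" "monic X k"
    using X by (auto simp: omega1_def)
  obtain g where g: "hom A Y P g"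
    using hom_zero hom_wf proj_coverD(2)[OF P(1)] by blast
  have "epi Y P g"
    by (rule proj_coverD(4)[OF P(1) g]) (metis Y amap_0 vec_0 zero_repD)
  then have "w = 0" if "w \<in> vec (dm P j)" for j and w :: "nat \<Rightarrow> 'k"
    using epiD[OF _ that] zero_repD[OF Y] by (metis amap_0)
  then show ?thesis
    using monicD[OF P(3)] hom_vec[OF P(2)] by (intro zero_repI) blast
qed

text \<open>The cover \<open>P\<close> is given abstractly. The map from the interval
  \<open>Q\<close> onto a lift of \<open>v\<close> is surjective by minimality of the cover and
  injective because the lift lies outside the radical, so \<open>P\<close> is an interval
  too.\<close>

lemma omega_interval:
  assumes Y: "is_interval A Y i l v" and l: "0 < l" and X: "omega1 A Y X"
  shows "\<exists>x. is_interval A X (tgt A i l) (plen A i - l) x"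
proof -
  obtain P p k where P: "proj_cover A P Y p" "hom A X P k" "monic X k" "exact X P k p"
    using X by (auto simp: omega1_def)
  note p = proj_coverD(2,3)[OF P(1)]
  have i: "i < nv A" using interval_top_lt[OF Y l] .
  have lp: "l \<le> plen A i" using interval_le_plen[OF Y] .
  have wP: "wfA A P" and wX: "wfA A X" using hom_wf[OF P(2)] by auto
  obtain q where q: "q \<in> vec (dm P i)" "hap P p i q = v" using epiD[OF p(2) is_intervalD(2)[OF Y]] by blast
  have qr: "\<not> inrad A P i q" using hom_inrad[OF p(1)] q interval_not_inrad[OF Y l] by blast
  obtain Q g where Q: "is_interval A Q i (plen A i) g" using interval_exists[OF i] by blast
  obtain \<gamma> where \<gamma>: "hom A Q P \<gamma>" "hap Q \<gamma> i g = q"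
    using hom_from_interval[OF Q wP q(1) pmap_plen[OF wP q(1)]] by blast
  have "epi Q P \<gamma>"
  proof (rule proj_coverD(4)[OF P(1) \<gamma>(1)])
    fix j and w :: "nat \<Rightarrow> 'k" assume "w \<in> vec (dm Y j)"
    then obtain c where c: "w = lc A Y i l v j c" using is_intervalD(5)[OF Y] by blast
    have "hap P p j (hap Q \<gamma> j (lc A Q i l g j c)) = w"
      using hom_lc[OF \<gamma>(1) is_intervalD(2)[OF Q]] hom_lc[OF p(1) q(1)] \<gamma>(2) q(2) c by simp
    then show "\<exists>x\<in>vec (dm Q j). hap P p j (hap Q \<gamma> j x) = w"
      using is_intervalD(1,2)[OF Q] by blast
  qed
  moreover have "monic Q \<gamma>"
    by (rule interval_monicI[OF Q \<gamma>(1)])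
      (use \<gamma>(2) projective_nonrad_pmap[OF proj_coverD(1)[OF P(1)] q(1) qr, of "plen A i - 1"] in simp)
  ultimately have IP: "is_interval A P i (plen A i) q"
    using interval_transport[OF \<gamma>(1) _ _ Q] \<gamma>(2) by simp
  define b where "b = tgt A i l"
  define m where "m = plen A i - l"
  \<comment> \<open>The kernel is generated by the path of length \<open>l\<close> applied to
    \<open>q\<close>: vectors of the kernel have zero coefficients below degree
    \<open>l\<close>.\<close>
  have lm: "l + m = plen A i" using lp by (simp add: m_def)
  define y where "y = pmap A P i l q"
  have y: "y \<in> vec (dm P b)" using pmap_vec[OF wP q(1)] by (simp add: y_def b_def)
  have "hap P p b y = 0"
    using hom_pmap[OF p(1) q(1), of l] q(2) is_intervalD(3)[OF Y] by (simp add: y_def b_def)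
  then obtain x where x: "x \<in> vec (dm X b)" "hap X k b x = y" using exactD1[OF P(4) y] by blast
  have kp: "hap X k (tgt A b s) (pmap A X b s x) = pmap A P i (l + s) q" for s
    using hom_pmap[OF P(2) x(1), of s] x(2) pmap_plus[of A P i l s q] by (simp add: y_def b_def)
  have "is_interval A X b m x"
    unfolding is_interval_def
  proof (intro conjI allI impI ballI wX x(1))
    show "pmap A X b m x = 0"
      using monicD[OF P(3) pmap_vec[OF wX x(1)], of m] kp[of m] is_intervalD(3)[OF IP] lm by simp
    show "pmap A X b s x \<noteq> 0" if "s < m" for s
      using kp[of s] is_intervalD(4)[OF IP, of "l + s"] that lm by auto
    fix j and w :: "nat \<Rightarrow> 'k" assume w: "w \<in> vec (dm X j)"
    obtain c where c: "hap X k j w = lc A P i (plen A i) q j c"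
      using is_intervalD(5)[OF IP hom_vec[OF P(2)]] by blast
    have "hap P p j (hap X k j w) = 0" using P(4) hom_vec[OF P(2)] w unfolding exact_iff by blast
    then have "lc A Y i l v j c = 0"
      using c hom_lc[OF p(1) q(1)] q(2) lc_truncate[OF Y lp] by simp
    then have c0: "c s = 0" if "s < l" "tgt A i s = j" for s
      using interval_lc_eq_0[OF Y] that by blast
    have "hap X k j w = lc A P b m y j (\<lambda>s. c (l + s))"
      unfolding c y_def b_def lm[symmetric] by (rule lc_shift) (rule c0)
    also have "\<dots> = hap X k j (lc A X b m x j (\<lambda>s. c (l + s)))"
      using hom_lc[OF P(2) x(1)] x(2) by simp
    finally have "w = lc A X b m x j (\<lambda>s. c (l + s))"
      using monic_inj[OF P(3) w] wX x(1) by blast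
    then show "\<exists>c. w = lc A X b m x j c" by blast
  qed
  then show ?thesis unfolding b_def m_def by blast
qed

lemma omega_interval_of:
  assumes "interval_of Y p" "omega1 A Y X"
  shows "interval_of X (om p)"
proof (cases "snd p = 0")
  case True
  then have "zero_rep Y" using assms(1) interval_0_zero by (auto simp: interval_of_def)
  then have "zero_rep X" using omega_zero assms(2) by blast
  moreover have "wfA A X" using assms(2) hom_wf by (auto simp: omega1_def)
  ultimately show ?thesis using zero_interval True by (auto simp: interval_of_def om_def)
next
  case False
  then show ?thesis
    using assms omega_interval[of Y "fst p" "snd p" _ X] by (auto simp: interval_of_def om_def)
qed

lemma interval_proj_cover:
  assumes Y: "is_interval A Y i l v" and l: "0 < l"
  shows "\<exists>Q g \<pi>. is_interval A Q i (plen A i) g \<and> proj_cover A Q Y \<pi> \<and> hap Q \<pi> i g = v"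
proof -
  have i: "i < nv A" using interval_top_lt[OF Y l] .
  have lp: "l \<le> plen A i" using interval_le_plen[OF Y] .
  obtain Q g where Q: "is_interval A Q i (plen A i) g" using interval_exists[OF i] by blast
  obtain \<pi> where \<pi>: "hom A Q Y \<pi>" "hap Q \<pi> i g = v"
    using hom_from_interval[OF Q is_intervalD(1,2)[OF Y] pmap_plen[OF is_intervalD(1,2)[OF Y]]] by blast
  let ?\<delta> = "\<lambda>s. if s = 0 then 1 else 0 :: 'k"
  have vl: "v = lc A Y i l v i ?\<delta>" using interval_generator_lc[OF Y l] .
  have "epi Q Y \<pi>"
    by (rule interval_epiI[OF Y \<pi>(1) is_intervalD(2)[OF Q] _ _ i, of ?\<delta>])
      (use \<pi>(2) vl in simp_all)
  moreover have "epi Z Q f" if f: "hom A Z Q f" and e: "epi Z Y (hcomp Q \<pi> f)" for Z f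
  proof -
    obtain z where z: "z \<in> vec (dm Z i)" "hap Q \<pi> i (hap Z f i z) = v"
      using epiD[OF e is_intervalD(2)[OF Y]] by (auto simp: hcomp_app)
    obtain c where c: "hap Z f i z = lc A Q i (plen A i) g i c"
      using is_intervalD(5)[OF Q hom_vec[OF f]] by blast
    have "c 0 = 1" using interval_quotient_cof[OF Q Y l lp \<pi>, of c ?\<delta>] c z(2) vl by simp
    then show ?thesis using interval_epiI[OF Q f z(1) c _ i] by simp
  qed
  ultimately have "proj_cover A Q Y \<pi>"
    unfolding proj_cover_def using projective_interval[OF Q] \<pi>(1) by blast
  then show ?thesis using Q \<pi>(2) by blast
qed

lemma omega_exists:
  assumes "interval_of Y p"
  shows "\<exists>X. omega1 A Y X"
proof (cases "snd p = 0")
  case True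
  then have Y: "zero_rep Y" "wfA A Y"
    using assms interval_0_zero is_intervalD(1) by (auto simp: interval_of_def)
  obtain j where j: "hom A Y Y j" using hom_zero[OF Y(2,2)] by blast
  have z: "w = 0" if "w \<in> vec (dm Y i)" for i and w :: "nat \<Rightarrow> 'k" using zero_repD[OF Y(1) that] .
  have ep: "epi Z Y f" for Z f unfolding epi_def by (metis amap_0 vec_0 z)
  have "proj_cover A Y Y j" unfolding proj_cover_def using projective_zero[OF Y(2,1)] j ep by blast
  moreover have "monic Y j" unfolding monic_iff using z by blast
  moreover have "exact Y Y j j" unfolding exact_iff by (metis amap_0 vec_0 z)
  ultimately show ?thesis unfolding omega1_def using j by blast
next
  case False
  then obtain Q \<pi> where Q: "proj_cover A Q Y \<pi>"
    using interval_proj_cover assms unfolding interval_of_def by blast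
  obtain K k where "hom A K Q k" "monic K k" "exact K Q k \<pi>"
    using kernel_exists[OF proj_coverD(2)[OF Q]] by blast
  then show ?thesis unfolding omega1_def using Q by blast
qed

lemma syz_interval_of:
  assumes "interval_of M p" "syz A t M X"
  shows "interval_of X ((om ^^ t) p)"
  using assms(2)
proof (induction t arbitrary: X)
  case 0
  then show ?case using assms(1) interval_iso_transport[of A M X] by (auto simp: interval_of_def)
next
  case (Suc t)
  then obtain Y where "syz A t M Y" "omega1 A Y X" by auto
  then show ?case using omega_interval_of[OF Suc.IH] by simp
qed

lemma syz_exists: "interval_of M p \<Longrightarrow> \<exists>X. syz A t M X"
proof (induction t)
  case 0
  then have "iso A M M" using iso_refl is_intervalD(1) unfolding interval_of_def by blast
  then show ?case by auto
next
  case (Suc t)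
  then obtain Y where Y: "syz A t M Y" by blast
  then obtain X where "omega1 A Y X" using omega_exists syz_interval_of Suc.prems by blast
  with Y show ?case by auto
qed

end

section \<open>Projective dimension\<close>

text \<open>Here \<open>m\<close> counts the projective terms, one more than the length used in
  \<open>pdim\<close>; this is the origin of the \<open>Suc\<close> in \<open>pdim_eq\<close>. The
  kernels make induction possible.\<close>

primrec resolved :: "'k::field nak \<Rightarrow> nat \<Rightarrow> 'k rep \<Rightarrow> bool" where
  "resolved A 0 Y = zero_rep Y"
| "resolved A (Suc m) Y = (\<exists>P p K k. projective A P \<and> hom A P Y p \<and> epi P Y p \<and>
      hom A K P k \<and> monic K k \<and> exact K P k p \<and> resolved A m K)"

definition is_resolution :: "'k::field nak \<Rightarrow> nat \<Rightarrow> 'k rep \<Rightarrow> (nat \<Rightarrow> 'k rep) \<Rightarrow> (nat \<Rightarrow> 'k hm) \<Rightarrow> bool" where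
  "is_resolution A m M C f \<longleftrightarrow> C 0 = M \<and>
      (\<forall>k\<le>m. hom A (C (Suc k)) (C k) (f k)) \<and>
      (\<forall>k. 1 \<le> k \<and> k \<le> m + 1 \<longrightarrow> projective A (C k)) \<and>
      epi (C 1) (C 0) (f 0) \<and>
      (\<forall>k. 1 \<le> k \<and> k \<le> m \<longrightarrow> exact (C (Suc k)) (C k) (f k) (f (k - 1))) \<and>
      monic (C (Suc m)) (f m)"

text \<open>The map \<open>f 1\<close> is corestricted to the kernel of \<open>f 0\<close>, and the
  tail of the resolution then resolves that kernel.\<close>

lemma is_resolution_resolved: "is_resolution A m Y C f \<Longrightarrow> resolved A (Suc m) Y"
proof (induction m arbitrary: Y C f)
  case (0 Y C f)
  then have R: "hom A (C 1) Y (f 0)" "projective A (C 1)" "epi (C 1) Y (f 0)" "monic (C 1) (f 0)"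
    by (auto simp: is_resolution_def)
  obtain K k where K: "hom A K (C 1) k" "monic K k" "exact K (C 1) k (f 0)"
    using kernel_exists[OF R(1)] by blast
  have "zero_rep K"
  proof (rule zero_repI)
    fix i and v :: "nat \<Rightarrow> 'a" assume v: "v \<in> vec (dm K i)"
    have kv: "hap K k i v \<in> vec (dm (C 1) i)" using K(1) by blast
    then have "hap (C 1) (f 0) i (hap K k i v) = 0" using K(3) v unfolding exact_iff by blast
    then have "hap K k i v = 0" using monicD[OF R(4) kv] by blast
    then show "v = 0" using monicD[OF K(2) v] by blast
  qed
  then show ?case using R K by auto
next
  case (Suc m Y C f)
  note R = Suc.prems
  have f0: "hom A (C 1) Y (f 0)" "projective A (C 1)" "epi (C 1) Y (f 0)"
    and f1: "hom A (C 2) (C 1) (f 1)" and ex1: "exact (C 2) (C 1) (f 1) (f 0)"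
    using R by (auto simp: is_resolution_def numeral_2_eq_2)
  obtain K k where K: "hom A K (C 1) k" "monic K k" "exact K (C 1) k (f 0)"
    using kernel_exists[OF f0(1)] by blast
  have "\<exists>u\<in>vec (dm K i). hap K k i u = hap (C 2) (f 1) i v" if "v \<in> vec (dm (C 2) i)" for i v
    using exactD1[OF K(3) hom_vec[OF f1]] ex1 that hom_vec[OF f1] unfolding exact_iff by metis
  then obtain h where h: "hom A (C 2) K h"
      "\<And>i v. v \<in> vec (dm (C 2) i) \<Longrightarrow> hap K k i (hap (C 2) h i v) = hap (C 2) (f 1) i v"
    using hom_factor_monic[OF f1 K(1,2)] by blast
  have h0: "hap (C 2) h i v = 0 \<longleftrightarrow> hap (C 2) (f 1) i v = 0" if "v \<in> vec (dm (C 2) i)" for i v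
    using h(2)[OF that] monicD[OF K(2) hom_vec[OF h(1)]] by (metis amap_0)
  define C' where "C' = (\<lambda>n. case n of 0 \<Rightarrow> K | Suc j \<Rightarrow> C (Suc (Suc j)))"
  define f' where "f' = (\<lambda>n. case n of 0 \<Rightarrow> h | Suc j \<Rightarrow> f (Suc (Suc j)))"
  have "is_resolution A m K C' f'"
    unfolding is_resolution_def
  proof (intro conjI allI impI)
    show "C' 0 = K" by (simp add: C'_def)
    show "hom A (C' (Suc n)) (C' n) (f' n)" if "n \<le> m" for n
      using h(1) that R by (cases n) (auto simp: C'_def f'_def is_resolution_def numeral_2_eq_2)
    show "projective A (C' n)" if "1 \<le> n \<and> n \<le> m + 1" for n
      using that R by (cases n) (auto simp: C'_def is_resolution_def)
    show "epi (C' 1) (C' 0) (f' 0)"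
      unfolding epi_def
    proof (intro allI impI)
      fix i and u :: "nat \<Rightarrow> 'a" assume u: "u \<in> vec (dm (C' 0) i)"
      then have u': "u \<in> vec (dm K i)" by (simp add: C'_def)
      have ku: "hap K k i u \<in> vec (dm (C 1) i)" using K(1) by blast
      then have "hap (C 1) (f 0) i (hap K k i u) = 0" using K(3) u' unfolding exact_iff by blast
      then obtain x where x: "x \<in> vec (dm (C 2) i)" "hap (C 2) (f 1) i x = hap K k i u"
        using exactD1[OF ex1 ku] by blast
      then have "hap (C 2) h i x = u"
        using h(2)[OF x(1)] monic_inj[OF K(2) hom_vec[OF h(1)] u'] by simp
      then show "\<exists>v\<in>vec (dm (C' 1) i). hap (C' 1) (f' 0) i v = u"
        using x(1) by (auto simp: C'_def f'_def numeral_2_eq_2)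
    qed
    show "exact (C' (Suc n)) (C' n) (f' n) (f' (n - 1))" if n: "1 \<le> n \<and> n \<le> m" for n
    proof (cases "n = 1")
      case True
      have "exact (C 3) (C 2) (f 2) (f 1)" using R n True
        by (auto simp: is_resolution_def numeral_2_eq_2 numeral_3_eq_3)
      then have "exact (C 3) (C 2) (f 2) h" unfolding exact_iff using h0 by metis
      then show ?thesis using True by (simp add: C'_def f'_def numeral_2_eq_2 numeral_3_eq_3)
    next
      case False
      then obtain j where j: "n = Suc (Suc j)" using n
        by (metis One_nat_def Suc_le_D le_0_eq not0_implies_Suc not_less_eq_eq)
      have "exact (C (Suc (Suc n))) (C (Suc n)) (f (Suc n)) (f (Suc n - 1))"
        using R n by (auto simp: is_resolution_def)
      then show ?thesis using j by (simp add: C'_def f'_def)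
    qed
    show "monic (C' (Suc m)) (f' m)"
    proof (cases m)
      case 0
      have "monic (C 2) (f 1)" using R 0 by (auto simp: is_resolution_def numeral_2_eq_2)
      then have "monic (C 2) h" unfolding monic_iff using h0 by blast
      then show ?thesis using 0 by (simp add: C'_def f'_def numeral_2_eq_2)
    next
      case (Suc m')
      then show ?thesis using R by (auto simp: C'_def f'_def is_resolution_def)
    qed
  qed
  from Suc.IH[OF this] have "resolved A (Suc m) K" .
  then show ?case
    using f0 K by (subst resolved.simps(2)) blast
qed

text \<open>Resolutions are spliced by composing with the inclusion \<open>k\<close>, which changes
  no kernels because it is injective (\<open>k0\<close>).\<close>

lemma resolved_is_resolution: "resolved A (Suc m) Y \<Longrightarrow> \<exists>C f. is_resolution A m Y C f"
proof (induction m arbitrary: Y)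
  case (0 Y)
  then obtain P p K k where P: "projective A P" "hom A P Y p" "epi P Y p"
    "hom A K P k" "exact K P k p" "zero_rep K" by auto
  have "monic P p"
    unfolding monic_iff
  proof (intro allI ballI impI)
    fix i v assume "v \<in> vec (dm P i)" "hap P p i v = 0"
    then obtain u where "u \<in> vec (dm K i)" "hap K k i u = v" using exactD1[OF P(5)] by blast
    then show "v = 0" using zero_repD[OF P(6)] by (metis amap_0)
  qed
  then have "is_resolution A 0 Y (\<lambda>n. case n of 0 \<Rightarrow> Y | Suc j \<Rightarrow> P) (\<lambda>_. p)"
    unfolding is_resolution_def using P by (auto split: nat.splits)
  then show ?case by blast
next
  case (Suc m Y)
  obtain P p K k where P: "projective A P" "hom A P Y p" "epi P Y p"
    "hom A K P k" "monic K k" "exact K P k p" "resolved A (Suc m) K"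
    using Suc.prems by (subst (asm) resolved.simps(2)) blast
  obtain C' f' where R: "is_resolution A m K C' f'" using Suc.IH[OF P(7)] by blast
  have R0: "C' 0 = K" "hom A (C' 1) K (f' 0)" "epi (C' 1) K (f' 0)"
    using R by (auto simp: is_resolution_def)
  define C where "C = (\<lambda>n. case n of 0 \<Rightarrow> Y | Suc j \<Rightarrow> (case j of 0 \<Rightarrow> P | Suc j' \<Rightarrow> C' (Suc j')))"
  define f where "f = (\<lambda>n. case n of 0 \<Rightarrow> p | Suc j \<Rightarrow>
      (case j of 0 \<Rightarrow> hcomp K k (f' 0) | Suc j' \<Rightarrow> f' (Suc j')))"
  have k0: "hap (C' 1) (hcomp K k (f' 0)) i v = 0 \<longleftrightarrow> hap (C' 1) (f' 0) i v = 0" for i v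
    unfolding hcomp_app using monicD[OF P(5) hom_vec[OF R0(2)]] by (metis amap_0)
  have "is_resolution A (Suc m) Y C f"
    unfolding is_resolution_def
  proof (intro conjI allI impI)
    show "C 0 = Y" by (simp add: C_def)
    show "hom A (C (Suc n)) (C n) (f n)" if "n \<le> Suc m" for n
      using that P(2) hom_hcomp[OF R0(2) P(4)] R
      by (auto simp: C_def f_def is_resolution_def split: nat.splits)
    show "projective A (C n)" if "1 \<le> n \<and> n \<le> Suc m + 1" for n
      using that P(1) R by (auto simp: C_def is_resolution_def split: nat.splits)
    show "epi (C 1) (C 0) (f 0)" using P(3) by (simp add: C_def f_def)
    show "exact (C (Suc n)) (C n) (f n) (f (n - 1))" if n: "1 \<le> n \<and> n \<le> Suc m" for n
    proof -
      consider "n = 1" | "n = 2" | j where "n = Suc (Suc (Suc j))"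
        using n by (metis One_nat_def Suc_1 le_0_eq not0_implies_Suc not_one_le_zero)
      then show ?thesis
      proof cases
        case 1
        have "exact (C' 1) P (hcomp K k (f' 0)) p"
          unfolding exact_iff
        proof (intro allI ballI)
          fix i and v :: "nat \<Rightarrow> 'a" assume v: "v \<in> vec (dm P i)"
          have "hap P p i v = 0 \<longleftrightarrow> (\<exists>u\<in>vec (dm K i). hap K k i u = v)"
            using P(6) v unfolding exact_iff by blast
          also have "\<dots> \<longleftrightarrow> (\<exists>u\<in>vec (dm (C' 1) i). hap K k i (hap (C' 1) (f' 0) i u) = v)"
            using epiD[OF R0(3)] hom_vec[OF R0(2)] by metis
          finally show "hap P p i v = 0 \<longleftrightarrow> (\<exists>u\<in>vec (dm (C' 1) i). hap (C' 1) (hcomp K k (f' 0)) i u = v)"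
            unfolding hcomp_app .
        qed
        then show ?thesis using 1 by (simp add: C_def f_def)
      next
        case 2
        have "exact (C' 2) (C' 1) (f' 1) (f' 0)" using R n 2
          by (auto simp: is_resolution_def numeral_2_eq_2)
        then have "exact (C' 2) (C' 1) (f' 1) (hcomp K k (f' 0))"
          unfolding exact_iff k0 by blast
        then show ?thesis using 2 by (simp add: C_def f_def numeral_2_eq_2)
      next
        case (3 j)
        have "exact (C' (Suc (n - 1))) (C' (n - 1)) (f' (n - 1)) (f' (n - 1 - 1))"
          using R n 3 unfolding is_resolution_def by auto
        then show ?thesis using 3 by (simp add: C_def f_def)
      qed
    qed
    show "monic (C (Suc (Suc m))) (f (Suc m))"
    proof (cases m)
      case 0
      then have "monic (C' 1) (f' 0)" using R by (auto simp: is_resolution_def)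
      then have "monic (C' 1) (hcomp K k (f' 0))" unfolding monic_iff k0 .
      then show ?thesis using 0 by (simp add: C_def f_def)
    next
      case (Suc m')
      then show ?thesis using R by (auto simp: C_def f_def is_resolution_def)
    qed
  qed
  then show ?case by blast
qed

lemma pdim_eq: "pdim A Y = Inf {enat m | m. resolved A (Suc m) Y}"
proof -
  have "(\<exists>C f. is_resolution A m Y C f) \<longleftrightarrow> resolved A (Suc m) Y" for m
    using is_resolution_resolved resolved_is_resolution by blast
  then show ?thesis unfolding pdim_def is_resolution_def by simp
qed

context nakayama_algebra
begin

lemma interval_resolved: "interval_of M p \<Longrightarrow> snd ((om ^^ m) p) = 0 \<Longrightarrow> resolved A m M"
proof (induction m arbitrary: M p)
  case 0
  then show ?case using interval_0_zero by (auto simp: interval_of_def)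
next
  case (Suc m)
  obtain X where X: "omega1 A M X" using omega_exists Suc.prems(1) by blast
  have "resolved A m X"
    using Suc.IH[OF omega_interval_of[OF Suc.prems(1) X]] Suc.prems(2) by (simp add: funpow_swap1)
  then show ?case using X proj_coverD(1,2,3) unfolding omega1_def by (subst resolved.simps(2)) blast
qed

text \<open>Comparison with an arbitrary resolution of \<open>Y\<close>: a map of minimal resolutions lifting a
  monomorphism of \<open>M\<close> is again a monomorphism in each degree.\<close>

lemma resolved_retract:
  assumes "resolved A m Y" "is_interval A M i l v" "hom A M Y a" "hom A Y M b" "monic M (hcomp Y b a)"
  shows "snd ((om ^^ m) (i, l)) = 0"
  using assms
proof (induction m arbitrary: Y M i l v a b)
  case 0
  have "w = 0" if w: "w \<in> vec (dm M j)" for j and w :: "nat \<Rightarrow> 'k"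
  proof -
    have "zero_rep Y" using 0(1) by simp
    then have "hap M a j w = 0" by (rule zero_repD[OF _ hom_vec[OF 0(3)]])
    then show ?thesis using monicD[OF 0(5) w] by (simp add: hcomp_app)
  qed
  then have "v = 0" using is_intervalD(2)[OF 0(2)] by blast
  then have "l = 0" using is_intervalD(4)[OF 0(2), of 0] by auto
  then show ?case by simp
next
  case (Suc m)
  note M = Suc.prems(2) and ab = Suc.prems(3,4) and mono = Suc.prems(5)
  show ?case
  proof (cases "l = 0")
    case True
    then show ?thesis using om_funpow_0[of "(i, l)" "Suc m"] by simp
  next
    case False
    then have l: "0 < l" by simp
    obtain P p K k where P: "projective A P" "hom A P Y p" "epi P Y p"
      "hom A K P k" "monic K k" "exact K P k p" "resolved A m K"
      using Suc.prems(1) by (subst (asm) resolved.simps(2)) blast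
    obtain Q g \<pi> where Q: "is_interval A Q i (plen A i) g" "proj_cover A Q M \<pi>" "hap Q \<pi> i g = v"
      using interval_proj_cover[OF M l] by blast
    note \<pi> = proj_coverD(1,2,3)[OF Q(2)]
    obtain X x where X: "hom A X Q x" "monic X x" "exact X Q x \<pi>" using kernel_exists[OF \<pi>(2)] by blast
    have "omega1 A M X" using Q(2) X unfolding omega1_def by blast
    then obtain y where y: "is_interval A X (tgt A i l) (plen A i - l) y" using omega_interval[OF M l] by blast
    have wl: "l \<le> plen A i" using interval_le_plen[OF M] .
    have i: "i < nv A" using interval_top_lt[OF M l] .
    obtain \<alpha> where \<alpha>: "hom A Q P \<alpha>" "\<And>j w. hap P p j (hap Q \<alpha> j w) = hap M a j (hap Q \<pi> j w)"
      using projectiveD[OF \<pi>(1) P(2,3) hom_hcomp[OF \<pi>(2) ab(1)]] by (auto simp: hcomp_app)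
    obtain \<beta> where \<beta>: "hom A P Q \<beta>" "\<And>j w. hap Q \<pi> j (hap P \<beta> j w) = hap Y b j (hap P p j w)"
      using projectiveD[OF P(1) \<pi>(2,3) hom_hcomp[OF P(2) ab(2)]] by (auto simp: hcomp_app)
    have "\<exists>u\<in>vec (dm K j). hap K k j u = hap X (hcomp Q \<alpha> x) j w" if w: "w \<in> vec (dm X j)" for j w
    proof (rule exactD1[OF P(6)])
      show "hap X (hcomp Q \<alpha> x) j w \<in> vec (dm P j)" using \<alpha>(1) by (simp add: hcomp_app)
      have "hap Q \<pi> j (hap X x j w) = 0" using X(3) w hom_vec[OF X(1)] unfolding exact_iff by blast
      then show "hap P p j (hap X (hcomp Q \<alpha> x) j w) = 0" by (simp add: hcomp_app \<alpha>(2))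
    qed
    then obtain a' where a': "hom A X K a'"
        "\<And>j w. w \<in> vec (dm X j) \<Longrightarrow> hap K k j (hap X a' j w) = hap Q \<alpha> j (hap X x j w)"
      using hom_factor_monic[OF hom_hcomp[OF X(1) \<alpha>(1)] P(4,5)] unfolding hcomp_app by blast
    have "\<exists>u\<in>vec (dm X j). hap X x j u = hap K (hcomp P \<beta> k) j w" if w: "w \<in> vec (dm K j)" for j w
    proof (rule exactD1[OF X(3)])
      show "hap K (hcomp P \<beta> k) j w \<in> vec (dm Q j)" using \<beta>(1) by (simp add: hcomp_app)
      have "hap P p j (hap K k j w) = 0" using P(6) w hom_vec[OF P(4)] unfolding exact_iff by blast
      then show "hap Q \<pi> j (hap K (hcomp P \<beta> k) j w) = 0" by (simp add: hcomp_app \<beta>(2))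
    qed
    then obtain b' where b': "hom A K X b'"
        "\<And>j w. w \<in> vec (dm K j) \<Longrightarrow> hap X x j (hap K b' j w) = hap P \<beta> j (hap K k j w)"
      using hom_factor_monic[OF hom_hcomp[OF P(4) \<beta>(1)] X(1,2)] unfolding hcomp_app by blast
    \<comment> \<open>The generator coefficient of the lifted composite equals that of
      \<open>b\<close> after \<open>a\<close>. The latter is nonzero because that composite is
      injective on the socle of \<open>M\<close>, so the lift is injective on the socle of
      \<open>Q\<close>.\<close>
    have "monic Q (hcomp P \<beta> \<alpha>)"
    proof (rule interval_monicI[OF Q(1) hom_hcomp[OF \<alpha>(1) \<beta>(1)]])
      assume pl: "0 < plen A i"
      obtain c where c: "hap Q (hcomp P \<beta> \<alpha>) i g = lc A Q i (plen A i) g i c"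
        using is_intervalD(5)[OF Q(1) hom_vec[OF hom_hcomp[OF \<alpha>(1) \<beta>(1)]]] by blast
      obtain d where d: "hap M (hcomp Y b a) i v = lc A M i l v i d"
        using is_intervalD(5)[OF M hom_vec[OF hom_hcomp[OF ab]]] by blast
      have "hap Q \<pi> i (lc A Q i (plen A i) g i c) = lc A M i l v i d"
        unfolding c[symmetric] d[symmetric] by (simp add: hcomp_app \<alpha>(2) \<beta>(2) Q(3))
      then have cd: "c 0 = d 0" by (rule interval_quotient_cof[OF Q(1) M l wl \<pi>(2) Q(3)])
      have vl: "pmap A M i (l - 1) v \<in> vec (dm M (tgt A i (l - 1)))"
        using is_intervalD(1,2)[OF M] by blast
      have "scl (d 0) (pmap A M i (l - 1) v) = pmap A M i (l - 1) (hap M (hcomp Y b a) i v)"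
        unfolding d using interval_lead[OF M l, of i d] i by simp
      also have "\<dots> = hap M (hcomp Y b a) (tgt A i (l - 1)) (pmap A M i (l - 1) v)"
        by (rule hom_pmap[OF hom_hcomp[OF ab] is_intervalD(2)[OF M], symmetric])
      finally have e: "scl (d 0) (pmap A M i (l - 1) v)
          = hap M (hcomp Y b a) (tgt A i (l - 1)) (pmap A M i (l - 1) v)" .
      have "d 0 \<noteq> 0"
      proof
        assume "d 0 = 0"
        then have "hap M (hcomp Y b a) (tgt A i (l - 1)) (pmap A M i (l - 1) v) = 0"
          using e by (metis fv.scale_zero_left)
        then show False using monicD[OF mono vl] is_intervalD(4)[OF M, of "l - 1"] l by simp
      qed
      moreover have "pmap A Q i (plen A i - 1) (hap Q (hcomp P \<beta> \<alpha>) i g)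
          = scl (c 0) (pmap A Q i (plen A i - 1) g)"
        unfolding c using interval_lead[OF Q(1) pl, of i c] i by simp
      ultimately show "pmap A Q i (plen A i - 1) (hap Q (hcomp P \<beta> \<alpha>) i g) \<noteq> 0"
        using cd is_intervalD(4)[OF Q(1), of "plen A i - 1"] pl by simp
    qed
    then have "monic X (hcomp K b' a')"
      unfolding monic_iff hcomp_app
      using a' b' X monicD[OF X(2)] by (metis amap_0 hom_vec)
    from Suc.IH[OF P(7) y a'(1) b'(1) this] have "snd ((om ^^ m) (tgt A i l, plen A i - l)) = 0" .
    moreover have "om (i, l) = (tgt A i l, plen A i - l)" using l by (simp add: om_def)
    ultimately show ?thesis by (simp add: funpow_swap1)
  qed
qed

lemma resolved_interval_iff:
  assumes "interval_of M p"
  shows "resolved A m M \<longleftrightarrow> snd ((om ^^ m) p) = 0"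
proof
  assume R: "resolved A m M"
  obtain v where v: "is_interval A M (fst p) (snd p) v" using assms by (auto simp: interval_of_def)
  obtain j where j: "hom A M M j" "\<And>i v. v \<in> vec (dm M i) \<Longrightarrow> hap M j i v = v"
    using hom_id[OF is_intervalD(1)[OF v]] by blast
  have "monic M (hcomp M j j)" unfolding monic_iff hcomp_app using j(2) by simp
  from resolved_retract[OF R v j(1) j(1) this] show "snd ((om ^^ m) p) = 0" by simp
qed (rule interval_resolved[OF assms])

lemma pdim_interval:
  assumes "interval_of M p"
  shows "pdim A M = Inf {enat m | m. snd ((om ^^ Suc m) p) = 0}"
  unfolding pdim_eq resolved_interval_iff[OF assms] ..

end

section \<open>Simple modules and their injective envelopes\<close>

context nakayama_algebra
begin

text \<open>A socle vector of \<open>S\<close> gives an injection of a length one interval, which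
  simplicity makes surjective.\<close>

lemma simple_is_interval:
  assumes S: "simple_mod A S"
  shows "\<exists>i v. is_interval A S i 1 v"
proof -
  have wS: "wfA A S" and nz: "\<not> zero_rep S" using S by (auto simp: simple_mod_def)
  obtain i and u :: "nat \<Rightarrow> 'k" where "u \<in> vec (dm S i)" "u \<noteq> 0" using nz zero_repI by blast
  then obtain j w where w: "w \<in> vec (dm S j)" "w \<noteq> 0" "act S j w = 0"
    using socle_exists[OF wS] by blast
  have j: "j < nv A" using vertex_lt[OF wS w(1,2)] .
  obtain I g where I: "is_interval A I j 1 g" using interval_simple_exists[OF j] by blast
  obtain h where h: "hom A I S h" "hap I h j g = w"
    using hom_from_interval[OF I wS w(1)] w(3) j by auto
  have m: "monic I h" by (rule interval_monicI[OF I h(1)]) (simp add: h(2) w(2))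
  have "\<not> zero_rep I"
    using is_intervalD(2)[OF I] is_intervalD(4)[OF I, of 0] zero_repD by fastforce
  then have "epi I S h" using S h(1) m by (auto simp: simple_mod_def)
  then show ?thesis using interval_transport[OF h(1) m _ I] by blast
qed

text \<open>The coefficient in degree \<open>s\<close> is forced, since the path of length
  \<open>l - 1 - s\<close> carries it to the socle. The assumption on \<open>\<phi>\<close> settles
  degree 0, where an arrow ends at the top vertex and nothing of degree 0 may be produced.\<close>

lemma hom_into_interval:
  assumes E: "is_interval A E g l v" and l: "0 < l" and N: "wfA A N" and \<phi>: "lfun \<phi>"
    and kill: "\<And>j w. w \<in> vec (dm N j) \<Longrightarrow> tgt A j l = tgt A g (l - 1) \<Longrightarrow> \<phi> (pmap A N j l w) = 0"
  shows "\<exists>h. hom A N E h \<and> (\<forall>j. \<forall>w\<in>vec (dm N j).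
    hap N h j w = lc A E g l v j (\<lambda>s. \<phi> (pmap A N j (l - 1 - s) w)))"
proof (rule hom_of_linear_maps)
  fix j and w :: "nat \<Rightarrow> 'k" assume w: "w \<in> vec (dm N j)"
  have g: "g < nv A" using interval_top_lt[OF E l] .
  show "lc A E g l v (tgt A j 1) (\<lambda>s. \<phi> (pmap A N (tgt A j 1) (l - 1 - s) (act N j w)))
      = act E j (lc A E g l v j (\<lambda>s. \<phi> (pmap A N j (l - 1 - s) w)))"
    unfolding act_lc[OF is_intervalD(3)[OF E]]
  proof (rule lc_cong)
    fix s assume s: "s < l" "tgt A g s = tgt A j 1"
    show "\<phi> (pmap A N (tgt A j 1) (l - 1 - s) (act N j w)) =
      (if 0 < s \<and> tgt A g (s - 1) = j then \<phi> (pmap A N j (l - 1 - (s - 1)) w) else 0)"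
    proof (cases "w = 0")
      case True
      then show ?thesis by (simp add: lfun_0[OF \<phi>])
    next
      case False
      then have j: "j < nv A" using vertex_lt[OF N w] by blast
      have e: "pmap A N (tgt A j 1) (l - 1 - s) (act N j w) = pmap A N j (Suc (l - 1 - s)) w"
        by (rule pmap_Suc_shift[OF j, symmetric])
      show ?thesis
      proof (cases "s = 0")
        case True
        then have "g = tgt A j 1" using s g by simp
        then have "tgt A j l = tgt A g (l - 1)" using l by simp
        then show ?thesis using kill[OF w] e True l by simp
      next
        case False
        have "tgt A g (s - 1) < nv A"
          using s interval_le_plen[OF E] by (intro tgt_lt plen_valid) simp
        moreover have "tgt A (tgt A g (s - 1)) 1 = tgt A j 1" using s False by simp
        ultimately have "tgt A g (s - 1) = j" using tgt_1_inj[OF _ j] by blast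
        moreover have "Suc (l - 1 - s) = l - 1 - (s - 1)" using s False by simp
        ultimately show ?thesis using e False by simp
      qed
    qed
  qed
qed (use N is_intervalD(1,2)[OF E] in
    \<open>auto simp: pmap_add pmap_scl lfun_add[OF \<phi>] lfun_scl[OF \<phi>] lc_add lc_scl\<close>)

text \<open>A homomorphism into \<open>E\<close> is determined by the functional giving the coefficient of the socle
  vector, and for maximal \<open>l\<close> every functional arises; so extending homomorphisms amounts to
  extending functionals.\<close>

lemma injective_interval:
  assumes E: "is_interval A E g l v" and l: "0 < l"
    and mx: "\<And>g' l'. g' < nv A \<Longrightarrow> 0 < l' \<Longrightarrow> l' \<le> plen A g' \<Longrightarrow> tgt A g' (l' - 1) = tgt A g (l - 1) \<Longrightarrow> l' \<le> l"
  shows "injective A E"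
  unfolding injective_def
proof (intro conjI allI impI, rule is_intervalD(1)[OF E], elim conjE)
  fix X Y \<gamma> f assume \<gamma>: "hom A X Y \<gamma>" "monic X \<gamma>" and f: "hom A X E f"
  define a where "a = tgt A g (l - 1)"
  let ?cf = "\<lambda>e. cof A E g l v a e (l - 1)"
  have l1: "l - 1 < l" "tgt A g (l - 1) = a" using l by (auto simp: a_def)
  have wY: "wfA A Y" using hom_wf \<gamma> by blast
  have wX: "wfA A X" using hom_wf \<gamma> by blast
  have av: "a < nv A" unfolding a_def using interval_le_plen[OF E] l by (intro tgt_lt plen_valid) simp
  obtain G where G: "lin G" "\<And>x. x \<in> vec (dm X a) \<Longrightarrow> G (hap X \<gamma> a x) = x" "\<And>y. G y \<in> vec (dm X a)"
    using left_inverse_on_vec[of "hap X \<gamma> a" "dm X a", OF lin_amap] monicD[OF \<gamma>(2), of _ a] by blast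
  define \<phi> where "\<phi> y = ?cf (hap X f a (G y))" for y
  have \<phi>: "lfun \<phi>"
    unfolding lfun_def \<phi>_def
    by (intro conjI allI; simp only: fp.linear_add[OF G(1)] fp.linear_scale[OF G(1)] amap_add amap_scl
        cof_add[OF E hom_vec[OF f] hom_vec[OF f] l1] cof_scl[OF E hom_vec[OF f] l1])
  have "\<phi> (pmap A Y j l w) = 0" if w: "w \<in> vec (dm Y j)" and t: "tgt A j l = tgt A g (l - 1)" for j w
  proof -
    have "pmap A Y j l w = 0"
    proof (cases "w = 0")
      case False
      then have "j < nv A" using vertex_lt[OF wY w] by blast
      \<comment> \<open>Otherwise an interval of length \<open>Suc l\<close> would end at the socle
        vertex of \<open>E\<close>.\<close>
      then have "\<not> Suc l \<le> plen A j" using mx[of j "Suc l"] t by auto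
      then show ?thesis using pmap_plen[OF wY w] by simp
    qed simp
    then show ?thesis by (simp add: lfun_0[OF \<phi>])
  qed
  then obtain h where h: "hom A Y E h" "\<And>j w. w \<in> vec (dm Y j) \<Longrightarrow>
      hap Y h j w = lc A E g l v j (\<lambda>s. \<phi> (pmap A Y j (l - 1 - s) w))"
    using hom_into_interval[OF E l wY \<phi>] by blast
  have last: "?cf (hap Y h a (hap X \<gamma> a x)) = ?cf (hap X f a x)" if x: "x \<in> vec (dm X a)" for x
  proof -
    have "?cf (hap Y h a (hap X \<gamma> a x)) = \<phi> (pmap A Y a (l - 1 - (l - 1)) (hap X \<gamma> a x))"
      by (rule cof_eq[OF E h(2)[OF hom_vec[OF \<gamma>(1)]] l1])
    then show ?thesis using G(2)[OF x] by (simp add: \<phi>_def)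
  qed
  have "hcomp Y h \<gamma> = f"
  proof (rule hom_eqI[OF hom_hcomp[OF \<gamma>(1) h(1)] f], rule ccontr)
    fix j x assume x: "x \<in> vec (dm X j)" and ne: "hap X (hcomp Y h \<gamma>) j x \<noteq> hap X f j x"
    let ?e = "hap X (hcomp Y h \<gamma>) j x" and ?e' = "hap X f j x"
    have eE: "?e \<in> vec (dm E j)" "?e' \<in> vec (dm E j)" using hom_hcomp[OF \<gamma>(1) h(1)] f by blast+
    \<comment> \<open>A nonzero difference of the two values can be pushed to the socle, where both
      maps agree by \<open>last\<close>.\<close>
    obtain s c where s: "s < l" "tgt A g s = j" "c \<noteq> 0"
        "pmap A E j (l - 1 - s) (?e - ?e') = scl c (pmap A E g (l - 1) v)"
      using interval_nonzero_lead[OF E vec_diff[OF eE]] ne by auto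
    define x' where "x' = pmap A X j (l - 1 - s) x"
    have tj: "tgt A j (l - 1 - s) = a" using s by (auto simp: a_def simp flip: s(2))
    have x': "x' \<in> vec (dm X a)" unfolding x'_def using pmap_vec[OF wX x, of "l - 1 - s"] tj by simp
    have "pmap A E j (l - 1 - s) ?e = hap Y h a (hap X \<gamma> a x')"
      using hom_pmap[OF hom_hcomp[OF \<gamma>(1) h(1)] x, of "l - 1 - s"] tj by (simp add: x'_def hcomp_app)
    moreover have "pmap A E j (l - 1 - s) ?e' = hap X f a x'"
      using hom_pmap[OF f x, of "l - 1 - s"] tj by (simp add: x'_def)
    ultimately have d: "hap Y h a (hap X \<gamma> a x') = hap X f a x' + scl c (pmap A E g (l - 1) v)"
      using s(4) by (simp add: pmap_diff diff_eq_eq add.commute)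
    have pv: "pmap A E g (l - 1) v \<in> vec (dm E a)"
      using pmap_vec[OF is_intervalD(1,2)[OF E], of "l - 1"] l1 by simp
    have "?cf (pmap A E g (l - 1) v) = 1"
      using cof_eq[OF E lc_single[OF l1] l1] by simp
    then have "?cf (hap Y h a (hap X \<gamma> a x')) = ?cf (hap X f a x') + c"
      unfolding d cof_add[OF E hom_vec[OF f] vec_scl[OF pv] l1] cof_scl[OF E pv l1] by simp
    then show False using last[OF x'] s(3) by simp
  qed
  then show "\<exists>h. hom A Y E h \<and> hcomp Y h \<gamma> = f" using h(1) by blast
qed

text \<open>\<open>e_inv\<close> picks an envelope by \<open>SOME\<close>, so a concrete one must be
  compared with it. The retraction \<open>r\<close> of \<open>u\<close> is injective by essentiality
  of \<open>\<iota>'\<close>, hence \<open>u\<close> is surjective.\<close>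

lemma inj_envelope_unique:
  assumes E: "inj_envelope A S E \<iota>" and E': "inj_envelope A S E' \<iota>'"
  shows "iso A E E'"
proof -
  have \<iota>: "injective A E" "hom A S E \<iota>" "monic S \<iota>"
    and \<iota>': "injective A E'" "hom A S E' \<iota>'" "monic S \<iota>'"
    using E E' by (auto simp: inj_envelope_def)
  obtain u where u: "hom A E E' u" "hcomp E u \<iota> = \<iota>'"
    using \<iota>'(1) \<iota>(2,3) \<iota>'(2) unfolding injective_def by blast
  have mu: "monic E u" using E u \<iota>'(3) unfolding inj_envelope_def by metis
  obtain j where j: "hom A E E j" "\<And>i v. v \<in> vec (dm E i) \<Longrightarrow> hap E j i v = v"
    using hom_id hom_wf(2)[OF \<iota>(2)] by blast
  obtain r where r: "hom A E' E r" "hcomp E' r u = j"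
    using \<iota>(1) u(1) mu j(1) unfolding injective_def by blast
  have ru: "hap E' r i (hap E u i v) = v" if "v \<in> vec (dm E i)" for i v
    using j(2)[OF that] r(2) hcomp_app by metis
  have "monic S (hcomp E' r \<iota>')"
    unfolding monic_iff hcomp_app u(2)[symmetric]
    using ru[OF hom_vec[OF \<iota>(2)]] monicD[OF \<iota>(3)] by auto
  then have mr: "monic E' r" using E' r(1) unfolding inj_envelope_def by blast
  have "epi E E' u"
    unfolding epi_def
  proof (intro allI impI)
    fix i and w :: "nat \<Rightarrow> 'k" assume w: "w \<in> vec (dm E' i)"
    have "hap E u i (hap E' r i w) = w"
      by (rule monic_inj[OF mr hom_vec[OF u(1)] w]) (use ru hom_vec[OF r(1)] in auto)
    then show "\<exists>v\<in>vec (dm E i). hap E u i v = w" using r(1) by blast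
  qed
  then show ?thesis using u(1) mu by (auto simp: iso_def)
qed

text \<open>The envelope is the longest interval ending at \<open>a\<close>. Maximality stays in the
  conclusion because it becomes the assumption \<open>gmax\<close> on the unrolled quiver.\<close>

lemma simple_inj_envelope:
  assumes S: "is_interval A S a 1 y"
  shows "\<exists>g l. g < nv A \<and> 0 < l \<and> l \<le> plen A g \<and> tgt A g (l - 1) = a \<and>
    (\<forall>g' l'. g' < nv A \<longrightarrow> 0 < l' \<longrightarrow> l' \<le> plen A g' \<longrightarrow> tgt A g' (l' - 1) = a \<longrightarrow> l' \<le> l) \<and>
    interval_of (SOME E. \<exists>\<iota>. inj_envelope A S E \<iota>) (g, l)"
proof -
  have a: "a < nv A" using interval_top_lt[OF S] by simp
  let ?P = "\<lambda>l. \<exists>g<nv A. 0 < l \<and> l \<le> plen A g \<and> tgt A g (l - 1) = a"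
  have P1: "?P 1" using a plen_pos[OF a] by (auto intro!: exI[of _ a])
  have bound: "l \<le> (\<Sum>g<nv A. plen A g)" if "?P l" for l
  proof -
    obtain g where g: "g < nv A" "l \<le> plen A g" using \<open>?P l\<close> by blast
    have "plen A g \<le> (\<Sum>g<nv A. plen A g)" using g(1) by (intro member_le_sum) auto
    with g show ?thesis by simp
  qed
  define l where "l = Greatest ?P"
  have "?P l" unfolding l_def by (rule GreatestI_nat[of ?P 1 "\<Sum>g<nv A. plen A g", OF P1 bound])
  then obtain g where g: "g < nv A" "0 < l" "l \<le> plen A g" "tgt A g (l - 1) = a" by blast
  have mx: "l' \<le> l" if "g' < nv A" "0 < l'" "l' \<le> plen A g'" "tgt A g' (l' - 1) = a" for g' l'
    unfolding l_def
    by (rule Greatest_le_nat[of ?P _ "\<Sum>g<nv A. plen A g", OF _ bound]) (use that in auto)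
  obtain E v where E: "is_interval A E g l v" using interval_exists[OF g(1,3)] by blast
  have inj: "injective A E" by (rule injective_interval[OF E g(2)]) (use mx g(4) in auto)
  define e where "e = pmap A E g (l - 1) v"
  have e: "e \<in> vec (dm E a)" "e \<noteq> 0"
    using pmap_vec[OF is_intervalD(1,2)[OF E], of "l - 1"] is_intervalD(4)[OF E, of "l - 1"] g
    by (auto simp: e_def)
  have "pmap A E a 1 e = 0"
    using pmap_plus[of A E g "l - 1" 1 v] is_intervalD(3)[OF E] g(2,4)
    by (simp add: e_def del: pmap.simps)
  then obtain \<iota> where \<iota>: "hom A S E \<iota>" "hap S \<iota> a y = e"
    using hom_from_interval[OF S is_intervalD(1)[OF E] e(1)] by blast
  have m\<iota>: "monic S \<iota>" by (rule interval_monicI[OF S \<iota>(1)]) (simp add: \<iota>(2) e(2))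
  have "monic E \<gamma>" if \<gamma>: "hom A E Z \<gamma>" "monic S (hcomp E \<gamma> \<iota>)" for Z \<gamma>
  proof (rule interval_monicI[OF E \<gamma>(1)])
    have "hap S (hcomp E \<gamma> \<iota>) a y \<noteq> 0"
      using monicD[OF \<gamma>(2) is_intervalD(2)[OF S]] is_intervalD(4)[OF S, of 0] by auto
    then show "pmap A Z g (l - 1) (hap E \<gamma> g v) \<noteq> 0"
      using hom_pmap[OF \<gamma>(1) is_intervalD(2)[OF E], of "l - 1"] g(4) by (simp add: hcomp_app \<iota>(2) e_def)
  qed
  then have env: "inj_envelope A S E \<iota>" using inj \<iota>(1) m\<iota> unfolding inj_envelope_def by blast
  let ?E = "SOME E. \<exists>\<iota>. inj_envelope A S E \<iota>"
  have "\<exists>\<iota>. inj_envelope A S ?E \<iota>" by (rule someI_ex) (use env in blast)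
  then have "iso A E ?E" using inj_envelope_unique[OF env] by blast
  then have "interval_of ?E (g, l)" using interval_iso_transport[OF _ E] by (simp add: interval_of_def)
  then show ?thesis using g mx by blast
qed

end

section \<open>Higher syzygy modules\<close>

lemma dsum_zero_left: "zero_rep Z \<Longrightarrow> dsum A Z P = P"
  by (simp add: dsum_def zero_rep_def)

lemma dsum_zero_right:
  assumes Z: "wfA A Z" and P: "wfA A P" "zero_rep P"
  shows "dsum A Z P = Z"
proof -
  have "ar P i r c = 0" for i r c
    using P by (auto simp: wfA_def wf_mat_def zero_rep_def)
  moreover have "ar Z i r c = 0" if "\<not> (r < dm Z (tgt A i 1) \<and> c < dm Z i)" for i r c
    using Z that by (auto simp: wfA_def wf_mat_def not_less)
  ultimately have "ar (dsum A Z P) = ar Z"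
    by (auto simp: dsum_def fun_eq_iff)
  moreover have "dm (dsum A Z P) = dm Z"
    using P(2) by (auto simp: dsum_def fun_eq_iff zero_rep_def)
  ultimately show ?thesis by simp
qed

lemma vec_dsum: "u \<in> vec (dm Z i) \<Longrightarrow> u \<in> vec (dm (dsum A Z P) i)"
  by (simp add: dsum_def vec_def)

lemma dsum_row:
  assumes "r < dm Z (tgt A i 1)"
  shows "act (dsum A Z P) i u r = (\<Sum>c<dm Z i. ar Z i r c * u c)"
proof -
  have "act (dsum A Z P) i u r = (\<Sum>c<dm Z i + dm P i. if c < dm Z i then ar Z i r c * u c else 0)"
    unfolding amap_def using assms by (intro sum.cong) (auto simp: dsum_def)
  also have "\<dots> = (\<Sum>c<dm Z i. ar Z i r c * u c)"
    by (rule sum.mono_neutral_cong_right) auto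
  finally show ?thesis .
qed

lemma act_dsum:
  assumes Z: "wfA A Z" and u: "u \<in> vec (dm Z i)"
  shows "act (dsum A Z P) i u = act Z i u"
proof
  fix r
  show "act (dsum A Z P) i u r = act Z i u r"
  proof (cases "r < dm Z (tgt A i 1)")
    case True
    then show ?thesis using dsum_row[of r Z A i P u] by (simp add: amap_def)
  next
    case False
    then have "act Z i u r = 0" using act_vec[OF Z, of i u] by (simp add: vec_def)
    moreover have "ar (dsum A Z P) i r c * u c = 0" for c
      using False u by (cases "c < dm Z i") (auto simp: dsum_def vec_def)
    then have "act (dsum A Z P) i u r = 0" unfolding amap_def by (intro sum.neutral ballI)
    ultimately show ?thesis by simp
  qed
qed

text \<open>Truncation of coordinates is the projection of the direct sum onto
  \<open>Z\<close>.\<close>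

lemma act_dsum_truncate:
  assumes Z: "wfA A Z"
  shows "act Z i (\<lambda>r. if r < dm Z i then u r else 0)
    = (\<lambda>r. if r < dm Z (tgt A i 1) then act (dsum A Z P) i u r else 0)"
proof
  fix r
  show "act Z i (\<lambda>r. if r < dm Z i then u r else 0) r
    = (if r < dm Z (tgt A i 1) then act (dsum A Z P) i u r else 0)"
  proof (cases "r < dm Z (tgt A i 1)")
    case True
    then show ?thesis unfolding dsum_row[OF True] by (simp add: amap_def)
  next
    case False
    then show ?thesis using act_vec[OF Z, of i "\<lambda>r. if r < dm Z i then u r else 0"] by (simp add: vec_def)
  qed
qed

lemma dsum_inrad:
  assumes Z: "wfA A Z" and z: "\<zeta> \<in> vec (dm Z i)" and r: "inrad A (dsum A Z P) i \<zeta>"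
  shows "inrad A Z i \<zeta>"
proof (cases "\<zeta> = 0")
  case True
  then show ?thesis by (simp add: inrad_def)
next
  case False
  then obtain j u where j: "j < nv A" "tgt A j 1 = i" "act (dsum A Z P) j u = \<zeta>"
    using r by (auto simp: inrad_def)
  have "act Z j (\<lambda>r. if r < dm Z j then u r else 0) = (\<lambda>r. if r < dm Z i then \<zeta> r else 0)"
    using act_dsum_truncate[OF Z, of j u P] unfolding j(2,3) .
  also have "\<dots> = \<zeta>" using z by (auto simp: vec_def)
  finally have "act Z j (\<lambda>r. if r < dm Z j then u r else 0) = \<zeta>" .
  moreover have "(\<lambda>r. if r < dm Z j then u r else 0) \<in> vec (dm Z j)" by (simp add: vec_def)
  ultimately show ?thesis unfolding inrad_def using j by blast
qed

context nakayama_algebra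
begin

lemma tops_dsum: "wfA A Z \<Longrightarrow> tops Z \<subseteq> tops (dsum A Z P)"
  unfolding tops_def using dsum_inrad vec_dsum by blast

lemma socs_dsum: "wfA A Z \<Longrightarrow> socs Z \<subseteq> socs (dsum A Z P)"
  unfolding socs_def using act_dsum vec_dsum by fastforce

lemma iso_tops: "iso A M N \<Longrightarrow> tops M \<subseteq> tops N"
proof
  fix i assume "iso A M N" and i: "i \<in> tops M"
  then obtain f g where f: "hom A M N f" "hom A N M g"
      "\<And>i v. v \<in> vec (dm M i) \<Longrightarrow> hap N g i (hap M f i v) = v"
    using isoE by metis
  obtain v where "v \<in> vec (dm M i)" "\<not> inrad A M i v" using i by (auto simp: tops_def)
  then show "i \<in> tops N" using iso_inrad[OF f] hom_vec[OF f(1)] unfolding tops_def by blast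
qed

lemma iso_socs: "iso A M N \<Longrightarrow> socs M \<subseteq> socs N"
proof
  fix i assume "iso A M N" and i: "i \<in> socs M"
  then obtain f where f: "hom A M N f" "monic M f" by (auto simp: iso_def)
  obtain v where v: "v \<in> vec (dm M i)" "v \<noteq> 0" "act M i v = 0" using i by (auto simp: socs_def)
  have "hap M f i v \<noteq> 0" using monicD[OF f(2) v(1)] v(2) by blast
  moreover have "act N i (hap M f i v) = 0" using hom_act[OF f(1) v(1)] v(3) by simp
  ultimately show "i \<in> socs N" using hom_vec[OF f(1)] unfolding socs_def by blast
qed

lemma syz_wf: "syz A k N Z \<Longrightarrow> wfA A Z"
  by (cases k) (auto simp: iso_def omega1_def hom_def)

lemma tops_lt: "wfA A M \<Longrightarrow> i \<in> tops M \<Longrightarrow> i < nv A"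
  unfolding tops_def inrad_def using vertex_lt by blast

text \<open>A nonzero \<open>Z\<close> contributes a top vertex and a socle vertex to
  \<open>X\<close>, which has only one of each; so nothing need be known about how \<open>X\<close>
  splits. If \<open>Z\<close> is zero, \<open>X\<close> is projective.\<close>

lemma kth_syzygy_interval:
  assumes K: "kth_syzygy_module A k X" and X: "is_interval A X x l v"
  shows "snd (om (x, l)) = 0 \<or> (\<exists>N Z. syz A k N Z \<and> x \<in> tops Z \<and> tgt A x (l - 1) \<in> socs Z)"
proof -
  obtain N Z P where Z: "syz A k N Z" "projective A P" "iso A X (dsum A Z P)"
    using K by (auto simp: kth_syzygy_module_def)
  have wZ: "wfA A Z" using syz_wf[OF Z(1)] .
  show ?thesis
  proof (cases "zero_rep Z")
    case True
    then have "iso A P X" using Z(3) dsum_zero_left iso_sym by metis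
    then obtain f where f: "hom A P X f" "monic P f" "epi P X f" by (auto simp: iso_def)
    have "is_resolution A 0 X (\<lambda>n. case n of 0 \<Rightarrow> X | Suc _ \<Rightarrow> P) (\<lambda>_. f)"
      using f Z(2) by (auto simp: is_resolution_def split: nat.splits)
    then have "resolved A (Suc 0) X" by (rule is_resolution_resolved)
    moreover have "interval_of X (x, l)" using X by (auto simp: interval_of_def)
    ultimately have "snd ((om ^^ Suc 0) (x, l)) = 0" using resolved_interval_iff by blast
    then show ?thesis by simp
  next
    case False
    then obtain i and u :: "nat \<Rightarrow> 'k" where u: "u \<in> vec (dm Z i)" "u \<noteq> 0" using zero_repI by blast
    obtain a where a: "a \<in> tops Z" using nonrad_preimage[OF wZ u] by (auto simp: tops_def)
    obtain j where j: "j \<in> socs Z" using socle_exists[OF wZ u] by (auto simp: socs_def)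
    have "a \<in> tops X" using a tops_dsum[OF wZ] iso_tops[OF iso_sym[OF Z(3)]] by blast
    then have "a = x" using interval_top[OF X] by (auto simp: tops_def)
    moreover have "j \<in> socs X" using j socs_dsum[OF wZ] iso_socs[OF iso_sym[OF Z(3)]] by blast
    then have "j = tgt A x (l - 1)" using interval_soc[OF X] unfolding socs_def by blast
    ultimately show ?thesis using Z(1) a j by blast
  qed
qed

text \<open>The map f on vertices. On a line the value may be \<open>nv A\<close>, which is not a
  vertex; there \<open>plen\<close> is 0, so \<open>nxt\<close> fixes it.\<close>

definition nxt :: "nat \<Rightarrow> nat" where
  "nxt a = tgt A a (plen A a)"

lemma syz_even_tops: "syz A (2 * k) N Z \<Longrightarrow> z \<in> tops Z \<Longrightarrow> \<exists>a<nv A. z = (nxt ^^ k) a"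
proof (induction k arbitrary: Z z)
  case 0
  then show ?case using tops_lt[OF syz_wf[OF 0(1)]] by auto
next
  case (Suc k)
  obtain Y Y' where Y: "syz A (2 * k) N Y'" "omega1 A Y' Y" "omega1 A Y Z"
    using Suc.prems(1) by auto
  obtain a where a: "a \<in> tops Y'" "tgt A a (plen A a) = z"
    using tops_omega2[OF Y(2,3) Suc.prems(2)] by blast
  obtain b where "b < nv A" "a = (nxt ^^ k) b" using Suc.IH[OF Y(1) a(1)] by blast
  then show ?case using a(2) by (auto simp: nxt_def[of "(nxt ^^ k) b"])
qed

text \<open>The exclusive right end belonging to a socle vertex \<open>w\<close> is
  \<open>tgt A w 1\<close>.\<close>

lemma syz_odd_socs:
  assumes "syz A (Suc (2 * k)) N Z" "w \<in> socs Z"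
  shows "\<exists>a<nv A. tgt A w 1 = (nxt ^^ Suc k) a"
proof -
  obtain Y where Y: "syz A (2 * k) N Y" "omega1 A Y Z" using assms(1) by auto
  obtain a where a: "a \<in> tops Y" "a < nv A" "tgt A a (plen A a - 1) = w"
    using socs_omega[OF Y(2) assms(2)] by blast
  obtain b where b: "b < nv A" "a = (nxt ^^ k) b" using syz_even_tops[OF Y(1) a(1)] by blast
  have "tgt A w 1 = nxt a"
    using tgt_tgt[of A a "plen A a - 1" 1] plen_pos[OF a(2)] unfolding a(3) nxt_def by simp
  then show ?thesis using b by auto
qed

lemma interval_of_exists: "i < nv A \<Longrightarrow> l \<le> plen A i \<Longrightarrow> \<exists>M. interval_of M (i, l)"
  using ivl_is_interval[of i l] by (auto simp: interval_of_def)

lemma zero_module_exists: "\<exists>M. interval_of M (0, 0)"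
  using interval_of_exists[OF nv_pos] by simp

lemma projective_kth_syzygy:
  assumes "projective A X"
  shows "kth_syzygy_module A k X"
proof -
  obtain Y0 where Y0: "interval_of Y0 (0, 0)" using zero_module_exists by blast
  obtain Z where Z: "syz A k Y0 Z" using syz_exists[OF Y0] by blast
  have "interval_of Z (0, 0)" using syz_interval_of[OF Y0 Z] om_funpow_0[of "(0, 0)"] by simp
  then have "zero_rep Z" using interval_0_zero by (auto simp: interval_of_def)
  then have "dsum A Z X = X" by (rule dsum_zero_left)
  then have "iso A X (dsum A Z X)" using assms iso_refl[of A X] by (simp add: projective_def)
  moreover have "wfA A Y0" using Y0 is_intervalD(1) by (auto simp: interval_of_def)
  ultimately show ?thesis using Z assms unfolding kth_syzygy_module_def by blast
qed

lemma syz_kth_syzygy: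
  assumes "wfA A N" "syz A k N Z" "iso A X Z"
  shows "kth_syzygy_module A k X"
proof -
  obtain Y0 where Y0: "interval_of Y0 (0, 0)" using zero_module_exists by blast
  then have zO: "zero_rep Y0" "wfA A Y0"
    using interval_0_zero is_intervalD(1) by (auto simp: interval_of_def)
  have "dsum A Z Y0 = Z" using dsum_zero_right[OF syz_wf[OF assms(2)] zO(2,1)] .
  then show ?thesis
    using assms projective_zero[OF zO(2,1)] unfolding kth_syzygy_module_def by metis
qed

lemma interval_projectiveI:
  assumes X: "is_interval A X x l v" and z: "snd (om (x, l)) = 0"
  shows "projective A X"
proof (cases "l = 0")
  case True
  then show ?thesis using X projective_zero interval_0_zero is_intervalD(1) by blast
next
  case False
  then have "l = plen A x" using z interval_le_plen[OF X] by (simp add: om_def)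
  then show ?thesis using projective_interval X by simp
qed

end

section \<open>The unrolled syzygy sequence\<close>

context nakayama_algebra
begin

definition vx :: "nat \<Rightarrow> nat" where
  "vx x = tgt A 0 x"

text \<open>Period 0 on a line makes translation trivial, so line and cycle are treated
  alike.\<close>

definition per :: nat where
  "per = (if cyc A then nv A else 0)"

definition fx :: "nat \<Rightarrow> nat" where
  "fx x = x + plen A (vx x)"

lemma tgt_vx: "tgt A (vx x) s = vx (x + s)"
  by (simp add: vx_def)

lemma vx_vertex: "i < nv A \<Longrightarrow> vx i = i"
  by (auto simp: vx_def tgt_def)

lemma vx_per: "vx (x + per * q) = vx x"
  by (simp add: vx_def tgt_def per_def)

text \<open>Multiples of the period appear on both sides to avoid negative translations.\<close>

lemma vx_eqD:
  assumes "vx x = vx y"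
  shows "\<exists>q q'. x + per * q = y + per * q'"
proof (cases "cyc A")
  case True
  then have "x mod nv A = y mod nv A" using assms by (simp add: vx_def tgt_def)
  then have "x + nv A * (y div nv A) = y + nv A * (x div nv A)"
    using mult_div_mod_eq[of "nv A" x] mult_div_mod_eq[of "nv A" y] by linarith
  then show ?thesis using True unfolding per_def by auto
next
  case False
  then show ?thesis using assms by (auto simp: vx_def tgt_def)
qed

lemma fx_per: "fx (x + per * q) = fx x + per * q"
  by (simp add: fx_def vx_per)

lemma fx_funpow_per: "(fx ^^ k) (x + per * q) = (fx ^^ k) x + per * q"
  by (induction k) (auto simp: fx_per)

lemma vx_fx: "vx (fx x) = nxt (vx x)"
  by (simp add: nxt_def tgt_vx fx_def)

lemma vx_fx_funpow: "vx ((fx ^^ k) x) = (nxt ^^ k) (vx x)"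
  by (induction k) (auto simp: vx_fx)

lemma fx_mono: "mono fx"
proof (rule mono_iff_le_Suc[THEN iffD2], rule allI)
  fix x
  have "plen A (vx x) \<le> Suc (plen A (vx (Suc x)))"
  proof (cases "valid_path A (vx x) 1")
    case True
    from plen_step[OF this] show ?thesis by (simp add: tgt_vx)
  next
    case False
    then show ?thesis using plen_le[of "vx x" 1] by simp
  qed
  then show "fx x \<le> fx (Suc x)" by (simp add: fx_def)
qed

lemma fx_funpow_mono: "x \<le> y \<Longrightarrow> (fx ^^ k) x \<le> (fx ^^ k) y"
  using fx_mono by (induction k) (auto dest: monoD)

text \<open>The \<open>j\<close>-th syzygy of the interval \<open>[a, b)\<close> is \<open>[seq a b j, seq a b (j + 1))\<close>,
  up to the first syzygy that vanishes.\<close>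

fun seq :: "nat \<Rightarrow> nat \<Rightarrow> nat \<Rightarrow> nat" where
  "seq a b 0 = a"
| "seq a b (Suc 0) = b"
| "seq a b (Suc (Suc j)) = fx (seq a b j)"

lemma seq_even: "seq a b (2 * k) = (fx ^^ k) a"
  by (induction k) auto

lemma seq_odd: "seq a b (Suc (2 * k)) = (fx ^^ k) b"
  by (induction k) auto

lemma seq_le:
  assumes "a \<le> b" "b \<le> fx a"
  shows "seq a b j \<le> seq a b (Suc j)"
proof -
  have "seq a b j \<le> seq a b (Suc j) \<and> seq a b (Suc j) \<le> seq a b (Suc (Suc j))"
    using assms fx_mono by (induction j) (auto dest: monoD)
  then show ?thesis by blast
qed

lemma om_seq:
  assumes "\<And>j. j < m \<Longrightarrow> seq a b j < seq a b (Suc j)"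
  shows "(om ^^ m) (vx a, b - a) = (vx (seq a b m), seq a b (Suc m) - seq a b m)"
  using assms
proof (induction m)
  case (Suc m)
  have lt: "seq a b m < seq a b (Suc m)" using Suc.prems by simp
  have "(om ^^ Suc m) (vx a, b - a) = om (vx (seq a b m), seq a b (Suc m) - seq a b m)"
    using Suc by simp
  also have "\<dots> = (vx (seq a b (Suc m)), seq a b (Suc (Suc m)) - seq a b (Suc m))"
    using lt by (simp add: om_def tgt_vx fx_def)
  finally show ?case .
qed simp

lemma om_seq_zero_iff:
  assumes "a \<le> b" "b \<le> fx a"
  shows "snd ((om ^^ m) (vx a, b - a)) = 0 \<longleftrightarrow> (\<exists>j\<le>m. seq a b j = seq a b (Suc j))"
proof
  assume z: "snd ((om ^^ m) (vx a, b - a)) = 0"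
  show "\<exists>j\<le>m. seq a b j = seq a b (Suc j)"
  proof (rule ccontr)
    assume "\<not> ?thesis"
    then have lt: "seq a b j < seq a b (Suc j)" if "j \<le> m" for j
      using seq_le[OF assms, of j] that by (simp add: order.not_eq_order_implies_strict)
    have "snd ((om ^^ m) (vx a, b - a)) = seq a b (Suc m) - seq a b m"
      using om_seq[of m a b] lt by simp
    then show False using z lt[OF order_refl] by linarith
  qed
next
  assume "\<exists>j\<le>m. seq a b j = seq a b (Suc j)"
  then obtain j where j: "j \<le> m" "seq a b j = seq a b (Suc j)" by blast
  \<comment> \<open>\<open>seq\<close> may increase again after a repetition, whereas
    \<open>om\<close> then stays at length 0; so \<open>om\<close> is followed only up to the first
    repetition.\<close>
  define i where "i = (LEAST j. seq a b j = seq a b (Suc j))"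
  have i: "seq a b i = seq a b (Suc i)" unfolding i_def using j(2) by (rule LeastI)
  have "i \<le> j" unfolding i_def using j(2) by (rule Least_le)
  have "seq a b t < seq a b (Suc t)" if "t < i" for t
    using not_less_Least[of t "\<lambda>j. seq a b j = seq a b (Suc j)"] that seq_le[OF assms, of t]
    unfolding i_def by (simp add: order.not_eq_order_implies_strict)
  then have oi: "snd ((om ^^ i) (vx a, b - a)) = 0" using om_seq[of i a b] i by simp
  have "(om ^^ m) (vx a, b - a) = (om ^^ (m - i)) ((om ^^ i) (vx a, b - a))"
    using \<open>i \<le> j\<close> j(1) by (simp flip: funpow_add[unfolded o_def fun_eq_iff, rule_format])
  then show "snd ((om ^^ m) (vx a, b - a)) = 0" using om_funpow_0[OF oi] oi by simp
qed

end

text \<open>The interval \<open>[g, a + 1)\<close> is the injective envelope of the simple module \<open>[a, a + 1)\<close>.\<close>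

locale unrolled_envelope = nakayama_algebra +
  fixes g a :: nat
  assumes ga: "g \<le> a" and fg: "Suc a \<le> fx g"
    and gmax: "\<And>z q. z < g + per * q \<Longrightarrow> fx z \<le> a + per * q"
begin

text \<open>Compare a translate of \<open>z\<close> with g. To its left, \<open>gmax\<close> gives f
  z \<le> a and hence f^k (a + 1) \<le> f^k a. Otherwise f^(k+1) g \<le> f^(k+1) z = f^k (a + 1)
  \<le> f^(k+1) g, the last step by a + 1 \<le> f g. All this holds up to translation.\<close>

lemma image_dichotomy:
  assumes "vx ((fx ^^ Suc k) z) = vx ((fx ^^ k) (Suc a))"
  shows "(fx ^^ Suc k) g = (fx ^^ k) (Suc a) \<or> (fx ^^ k) a = (fx ^^ k) (Suc a)"
proof -
  obtain q q' where "(fx ^^ Suc k) z + per * q = (fx ^^ k) (Suc a) + per * q'"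
    using vx_eqD[OF assms] by blast
  then have e: "(fx ^^ Suc k) (z + per * q) = (fx ^^ k) (Suc a) + per * q'"
    by (simp only: fx_funpow_per)
  show ?thesis
  proof (cases "z + per * q < g + per * q'")
    case True
    then have "fx (z + per * q) \<le> a + per * q'" by (rule gmax)
    then have "(fx ^^ k) (fx (z + per * q)) \<le> (fx ^^ k) (a + per * q')" by (rule fx_funpow_mono)
    then have "(fx ^^ k) (Suc a) \<le> (fx ^^ k) a"
      using e unfolding funpow_Suc_right o_apply fx_funpow_per[of k a] by linarith
    moreover have "(fx ^^ k) a \<le> (fx ^^ k) (Suc a)" by (rule fx_funpow_mono) simp
    ultimately show ?thesis by simp
  next
    case False
    then have "(fx ^^ Suc k) (g + per * q') \<le> (fx ^^ Suc k) (z + per * q)"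
      by (intro fx_funpow_mono) simp
    then have "(fx ^^ Suc k) g \<le> (fx ^^ k) (Suc a)" unfolding e fx_funpow_per[of "Suc k" g] by linarith
    moreover have "(fx ^^ k) (Suc a) \<le> (fx ^^ k) (fx g)" using fg by (rule fx_funpow_mono)
    ultimately show ?thesis by (simp add: funpow_swap1)
  qed
qed

lemma fa: "Suc a \<le> fx a"
  using fg monoD[OF fx_mono ga] by simp

lemma deloop_imp:
  assumes S: "interval_of S (vx a, 1)" and X: "syz A t S X" and K: "kth_syzygy_module A (t + 1) X"
  shows "snd ((om ^^ Suc t) (vx a, 1)) = 0 \<or> snd ((om ^^ Suc t) (vx g, Suc a - g)) = 0"
proof (rule disjCI)
  let ?S = "seq a (Suc a)" and ?E = "seq g (Suc a)"
  have Zs: "snd ((om ^^ m) (vx a, 1)) = 0 \<longleftrightarrow> (\<exists>j\<le>m. ?S j = ?S (Suc j))" for m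
    using om_seq_zero_iff[of a "Suc a" m] fa by simp
  have Ze: "snd ((om ^^ m) (vx g, Suc a - g)) = 0 \<longleftrightarrow> (\<exists>j\<le>m. ?E j = ?E (Suc j))" for m
    using om_seq_zero_iff[of g "Suc a" m] fg ga by simp
  assume nE: "snd ((om ^^ Suc t) (vx g, Suc a - g)) \<noteq> 0"
  show "snd ((om ^^ Suc t) (vx a, 1)) = 0"
  proof (rule ccontr)
    assume nS: "snd ((om ^^ Suc t) (vx a, 1)) \<noteq> 0"
    have lt: "?S j < ?S (Suc j)" if "j \<le> Suc t" for j
      using nS that seq_le[of a "Suc a" j] fa unfolding Zs by (simp add: order.not_eq_order_implies_strict)
    have ot: "(om ^^ t) (vx a, 1) = (vx (?S t), ?S (Suc t) - ?S t)"
      using om_seq[of t a "Suc a"] lt by simp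
    obtain v where v: "is_interval A X (vx (?S t)) (?S (Suc t) - ?S t) v"
      using syz_interval_of[OF S X] unfolding ot interval_of_def by auto
    have "snd (om (vx (?S t), ?S (Suc t) - ?S t)) \<noteq> 0" using nS ot by simp
    then obtain N Z where Z: "syz A (t + 1) N Z" "vx (?S t) \<in> tops Z"
        "tgt A (vx (?S t)) (?S (Suc t) - ?S t - 1) \<in> socs Z"
      using kth_syzygy_interval[OF K v] by (elim disjE exE conjE) auto
    \<comment> \<open>For even \<open>t\<close> the position f^k (a + 1) is the right end of
      \<open>X\<close>, found through its socle; for odd \<open>t\<close> it is the top of
      \<open>X\<close>.\<close>
    have "\<exists>k z. (t = 2 * k \<or> t = Suc (2 * k)) \<and> vx ((fx ^^ Suc k) z) = vx ((fx ^^ k) (Suc a))"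
    proof (cases "even t")
      case True
      then obtain k where k: "t = 2 * k" by blast
      have "syz A (Suc (2 * k)) N Z" using Z(1) k by (simp del: syz.simps)
      from syz_odd_socs[OF this Z(3)]
      obtain b where b: "b < nv A" "tgt A (tgt A (vx (?S t)) (?S (Suc t) - ?S t - 1)) 1 = (nxt ^^ Suc k) b"
        by blast
      have "tgt A (tgt A (vx (?S t)) (?S (Suc t) - ?S t - 1)) 1 = vx (?S (Suc t))"
        using lt[of t] by (simp add: tgt_vx)
      then have "vx (?S (Suc t)) = (nxt ^^ Suc k) b" using b(2) by metis
      moreover have "?S (Suc t) = (fx ^^ k) (Suc a)" unfolding k by (rule seq_odd)
      ultimately have "vx ((fx ^^ Suc k) b) = vx ((fx ^^ k) (Suc a))"
        using vx_vertex[OF b(1)] vx_fx_funpow[of "Suc k" b] by simp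
      then show ?thesis using k by blast
    next
      case False
      then obtain k where k: "t = Suc (2 * k)" by (auto elim: oddE)
      have "syz A (2 * Suc k) N Z" using Z(1) k by (simp del: syz.simps)
      from syz_even_tops[OF this Z(2)]
      obtain b where b: "b < nv A" "vx (?S t) = (nxt ^^ Suc k) b" by blast
      have "?S t = (fx ^^ k) (Suc a)" unfolding k by (rule seq_odd)
      then have "vx ((fx ^^ Suc k) b) = vx ((fx ^^ k) (Suc a))"
        using b vx_vertex[OF b(1)] vx_fx_funpow[of "Suc k" b] by simp
      then show ?thesis using k by blast
    qed
    then obtain k z where k: "t = 2 * k \<or> t = Suc (2 * k)"
        and z: "vx ((fx ^^ Suc k) z) = vx ((fx ^^ k) (Suc a))" by blast
    have kt: "2 * k \<le> t" using k by auto
    from image_dichotomy[OF z] show False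
    proof
      assume "(fx ^^ Suc k) g = (fx ^^ k) (Suc a)"
      then have "?E (Suc (2 * k)) = ?E (Suc (Suc (2 * k)))"
        using seq_odd[of g "Suc a" k] seq_even[of g "Suc a" "Suc k"] by simp
      then show False using nE kt unfolding Ze by (metis Suc_le_mono)
    next
      assume "(fx ^^ k) a = (fx ^^ k) (Suc a)"
      then have "?S (2 * k) = ?S (Suc (2 * k))" unfolding seq_even seq_odd .
      then show False using lt[of "2 * k"] kt by simp
    qed
  qed
qed

text \<open>If the envelope \<open>[g, a + 1)\<close> has finite projective dimension \<open>2 * k\<close>, then the even syzygy of the
  simple module coincides with the next syzygy of the cosyzygy \<open>[g, a)\<close>.\<close>

lemma imp_deloop:
  assumes S: "interval_of S (vx a, 1)" and gv: "g < nv A"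
    and Z: "snd ((om ^^ Suc t) (vx a, 1)) = 0 \<or> snd ((om ^^ Suc t) (vx g, Suc a - g)) = 0"
  shows "\<exists>t'\<le>t. \<exists>X. syz A t' S X \<and> kth_syzygy_module A (t' + 1) X"
proof (cases "snd ((om ^^ Suc t) (vx a, 1)) = 0")
  case True
  obtain X where X: "syz A t S X" using syz_exists[OF S] by blast
  obtain v where v: "is_interval A X (fst ((om ^^ t) (vx a, 1))) (snd ((om ^^ t) (vx a, 1))) v"
    using syz_interval_of[OF S X] by (auto simp: interval_of_def)
  have "projective A X" by (rule interval_projectiveI[OF v]) (use True in simp)
  then show ?thesis using X projective_kth_syzygy by blast
next
  case nS: False
  let ?S = "seq a (Suc a)" and ?E = "seq g (Suc a)" and ?N = "seq g a"
  have lt: "?S j < ?S (Suc j)" if "j \<le> Suc t" for j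
    using nS om_seq_zero_iff[of a "Suc a" "Suc t"] fa that seq_le[of a "Suc a" j]
    by (simp add: order.not_eq_order_implies_strict)
  obtain j where j: "j \<le> Suc t" "?E j = ?E (Suc j)"
    using Z nS om_seq_zero_iff[of g "Suc a" "Suc t"] fg ga by auto
  \<comment> \<open>A repetition at an even index would squeeze f^k a between two equal values and
    give a repetition for the simple module.\<close>
  have "odd j"
  proof
    assume "even j"
    then obtain k where k: "j = 2 * k" by blast
    have "(fx ^^ k) g = (fx ^^ k) (Suc a)" using j(2) unfolding k seq_even seq_odd .
    moreover have "(fx ^^ k) g \<le> (fx ^^ k) a" using ga by (rule fx_funpow_mono)
    moreover have "(fx ^^ k) a \<le> (fx ^^ k) (Suc a)" by (rule fx_funpow_mono) simp
    ultimately have "?S (2 * k) = ?S (Suc (2 * k))" unfolding seq_even seq_odd by simp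
    then show False using lt[of "2 * k"] j(1) k by simp
  qed
  then obtain k where k: "j = Suc (2 * k)" by (auto elim: oddE)
  have kt: "2 * k \<le> t" using j(1) k by simp
  have eq: "(fx ^^ Suc k) g = (fx ^^ k) (Suc a)"
    using j(2) seq_odd[of g "Suc a" k] seq_even[of g "Suc a" "Suc k"] unfolding k by simp
  have fg': "a \<le> fx g" using fg by simp
  \<comment> \<open>A repetition for [g, a) before this index, carried forward by \<open>fx\<close>
    and combined with \<open>eq\<close>, would give one for the simple module at index 2 k or 2 k +
    1.\<close>
  have ltN: "?N i < ?N (Suc i)" if i: "i < Suc (2 * k)" for i
  proof (rule ccontr)
    assume "\<not> ?thesis"
    then have e: "?N i = ?N (Suc i)" using seq_le[OF ga fg', of i] by simp
    show False
    proof (cases "even i")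
      case True
      then obtain m where m: "i = 2 * m" by blast
      have "(fx ^^ m) g = (fx ^^ m) a" using e unfolding m seq_even seq_odd .
      then have "(fx ^^ (Suc k - m)) ((fx ^^ m) g) = (fx ^^ (Suc k - m)) ((fx ^^ m) a)" by simp
      moreover have "m \<le> Suc k" using i m by simp
      ultimately have "(fx ^^ Suc k) g = (fx ^^ Suc k) a"
        by (metis comp_apply funpow_add le_add_diff_inverse2)
      then have "?S (Suc (2 * k)) = ?S (2 * Suc k)" using eq unfolding seq_even seq_odd by simp
      then show False using lt[of "Suc (2 * k)"] kt by simp
    next
      case False
      then obtain m where m: "i = Suc (2 * m)" by (auto elim: oddE)
      have "(fx ^^ m) a = (fx ^^ Suc m) g"
        using e seq_odd[of g a m] seq_even[of g a "Suc m"] unfolding m by simp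
      then have "(fx ^^ (k - m)) ((fx ^^ m) a) = (fx ^^ (k - m)) ((fx ^^ Suc m) g)" by simp
      moreover have "m \<le> k" using i m by simp
      ultimately have "(fx ^^ k) a = (fx ^^ Suc k) g"
        by (metis Suc_diff_le comp_apply diff_Suc_Suc funpow_add le_add_diff_inverse2 add_Suc_right)
      then have "?S (2 * k) = ?S (Suc (2 * k))" using eq unfolding seq_even seq_odd by simp
      then show False using lt[of "2 * k"] kt by simp
    qed
  qed
  have "a - g \<le> plen A g" using fg' gv by (simp add: fx_def vx_vertex)
  then obtain N where N: "interval_of N (vx g, a - g)"
    using interval_of_exists[OF gv] vx_vertex[OF gv] by auto
  obtain Z where Z: "syz A (Suc (2 * k)) N Z" using syz_exists[OF N] by blast
  obtain X where X: "syz A (2 * k) S X" using syz_exists[OF S] by blast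
  have omN: "(om ^^ Suc (2 * k)) (vx g, a - g)
      = (vx (?N (Suc (2 * k))), ?N (Suc (Suc (2 * k))) - ?N (Suc (2 * k)))"
    by (rule om_seq) (rule ltN)
  have "interval_of Z (vx (?N (Suc (2 * k))), ?N (Suc (Suc (2 * k))) - ?N (Suc (2 * k)))"
    using syz_interval_of[OF N Z] unfolding omN .
  moreover have "?N (Suc (2 * k)) = (fx ^^ k) a" by (rule seq_odd)
  moreover have "?N (Suc (Suc (2 * k))) = (fx ^^ k) (Suc a)"
    using seq_even[of g a "Suc k"] eq by simp
  ultimately have IZ: "interval_of Z (vx ((fx ^^ k) a), (fx ^^ k) (Suc a) - (fx ^^ k) a)" by simp
  have "(om ^^ (2 * k)) (vx a, 1) = (vx (?S (2 * k)), ?S (Suc (2 * k)) - ?S (2 * k))"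
    using om_seq[of "2 * k" a "Suc a"] lt kt by simp
  then have IX: "interval_of X (vx ((fx ^^ k) a), (fx ^^ k) (Suc a) - (fx ^^ k) a)"
    using syz_interval_of[OF S X] unfolding seq_even seq_odd by simp
  have "iso A X Z" using IX IZ interval_iso unfolding interval_of_def by blast
  moreover have "wfA A N" using N is_intervalD(1) by (auto simp: interval_of_def)
  ultimately have "kth_syzygy_module A (2 * k + 1) X" using syz_kth_syzygy[OF _ Z] by simp
  then show ?thesis using X kt by blast
qed

end

text \<open>The second assumption allows a smaller witness because \<open>imp_deloop\<close> may
  produce delooping only at an even order below the given one.\<close>

lemma Inf_enat_eqI:
  assumes "\<And>t. P t \<Longrightarrow> Q t" and "\<And>t. Q t \<Longrightarrow> \<exists>t'\<le>t. P t'"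
  shows "Inf {enat t | t. P t} = Inf {enat t | t. Q t}"
proof (rule antisym)
  show "Inf {enat t | t. P t} \<le> Inf {enat t | t. Q t}"
  proof (rule Inf_mono)
    fix b assume "b \<in> {enat t | t. Q t}"
    then obtain t where "b = enat t" "Q t" by blast
    then show "\<exists>a\<in>{enat t | t. P t}. a \<le> b" using assms(2)[of t] by auto
  qed
  show "Inf {enat t | t. Q t} \<le> Inf {enat t | t. P t}"
    by (rule Inf_superset_mono) (use assms(1) in auto)
qed

theorem theorem3p7:
  fixes A :: "'k::field nak" and S :: "'k rep"
  assumes "nakayama A" and "simple_mod A S"
  shows "delooping_level A S = e_inv A S"
proof -
  interpret nakayama_algebra A by unfold_locales fact
  obtain i y where y: "is_interval A S i 1 y" using simple_is_interval[OF assms(2)] by blast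
  let ?E = "SOME E. \<exists>\<iota>. inj_envelope A S E \<iota>"
  obtain g l where g: "g < nv A" "0 < l" "l \<le> plen A g" "tgt A g (l - 1) = i"
    and mx: "\<And>g' l'. g' < nv A \<Longrightarrow> 0 < l' \<Longrightarrow> l' \<le> plen A g' \<Longrightarrow> tgt A g' (l' - 1) = i \<Longrightarrow> l' \<le> l"
    and E: "interval_of ?E (g, l)"
    using simple_inj_envelope[OF y] by blast
  \<comment> \<open>The envelope is placed at position \<open>g\<close>; \<open>a\<close> is its
    last position and lies over the vertex of \<open>S\<close>.\<close>
  define a where "a = g + l - 1"
  have vg: "vx g = g" using vx_vertex[OF g(1)] .
  have va: "vx a = i" using tgt_vx[of g "l - 1"] g by (simp add: vg a_def)
  interpret unrolled_envelope A g a
  proof unfold_locales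
    show "g \<le> a" using g(2) by (simp add: a_def)
    show "Suc a \<le> fx g" using g by (simp add: a_def fx_def vg)
    fix z q assume z: "z < g + per * q"
    show "fx z \<le> a + per * q"
    proof (rule ccontr)
      assume "\<not> ?thesis"
      then have gt: "a + per * q < z + plen A (vx z)" by (simp add: fx_def)
      \<comment> \<open>If the projective at \<open>z\<close> reached beyond the translate of
        \<open>a\<close>, its quotient ending exactly there would be longer than the
        envelope.\<close>
      define l' where "l' = Suc (a + per * q) - z"
      have za: "z \<le> a + per * q" using z g(2) by (simp add: a_def)
      have l': "0 < l'" "l' \<le> plen A (vx z)" using gt za by (auto simp: l'_def)
      have "vx z < nv A" using plen_valid[of 0 "vx z"] l' by (simp add: valid_path_def)
      moreover have "tgt A (vx z) (l' - 1) = i"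
        using za by (simp add: tgt_vx l'_def vx_per va)
      ultimately have "l' \<le> l" using mx l' by blast
      then show False using z g(2) by (simp add: l'_def a_def)
    qed
  qed
  have S: "interval_of S (vx a, 1)" using y va by (auto simp: interval_of_def)
  have E': "interval_of ?E (vx g, Suc a - g)" using E g(2) by (simp add: vg a_def)
  have "e_inv A S = Inf ({enat m | m. snd ((om ^^ Suc m) (vx a, 1)) = 0}
      \<union> {enat m | m. snd ((om ^^ Suc m) (vx g, Suc a - g)) = 0})"
    unfolding e_inv_def pdim_interval[OF S] pdim_interval[OF E'] Inf_union_distrib inf_min ..
  also have "\<dots> = Inf {enat m | m. snd ((om ^^ Suc m) (vx a, 1)) = 0
      \<or> snd ((om ^^ Suc m) (vx g, Suc a - g)) = 0}"
    by (rule arg_cong[of _ _ Inf]) blast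
  also have "\<dots> = delooping_level A S"
    unfolding delooping_level_def
  proof (rule Inf_enat_eqI[symmetric])
    fix t assume "\<exists>X. syz A t S X \<and> kth_syzygy_module A (t + 1) X"
    then obtain X where "syz A t S X" "kth_syzygy_module A (t + 1) X" by blast
    then show "snd ((om ^^ Suc t) (vx a, 1)) = 0 \<or> snd ((om ^^ Suc t) (vx g, Suc a - g)) = 0"
      by (rule deloop_imp[OF S])
  qed (rule imp_deloop[OF S g(1)])
  finally show ?thesis by simp
qed

end
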